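(* Let $A$ be a Noetherian commutative monoid object in $(\mathbf C,\otimes,1)$. Then $\mathcal E(A)$ is a Noetherian ring.
   Context: Standing assumptions: $(\mathbf C,\otimes,1)$ is an abelian symmetric monoidal category with small limits and small colimits such that for every object $X$ the functor $-\otimes X$ preserves colimits. $Comm(\mathbf C)$ is the category of unital commutative monoid objects in $\mathbf C$ (all monoids are unital and commutative), and $A\text{-}Mod$ is the category of modules over $A\in Comm(\mathbf C)$. For every monoid $A$, filtered colimits commute with finite limits in $A\text{-}Mod$. Moreover: (C1) $Hom_{\mathbf C}(1,-)$ preserves filtered colimits, and for every monoid $A$ and every finite (not necessarily filtered) system of $A$-modules of the form $\{A^{r_i}\}_{i\in I}$, $r_i\ge 0$, the canonical map $colim_{i}\,Hom_{A-Mod}(A,A^{r_i})\to Hom_{A-Mod}(A,colim_i A^{r_i})$ is an isomorphism. (C2) For every monoid $A$, every object of $A\text{-}Mod$ is a directed colimit of finitely presented objects, where $M$ is finitely presented if $Hom_{A-Mod}(M,-)$ preserves directed colimits. $\mathcal E(A):=Hom_{A-Mod}(A,A)$, a commutative ring under composition. An object $N$ of $A\text{-}Mod$ is finitely generated if for every filtered inductive system $\{M_i\}_{i\in I}$ in $A\text{-}Mod$ connected by monomorphisms, with $M=colim_iM_i$, the canonical map $colim_i Hom_{A-Mod}(N,M_i)\to Hom_{A-Mod}(N,M)$ is a bijection. The monoid $A$ is Noetherian if every subobject of $A$ in $A\text{-}Mod$ is finitely generated in $A\text{-}Mod$. *)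

theory Defs
  imports
    "HOL-Library.Equipollence"
    "HOL-Library.Countable_Set"
    "HOL-Algebra.Product_Groups"
    "HOL-Algebra.Ring_Divisibility"
begin

section \<open>Categories, functors, limits and colimits\<close>

text \<open>
  Hom-sets are not required to be pairwise disjoint, and composition does not take the objects
  as arguments.  Every category is isomorphic to one of this form (make its hom-sets disjoint), and
  the category of modules over a monoid can then have arrows of the ambient category as its arrows.
\<close>

record ('o, 'a) cat =
  Ob :: "'o set"
  Hom :: "'o \<Rightarrow> 'o \<Rightarrow> 'a set"
  idt :: "'o \<Rightarrow> 'a"
  cmp :: "'a \<Rightarrow> 'a \<Rightarrow> 'a" (infixr "\<cdot>\<index>" 75)

locale category =
  fixes C :: "('o, 'a, 'm) cat_scheme" (structure)
  assumes idt_in: "X \<in> Ob C \<Longrightarrow> idt C X \<in> Hom C X X"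
    and cmp_in: "\<lbrakk>X \<in> Ob C; Y \<in> Ob C; Z \<in> Ob C; f \<in> Hom C X Y; g \<in> Hom C Y Z\<rbrakk>
                  \<Longrightarrow> g \<cdot> f \<in> Hom C X Z"
    and idt_left: "\<lbrakk>X \<in> Ob C; Y \<in> Ob C; f \<in> Hom C X Y\<rbrakk> \<Longrightarrow> idt C Y \<cdot> f = f"
    and idt_right: "\<lbrakk>X \<in> Ob C; Y \<in> Ob C; f \<in> Hom C X Y\<rbrakk> \<Longrightarrow> f \<cdot> idt C X = f"
    and cmp_assoc: "\<lbrakk>W \<in> Ob C; X \<in> Ob C; Y \<in> Ob C; Z \<in> Ob C;
                     f \<in> Hom C W X; g \<in> Hom C X Y; h \<in> Hom C Y Z\<rbrakk>
                  \<Longrightarrow> (h \<cdot> g) \<cdot> f = h \<cdot> (g \<cdot> f)"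

definition is_iso :: "('o, 'a, 'm) cat_scheme \<Rightarrow> 'o \<Rightarrow> 'o \<Rightarrow> 'a \<Rightarrow> bool" where
  "is_iso C X Y f \<longleftrightarrow> f \<in> Hom C X Y \<and>
     (\<exists>g \<in> Hom C Y X. g \<cdot>\<^bsub>C\<^esub> f = idt C X \<and> f \<cdot>\<^bsub>C\<^esub> g = idt C Y)"

definition is_mono :: "('o, 'a, 'm) cat_scheme \<Rightarrow> 'o \<Rightarrow> 'o \<Rightarrow> 'a \<Rightarrow> bool" where
  "is_mono C X Y f \<longleftrightarrow> f \<in> Hom C X Y \<and>
     (\<forall>W \<in> Ob C. \<forall>g \<in> Hom C W X. \<forall>h \<in> Hom C W X. f \<cdot>\<^bsub>C\<^esub> g = f \<cdot>\<^bsub>C\<^esub> h \<longrightarrow> g = h)"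

definition is_epi :: "('o, 'a, 'm) cat_scheme \<Rightarrow> 'o \<Rightarrow> 'o \<Rightarrow> 'a \<Rightarrow> bool" where
  "is_epi C X Y f \<longleftrightarrow> f \<in> Hom C X Y \<and>
     (\<forall>Z \<in> Ob C. \<forall>g \<in> Hom C Y Z. \<forall>h \<in> Hom C Y Z. g \<cdot>\<^bsub>C\<^esub> f = h \<cdot>\<^bsub>C\<^esub> f \<longrightarrow> g = h)"

text \<open>The arrow part of a functor also receives source and target, as hom-sets may overlap.\<close>

record ('i, 'j, 'o, 'a) diagram =
  dob :: "'i \<Rightarrow> 'o"
  dar :: "'i \<Rightarrow> 'i \<Rightarrow> 'j \<Rightarrow> 'a"

definition is_functor ::
  "('i, 'j, 'k) cat_scheme \<Rightarrow> ('o, 'a, 'm) cat_scheme \<Rightarrow> ('i, 'j, 'o, 'a) diagram \<Rightarrow> bool" where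
  "is_functor J C D \<longleftrightarrow> category J \<and> category C \<and>
     (\<forall>i \<in> Ob J. dob D i \<in> Ob C) \<and>
     (\<forall>i \<in> Ob J. \<forall>j \<in> Ob J. \<forall>u \<in> Hom J i j. dar D i j u \<in> Hom C (dob D i) (dob D j)) \<and>
     (\<forall>i \<in> Ob J. dar D i i (idt J i) = idt C (dob D i)) \<and>
     (\<forall>i \<in> Ob J. \<forall>j \<in> Ob J. \<forall>k \<in> Ob J. \<forall>u \<in> Hom J i j. \<forall>v \<in> Hom J j k.
        dar D i k (v \<cdot>\<^bsub>J\<^esub> u) = dar D j k v \<cdot>\<^bsub>C\<^esub> dar D i j u)"

definition is_cocone ::
  "('i, 'j, 'k) cat_scheme \<Rightarrow> ('o, 'a, 'm) cat_scheme \<Rightarrow> ('i, 'j, 'o, 'a) diagram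
     \<Rightarrow> 'o \<Rightarrow> ('i \<Rightarrow> 'a) \<Rightarrow> bool" where
  "is_cocone J C D L l \<longleftrightarrow> L \<in> Ob C \<and>
     (\<forall>i \<in> Ob J. l i \<in> Hom C (dob D i) L) \<and>
     (\<forall>i \<in> Ob J. \<forall>j \<in> Ob J. \<forall>u \<in> Hom J i j. l j \<cdot>\<^bsub>C\<^esub> dar D i j u = l i)"

definition is_colimit ::
  "('i, 'j, 'k) cat_scheme \<Rightarrow> ('o, 'a, 'm) cat_scheme \<Rightarrow> ('i, 'j, 'o, 'a) diagram
     \<Rightarrow> 'o \<Rightarrow> ('i \<Rightarrow> 'a) \<Rightarrow> bool" where
  "is_colimit J C D L l \<longleftrightarrow> is_cocone J C D L l \<and>
     (\<forall>M m. is_cocone J C D M m \<longrightarrow> (\<exists>!h. h \<in> Hom C L M \<and> (\<forall>i \<in> Ob J. h \<cdot>\<^bsub>C\<^esub> l i = m i)))"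

definition is_cone ::
  "('i, 'j, 'k) cat_scheme \<Rightarrow> ('o, 'a, 'm) cat_scheme \<Rightarrow> ('i, 'j, 'o, 'a) diagram
     \<Rightarrow> 'o \<Rightarrow> ('i \<Rightarrow> 'a) \<Rightarrow> bool" where
  "is_cone J C D L l \<longleftrightarrow> L \<in> Ob C \<and>
     (\<forall>i \<in> Ob J. l i \<in> Hom C L (dob D i)) \<and>
     (\<forall>i \<in> Ob J. \<forall>j \<in> Ob J. \<forall>u \<in> Hom J i j. dar D i j u \<cdot>\<^bsub>C\<^esub> l i = l j)"

definition is_limit ::
  "('i, 'j, 'k) cat_scheme \<Rightarrow> ('o, 'a, 'm) cat_scheme \<Rightarrow> ('i, 'j, 'o, 'a) diagram
     \<Rightarrow> 'o \<Rightarrow> ('i \<Rightarrow> 'a) \<Rightarrow> bool" where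
  "is_limit J C D L l \<longleftrightarrow> is_cone J C D L l \<and>
     (\<forall>M m. is_cone J C D M m \<longrightarrow> (\<exists>!h. h \<in> Hom C M L \<and> (\<forall>i \<in> Ob J. l i \<cdot>\<^bsub>C\<^esub> h = m i)))"

section \<open>Smallness, filtered and directed index categories\<close>

definition arrows :: "('i, 'j, 'k) cat_scheme \<Rightarrow> ('i \<times> 'i \<times> 'j) set" where
  "arrows J = {(i, j, u). i \<in> Ob J \<and> j \<in> Ob J \<and> u \<in> Hom J i j}"

text \<open>
  The set \<open>U\<close> plays the role of a universe: a category is small if it has fewer than \<open>|U|\<close> arrows.
  Only uncountability of \<open>U\<close> will be assumed, so that \<open>U\<close> may be any Grothendieck universe.
  Index categories have their objects and arrows in the type of \<open>U\<close>; up to isomorphism, these are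
  all the small categories.  Identities embed the objects into the arrows, so it suffices to
  bound the arrows.
\<close>

definition small_cat :: "'u set \<Rightarrow> ('i, 'j, 'k) cat_scheme \<Rightarrow> bool" where
  "small_cat U J \<longleftrightarrow> category J \<and> arrows J \<prec> U"

definition finite_cat :: "('i, 'j, 'k) cat_scheme \<Rightarrow> bool" where
  "finite_cat J \<longleftrightarrow> category J \<and> finite (arrows J)"

definition filtered_cat :: "('i, 'j, 'k) cat_scheme \<Rightarrow> bool" where
  "filtered_cat J \<longleftrightarrow> category J \<and> Ob J \<noteq> {} \<and>
     (\<forall>i \<in> Ob J. \<forall>j \<in> Ob J. \<exists>k \<in> Ob J. Hom J i k \<noteq> {} \<and> Hom J j k \<noteq> {}) \<and>
     (\<forall>i \<in> Ob J. \<forall>j \<in> Ob J. \<forall>u \<in> Hom J i j. \<forall>v \<in> Hom J i j.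
        \<exists>k \<in> Ob J. \<exists>w \<in> Hom J j k. w \<cdot>\<^bsub>J\<^esub> u = w \<cdot>\<^bsub>J\<^esub> v)"

text \<open>A directed (pre)ordered set, seen as a category.\<close>

definition directed_cat :: "('i, 'j, 'k) cat_scheme \<Rightarrow> bool" where
  "directed_cat J \<longleftrightarrow> filtered_cat J \<and>
     (\<forall>i \<in> Ob J. \<forall>j \<in> Ob J. \<forall>u \<in> Hom J i j. \<forall>v \<in> Hom J i j. u = v)"

definition has_small_colimits :: "'u set \<Rightarrow> ('o, 'a, 'm) cat_scheme \<Rightarrow> bool" where
  "has_small_colimits U C \<longleftrightarrow>
     (\<forall>(J :: ('u, 'u) cat) D. small_cat U J \<and> is_functor J C D \<longrightarrow> (\<exists>L l. is_colimit J C D L l))"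

definition has_small_limits :: "'u set \<Rightarrow> ('o, 'a, 'm) cat_scheme \<Rightarrow> bool" where
  "has_small_limits U C \<longleftrightarrow>
     (\<forall>(J :: ('u, 'u) cat) D. small_cat U J \<and> is_functor J C D \<longrightarrow> (\<exists>L l. is_limit J C D L l))"

section \<open>Filtered colimits commute with finite limits\<close>

definition prod_cat ::
  "('i, 'j, 'k) cat_scheme \<Rightarrow> ('p, 'q, 'r) cat_scheme \<Rightarrow> ('i \<times> 'p, 'j \<times> 'q) cat" where
  "prod_cat J K = \<lparr>Ob = Ob J \<times> Ob K,
     Hom = (\<lambda>x y. Hom J (fst x) (fst y) \<times> Hom K (snd x) (snd y)),
     idt = (\<lambda>x. (idt J (fst x), idt K (snd x))),
     cmp = (\<lambda>g f. (fst g \<cdot>\<^bsub>J\<^esub> fst f, snd g \<cdot>\<^bsub>K\<^esub> snd f))\<rparr>"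

text \<open>The functors \<open>D (j, -)\<close> and \<open>D (-, k)\<close> obtained from a functor \<open>D\<close> on \<open>prod_cat J K\<close>.\<close>

definition slice_fst :: "('i, 'j, 'k) cat_scheme \<Rightarrow> ('i \<times> 'p, 'j \<times> 'q, 'o, 'a) diagram
     \<Rightarrow> 'i \<Rightarrow> ('p, 'q, 'o, 'a) diagram" where
  "slice_fst J D j = \<lparr>dob = (\<lambda>k. dob D (j, k)),
     dar = (\<lambda>k k' v. dar D (j, k) (j, k') (idt J j, v))\<rparr>"

definition slice_snd :: "('p, 'q, 'k) cat_scheme \<Rightarrow> ('i \<times> 'p, 'j \<times> 'q, 'o, 'a) diagram
     \<Rightarrow> 'p \<Rightarrow> ('i, 'j, 'o, 'a) diagram" where
  "slice_snd K D k = \<lparr>dob = (\<lambda>j. dob D (j, k)),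
     dar = (\<lambda>j j' u. dar D (j, k) (j', k) (u, idt K k))\<rparr>"

text \<open>
  For \<open>D : J \<times> K \<rightarrow> C\<close>, let \<open>F j = lim\<^sub>k D (j, k)\<close> with projections \<open>p j k\<close>, functorial in \<open>j\<close>, and
  \<open>G k = colim\<^sub>j D (j, k)\<close> with coprojections \<open>c k j\<close>, functorial in \<open>k\<close>.  Let \<open>X = colim\<^sub>j F j\<close> and
  \<open>Y = lim\<^sub>k G k\<close>.  The canonical map \<open>h : X \<rightarrow> Y\<close>, which exists uniquely by the universal properties,
  is the one compatible with all \<open>p j k\<close> and \<open>c k j\<close>.
\<close>

definition filtered_colimits_commute_with_finite_limits ::
  "'u set \<Rightarrow> ('o, 'a, 'm) cat_scheme \<Rightarrow> bool" where
  "filtered_colimits_commute_with_finite_limits U C \<longleftrightarrow>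
     (\<forall>(J :: ('u, 'u) cat) (K :: ('u, 'u) cat) D F p G c X x Y y h.
        small_cat U J \<and> filtered_cat J \<and> finite_cat K \<and> is_functor (prod_cat J K) C D \<and>
        is_functor J C F \<and>
        (\<forall>j \<in> Ob J. is_limit K C (slice_fst J D j) (dob F j) (p j)) \<and>
        (\<forall>j \<in> Ob J. \<forall>j' \<in> Ob J. \<forall>u \<in> Hom J j j'. \<forall>k \<in> Ob K.
           p j' k \<cdot>\<^bsub>C\<^esub> dar F j j' u = dar D (j, k) (j', k) (u, idt K k) \<cdot>\<^bsub>C\<^esub> p j k) \<and>
        is_functor K C G \<and>
        (\<forall>k \<in> Ob K. is_colimit J C (slice_snd K D k) (dob G k) (c k)) \<and>
        (\<forall>k \<in> Ob K. \<forall>k' \<in> Ob K. \<forall>v \<in> Hom K k k'. \<forall>j \<in> Ob J.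
           dar G k k' v \<cdot>\<^bsub>C\<^esub> c k j = c k' j \<cdot>\<^bsub>C\<^esub> dar D (j, k) (j, k') (idt J j, v)) \<and>
        is_colimit J C F X x \<and> is_limit K C G Y y \<and>
        h \<in> Hom C X Y \<and>
        (\<forall>j \<in> Ob J. \<forall>k \<in> Ob K. y k \<cdot>\<^bsub>C\<^esub> (h \<cdot>\<^bsub>C\<^esub> x j) = c k j \<cdot>\<^bsub>C\<^esub> p j k)
        \<longrightarrow> is_iso C X Y h)"

section \<open>Hom-functors and colimits of sets\<close>

text \<open>
  The colimit of a diagram of sets \<open>S i\<close> with transition maps \<open>T i j u\<close>: the disjoint union modulo
  the equivalence relation generated by \<open>(i, x) \<sim> (j, T i j u x)\<close>.
\<close>

definition set_colim_step ::
  "('i, 'j, 'k) cat_scheme \<Rightarrow> ('i \<Rightarrow> 's set) \<Rightarrow> ('i \<Rightarrow> 'i \<Rightarrow> 'j \<Rightarrow> 's \<Rightarrow> 's)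
     \<Rightarrow> (('i \<times> 's) \<times> ('i \<times> 's)) set" where
  "set_colim_step J S T = {((i, x), (j, T i j u x)) | i j u x.
     i \<in> Ob J \<and> j \<in> Ob J \<and> u \<in> Hom J i j \<and> x \<in> S i}"

definition set_colim ::
  "('i, 'j, 'k) cat_scheme \<Rightarrow> ('i \<Rightarrow> 's set) \<Rightarrow> ('i \<Rightarrow> 'i \<Rightarrow> 'j \<Rightarrow> 's \<Rightarrow> 's) \<Rightarrow> ('i \<times> 's) set set"
  where
  "set_colim J S T =
     (SIGMA i : Ob J. S i) // ((set_colim_step J S T \<union> (set_colim_step J S T)\<inverse>)\<^sup>*)"

text \<open>
  For a colimit cocone \<open>l i : D i \<rightarrow> L\<close>, the canonical map from \<open>colim\<^sub>i Hom(N, D i)\<close> to \<open>Hom(N, L)\<close>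
  sends the class of \<open>(i, f)\<close> to \<open>l i \<cdot> f\<close>.
\<close>

definition hom_preserves_colimit ::
  "('o, 'a, 'm) cat_scheme \<Rightarrow> 'o \<Rightarrow> ('i, 'j, 'k) cat_scheme \<Rightarrow> ('i, 'j, 'o, 'a) diagram
     \<Rightarrow> 'o \<Rightarrow> ('i \<Rightarrow> 'a) \<Rightarrow> bool" where
  "hom_preserves_colimit C N J D L l \<longleftrightarrow>
     bij_betw (\<lambda>c. the_elem ((\<lambda>(i, f). l i \<cdot>\<^bsub>C\<^esub> f) ` c))
       (set_colim J (\<lambda>i. Hom C N (dob D i)) (\<lambda>i j u f. dar D i j u \<cdot>\<^bsub>C\<^esub> f))
       (Hom C N L)"

definition hom_preserves_filtered_colimits :: "'u set \<Rightarrow> ('o, 'a, 'm) cat_scheme \<Rightarrow> 'o \<Rightarrow> bool" where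
  "hom_preserves_filtered_colimits U C N \<longleftrightarrow>
     (\<forall>(J :: ('u, 'u) cat) D L l. small_cat U J \<and> filtered_cat J \<and> is_functor J C D \<and>
        is_colimit J C D L l \<longrightarrow> hom_preserves_colimit C N J D L l)"

definition finitely_presented :: "'u set \<Rightarrow> ('o, 'a, 'm) cat_scheme \<Rightarrow> 'o \<Rightarrow> bool" where
  "finitely_presented U C N \<longleftrightarrow> N \<in> Ob C \<and>
     (\<forall>(J :: ('u, 'u) cat) D L l. small_cat U J \<and> directed_cat J \<and> is_functor J C D \<and>
        is_colimit J C D L l \<longrightarrow> hom_preserves_colimit C N J D L l)"

definition finitely_generated :: "'u set \<Rightarrow> ('o, 'a, 'm) cat_scheme \<Rightarrow> 'o \<Rightarrow> bool" where
  "finitely_generated U C N \<longleftrightarrow> N \<in> Ob C \<and>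
     (\<forall>(J :: ('u, 'u) cat) D L l. small_cat U J \<and> filtered_cat J \<and> is_functor J C D \<and>
        (\<forall>i \<in> Ob J. \<forall>j \<in> Ob J. \<forall>u \<in> Hom J i j. is_mono C (dob D i) (dob D j) (dar D i j u)) \<and>
        is_colimit J C D L l \<longrightarrow> hom_preserves_colimit C N J D L l)"

section \<open>Abelian categories\<close>

record ('o, 'a) additive_cat = "('o, 'a) cat" +
  addA :: "'a \<Rightarrow> 'a \<Rightarrow> 'a"
  zeroA :: "'o \<Rightarrow> 'o \<Rightarrow> 'a"

definition hom_group :: "('o, 'a, 'm) additive_cat_scheme \<Rightarrow> 'o \<Rightarrow> 'o \<Rightarrow> 'a monoid" where
  "hom_group C X Y = \<lparr>carrier = Hom C X Y, monoid.mult = addA C, one = zeroA C X Y\<rparr>"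

definition is_zero_object :: "('o, 'a, 'm) cat_scheme \<Rightarrow> 'o \<Rightarrow> bool" where
  "is_zero_object C Z \<longleftrightarrow> Z \<in> Ob C \<and>
     (\<forall>X \<in> Ob C. (\<exists>!f. f \<in> Hom C Z X) \<and> (\<exists>!f. f \<in> Hom C X Z))"

definition is_biproduct ::
  "('o, 'a, 'm) additive_cat_scheme \<Rightarrow> 'o \<Rightarrow> 'o \<Rightarrow> 'o \<Rightarrow> 'a \<Rightarrow> 'a \<Rightarrow> 'a \<Rightarrow> 'a \<Rightarrow> bool" where
  "is_biproduct C X Y P i1 i2 p1 p2 \<longleftrightarrow> P \<in> Ob C \<and>
     i1 \<in> Hom C X P \<and> i2 \<in> Hom C Y P \<and> p1 \<in> Hom C P X \<and> p2 \<in> Hom C P Y \<and>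
     p1 \<cdot>\<^bsub>C\<^esub> i1 = idt C X \<and> p2 \<cdot>\<^bsub>C\<^esub> i2 = idt C Y \<and>
     p1 \<cdot>\<^bsub>C\<^esub> i2 = zeroA C Y X \<and> p2 \<cdot>\<^bsub>C\<^esub> i1 = zeroA C X Y \<and>
     addA C (i1 \<cdot>\<^bsub>C\<^esub> p1) (i2 \<cdot>\<^bsub>C\<^esub> p2) = idt C P"

definition is_kernel ::
  "('o, 'a, 'm) additive_cat_scheme \<Rightarrow> 'o \<Rightarrow> 'o \<Rightarrow> 'a \<Rightarrow> 'o \<Rightarrow> 'a \<Rightarrow> bool" where
  "is_kernel C X Y f K k \<longleftrightarrow> K \<in> Ob C \<and> k \<in> Hom C K X \<and> f \<cdot>\<^bsub>C\<^esub> k = zeroA C K Y \<and>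
     (\<forall>W \<in> Ob C. \<forall>g \<in> Hom C W X. f \<cdot>\<^bsub>C\<^esub> g = zeroA C W Y \<longrightarrow>
        (\<exists>!h. h \<in> Hom C W K \<and> k \<cdot>\<^bsub>C\<^esub> h = g))"

definition is_cokernel ::
  "('o, 'a, 'm) additive_cat_scheme \<Rightarrow> 'o \<Rightarrow> 'o \<Rightarrow> 'a \<Rightarrow> 'o \<Rightarrow> 'a \<Rightarrow> bool" where
  "is_cokernel C X Y f Q q \<longleftrightarrow> Q \<in> Ob C \<and> q \<in> Hom C Y Q \<and> q \<cdot>\<^bsub>C\<^esub> f = zeroA C X Q \<and>
     (\<forall>W \<in> Ob C. \<forall>g \<in> Hom C Y W. g \<cdot>\<^bsub>C\<^esub> f = zeroA C X W \<longrightarrow>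
        (\<exists>!h. h \<in> Hom C Q W \<and> h \<cdot>\<^bsub>C\<^esub> q = g))"

locale abelian_category = category C
  for C :: "('o, 'a, 'm) additive_cat_scheme" (structure) +
  assumes hom_comm_group: "\<lbrakk>X \<in> Ob C; Y \<in> Ob C\<rbrakk> \<Longrightarrow> comm_group (hom_group C X Y)"
    and cmp_add_right:
      "\<lbrakk>X \<in> Ob C; Y \<in> Ob C; Z \<in> Ob C; f \<in> Hom C X Y; f' \<in> Hom C X Y; g \<in> Hom C Y Z\<rbrakk>
        \<Longrightarrow> g \<cdot> addA C f f' = addA C (g \<cdot> f) (g \<cdot> f')"
    and cmp_add_left:
      "\<lbrakk>X \<in> Ob C; Y \<in> Ob C; Z \<in> Ob C; f \<in> Hom C X Y; g \<in> Hom C Y Z; g' \<in> Hom C Y Z\<rbrakk>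
        \<Longrightarrow> addA C g g' \<cdot> f = addA C (g \<cdot> f) (g' \<cdot> f)"
    and ex_zero_object: "\<exists>Z. is_zero_object C Z"
    and ex_biproduct:
      "\<lbrakk>X \<in> Ob C; Y \<in> Ob C\<rbrakk> \<Longrightarrow> \<exists>P i1 i2 p1 p2. is_biproduct C X Y P i1 i2 p1 p2"
    and ex_kernel:
      "\<lbrakk>X \<in> Ob C; Y \<in> Ob C; f \<in> Hom C X Y\<rbrakk> \<Longrightarrow> \<exists>K k. is_kernel C X Y f K k"
    and ex_cokernel:
      "\<lbrakk>X \<in> Ob C; Y \<in> Ob C; f \<in> Hom C X Y\<rbrakk> \<Longrightarrow> \<exists>Q q. is_cokernel C X Y f Q q"
    and mono_normal:
      "\<lbrakk>X \<in> Ob C; Y \<in> Ob C; is_mono C X Y f\<rbrakk>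
        \<Longrightarrow> \<exists>Z \<in> Ob C. \<exists>g \<in> Hom C Y Z. is_kernel C Y Z g X f"
    and epi_normal:
      "\<lbrakk>X \<in> Ob C; Y \<in> Ob C; is_epi C X Y f\<rbrakk>
        \<Longrightarrow> \<exists>W \<in> Ob C. \<exists>g \<in> Hom C W X. is_cokernel C W X g Y f"

section \<open>Symmetric monoidal categories, commutative monoids and modules\<close>

record ('o, 'a) monoidal_cat = "('o, 'a) additive_cat" +
  tenO :: "'o \<Rightarrow> 'o \<Rightarrow> 'o" (infixr "\<boxtimes>\<index>" 80)
  tenA :: "'a \<Rightarrow> 'a \<Rightarrow> 'a" (infixr "\<boxtimes>\<^sub>a\<index>" 80)
  unitO :: "'o"
  assocA :: "'o \<Rightarrow> 'o \<Rightarrow> 'o \<Rightarrow> 'a"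
  lunitA :: "'o \<Rightarrow> 'a"
  runitA :: "'o \<Rightarrow> 'a"
  braidA :: "'o \<Rightarrow> 'o \<Rightarrow> 'a"

locale symmetric_monoidal_category = category C
  for C :: "('o, 'a, 'm) monoidal_cat_scheme" (structure) +
  assumes unit_ob: "unitO C \<in> Ob C"
    and ten_ob: "\<lbrakk>X \<in> Ob C; Y \<in> Ob C\<rbrakk> \<Longrightarrow> X \<boxtimes> Y \<in> Ob C"
    and ten_ar: "\<lbrakk>X \<in> Ob C; X' \<in> Ob C; Y \<in> Ob C; Y' \<in> Ob C; f \<in> Hom C X X'; g \<in> Hom C Y Y'\<rbrakk>
                  \<Longrightarrow> f \<boxtimes>\<^sub>a g \<in> Hom C (X \<boxtimes> Y) (X' \<boxtimes> Y')"
    and ten_idt: "\<lbrakk>X \<in> Ob C; Y \<in> Ob C\<rbrakk> \<Longrightarrow> idt C X \<boxtimes>\<^sub>a idt C Y = idt C (X \<boxtimes> Y)"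
    and ten_cmp:
      "\<lbrakk>X \<in> Ob C; X' \<in> Ob C; X'' \<in> Ob C; Y \<in> Ob C; Y' \<in> Ob C; Y'' \<in> Ob C;
        f \<in> Hom C X X'; f' \<in> Hom C X' X''; g \<in> Hom C Y Y'; g' \<in> Hom C Y' Y''\<rbrakk>
        \<Longrightarrow> (f' \<cdot> f) \<boxtimes>\<^sub>a (g' \<cdot> g) = (f' \<boxtimes>\<^sub>a g') \<cdot> (f \<boxtimes>\<^sub>a g)"
    and assoc_iso:
      "\<lbrakk>X \<in> Ob C; Y \<in> Ob C; Z \<in> Ob C\<rbrakk>
        \<Longrightarrow> is_iso C ((X \<boxtimes> Y) \<boxtimes> Z) (X \<boxtimes> (Y \<boxtimes> Z)) (assocA C X Y Z)"
    and lunit_iso: "X \<in> Ob C \<Longrightarrow> is_iso C (unitO C \<boxtimes> X) X (lunitA C X)"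
    and runit_iso: "X \<in> Ob C \<Longrightarrow> is_iso C (X \<boxtimes> unitO C) X (runitA C X)"
    and braid_iso: "\<lbrakk>X \<in> Ob C; Y \<in> Ob C\<rbrakk> \<Longrightarrow> is_iso C (X \<boxtimes> Y) (Y \<boxtimes> X) (braidA C X Y)"
    and assoc_nat:
      "\<lbrakk>X \<in> Ob C; X' \<in> Ob C; Y \<in> Ob C; Y' \<in> Ob C; Z \<in> Ob C; Z' \<in> Ob C;
        f \<in> Hom C X X'; g \<in> Hom C Y Y'; h \<in> Hom C Z Z'\<rbrakk>
        \<Longrightarrow> assocA C X' Y' Z' \<cdot> ((f \<boxtimes>\<^sub>a g) \<boxtimes>\<^sub>a h) = (f \<boxtimes>\<^sub>a (g \<boxtimes>\<^sub>a h)) \<cdot> assocA C X Y Z"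
    and lunit_nat:
      "\<lbrakk>X \<in> Ob C; X' \<in> Ob C; f \<in> Hom C X X'\<rbrakk>
        \<Longrightarrow> lunitA C X' \<cdot> (idt C (unitO C) \<boxtimes>\<^sub>a f) = f \<cdot> lunitA C X"
    and runit_nat:
      "\<lbrakk>X \<in> Ob C; X' \<in> Ob C; f \<in> Hom C X X'\<rbrakk>
        \<Longrightarrow> runitA C X' \<cdot> (f \<boxtimes>\<^sub>a idt C (unitO C)) = f \<cdot> runitA C X"
    and braid_nat:
      "\<lbrakk>X \<in> Ob C; X' \<in> Ob C; Y \<in> Ob C; Y' \<in> Ob C; f \<in> Hom C X X'; g \<in> Hom C Y Y'\<rbrakk>
        \<Longrightarrow> braidA C X' Y' \<cdot> (f \<boxtimes>\<^sub>a g) = (g \<boxtimes>\<^sub>a f) \<cdot> braidA C X Y"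
    and pentagon:
      "\<lbrakk>W \<in> Ob C; X \<in> Ob C; Y \<in> Ob C; Z \<in> Ob C\<rbrakk>
        \<Longrightarrow> assocA C W X (Y \<boxtimes> Z) \<cdot> assocA C (W \<boxtimes> X) Y Z
          = (idt C W \<boxtimes>\<^sub>a assocA C X Y Z) \<cdot> assocA C W (X \<boxtimes> Y) Z \<cdot> (assocA C W X Y \<boxtimes>\<^sub>a idt C Z)"
    and triangle:
      "\<lbrakk>X \<in> Ob C; Y \<in> Ob C\<rbrakk>
        \<Longrightarrow> (idt C X \<boxtimes>\<^sub>a lunitA C Y) \<cdot> assocA C X (unitO C) Y = runitA C X \<boxtimes>\<^sub>a idt C Y"
    and hexagon:
      "\<lbrakk>X \<in> Ob C; Y \<in> Ob C; Z \<in> Ob C\<rbrakk>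
        \<Longrightarrow> assocA C Y Z X \<cdot> braidA C X (Y \<boxtimes> Z) \<cdot> assocA C X Y Z
          = (idt C Y \<boxtimes>\<^sub>a braidA C X Z) \<cdot> assocA C Y X Z \<cdot> (braidA C X Y \<boxtimes>\<^sub>a idt C Z)"
    and symmetry:
      "\<lbrakk>X \<in> Ob C; Y \<in> Ob C\<rbrakk> \<Longrightarrow> braidA C Y X \<cdot> braidA C X Y = idt C (X \<boxtimes> Y)"

record ('o, 'a) monoid_object =
  undO :: "'o"
  mulA :: "'a"
  uniA :: "'a"

locale comm_monoid_object =
  fixes C :: "('o, 'a, 'm) monoidal_cat_scheme" (structure) and A :: "('o, 'a) monoid_object"
  assumes und_ob: "undO A \<in> Ob C"
    and mul_in: "mulA A \<in> Hom C (undO A \<boxtimes> undO A) (undO A)"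
    and uni_in: "uniA A \<in> Hom C (unitO C) (undO A)"
    and mul_assoc:
      "mulA A \<cdot> (mulA A \<boxtimes>\<^sub>a idt C (undO A))
        = mulA A \<cdot> (idt C (undO A) \<boxtimes>\<^sub>a mulA A) \<cdot> assocA C (undO A) (undO A) (undO A)"
    and mul_lunit: "mulA A \<cdot> (uniA A \<boxtimes>\<^sub>a idt C (undO A)) = lunitA C (undO A)"
    and mul_runit: "mulA A \<cdot> (idt C (undO A) \<boxtimes>\<^sub>a uniA A) = runitA C (undO A)"
    and mul_comm: "mulA A \<cdot> braidA C (undO A) (undO A) = mulA A"

text \<open>A module is a pair of an object \<open>M\<close> and an action \<open>A \<otimes> M \<rightarrow> M\<close>.\<close>

definition is_module ::
  "('o, 'a, 'm) monoidal_cat_scheme \<Rightarrow> ('o, 'a) monoid_object \<Rightarrow> 'o \<times> 'a \<Rightarrow> bool" where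
  "is_module C A M \<longleftrightarrow> (case M of (X, r) \<Rightarrow>
     X \<in> Ob C \<and> r \<in> Hom C (undO A \<boxtimes>\<^bsub>C\<^esub> X) X \<and>
     r \<cdot>\<^bsub>C\<^esub> (mulA A \<boxtimes>\<^sub>a\<^bsub>C\<^esub> idt C X)
       = r \<cdot>\<^bsub>C\<^esub> (idt C (undO A) \<boxtimes>\<^sub>a\<^bsub>C\<^esub> r) \<cdot>\<^bsub>C\<^esub> assocA C (undO A) (undO A) X \<and>
     r \<cdot>\<^bsub>C\<^esub> (uniA A \<boxtimes>\<^sub>a\<^bsub>C\<^esub> idt C X) = lunitA C X)"

definition module_cat ::
  "('o, 'a, 'm) monoidal_cat_scheme \<Rightarrow> ('o, 'a) monoid_object \<Rightarrow> ('o \<times> 'a, 'a) additive_cat" where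
  "module_cat C A = \<lparr>Ob = {M. is_module C A M},
     Hom = (\<lambda>M N. {f \<in> Hom C (fst M) (fst N).
              f \<cdot>\<^bsub>C\<^esub> snd M = snd N \<cdot>\<^bsub>C\<^esub> (idt C (undO A) \<boxtimes>\<^sub>a\<^bsub>C\<^esub> f)}),
     idt = (\<lambda>M. idt C (fst M)),
     cmp = cmp C,
     addA = addA C,
     zeroA = (\<lambda>M N. zeroA C (fst M) (fst N))\<rparr>"

definition reg_module :: "('o, 'a) monoid_object \<Rightarrow> 'o \<times> 'a" where
  "reg_module A = (undO A, mulA A)"

text \<open>The ring \<open>\<E>(A) = Hom\<^bsub>A-Mod\<^esub>(A, A)\<close>, with composition as multiplication.\<close>

definition end_ring ::
  "('o, 'a, 'm) monoidal_cat_scheme \<Rightarrow> ('o, 'a) monoid_object \<Rightarrow> 'a ring" where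
  "end_ring C A = (let M = module_cat C A; R = reg_module A in
     \<lparr>carrier = Hom M R R, monoid.mult = cmp M, one = idt M R,
      ring.zero = zeroA M R R, ring.add = addA M\<rparr>)"

definition noetherian_monoid ::
  "'u set \<Rightarrow> ('o, 'a, 'm) monoidal_cat_scheme \<Rightarrow> ('o, 'a) monoid_object \<Rightarrow> bool" where
  "noetherian_monoid U C A \<longleftrightarrow>
     (\<forall>N \<in> Ob (module_cat C A). \<forall>m. is_mono (module_cat C A) N (reg_module A) m \<longrightarrow>
        finitely_generated U (module_cat C A) N)"

section \<open>The standing assumptions\<close>

text \<open>\<open>P\<close> is an \<open>r\<close>-fold direct sum (coproduct) of copies of \<open>X\<close>.\<close>

definition is_power :: "('o, 'a, 'm) cat_scheme \<Rightarrow> 'o \<Rightarrow> nat \<Rightarrow> 'o \<Rightarrow> bool" where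
  "is_power C X r P \<longleftrightarrow> P \<in> Ob C \<and> (\<exists>\<iota>. (\<forall>k < r. \<iota> k \<in> Hom C X P) \<and>
     (\<forall>Y \<in> Ob C. \<forall>f. (\<forall>k < r. f k \<in> Hom C X Y) \<longrightarrow>
        (\<exists>!h. h \<in> Hom C P Y \<and> (\<forall>k < r. h \<cdot>\<^bsub>C\<^esub> \<iota> k = f k))))"

text \<open>
  The colimit of a diagram of abelian groups \<open>G i\<close> with transition maps \<open>T i j u\<close>: the direct sum
  modulo the subgroup generated by the elements \<open>\<iota>\<^sub>j (T i j u x) - \<iota>\<^sub>i x\<close>.
\<close>

definition ab_inj ::
  "'i set \<Rightarrow> ('i \<Rightarrow> ('s, 'n) monoid_scheme) \<Rightarrow> 'i \<Rightarrow> 's \<Rightarrow> 'i \<Rightarrow> 's" where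
  "ab_inj I G i x = (\<lambda>k\<in>I. if k = i then x else \<one>\<^bsub>G k\<^esub>)"

definition ab_colim ::
  "('i, 'j, 'k) cat_scheme \<Rightarrow> ('i \<Rightarrow> ('s, 'n) monoid_scheme) \<Rightarrow> ('i \<Rightarrow> 'i \<Rightarrow> 'j \<Rightarrow> 's \<Rightarrow> 's)
     \<Rightarrow> ('i \<Rightarrow> 's) set monoid" where
  "ab_colim J G T = (let S = sum_group (Ob J) G in
     S Mod generate S {ab_inj (Ob J) G j (T i j u x) \<otimes>\<^bsub>S\<^esub> inv\<^bsub>S\<^esub> (ab_inj (Ob J) G i x) | i j u x.
       i \<in> Ob J \<and> j \<in> Ob J \<and> u \<in> Hom J i j \<and> x \<in> carrier (G i)})"

text \<open>
  For a colimit cocone \<open>l i : D i \<rightarrow> L\<close>, the canonical homomorphism from \<open>colim\<^sub>i Hom(N, D i)\<close> (a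
  colimit of abelian groups) to \<open>Hom(N, L)\<close> sends the class of \<open>(f i)\<^sub>i\<close> to the sum of all
  \<open>l i \<cdot> f i\<close>; the product \<open>finprod\<close> is a sum of arrows, as \<open>hom_group\<close> is written multiplicatively.
\<close>

definition hom_preserves_additive_colimit ::
  "('o, 'a, 'm) additive_cat_scheme \<Rightarrow> 'o \<Rightarrow> ('i, 'j, 'k) cat_scheme
     \<Rightarrow> ('i, 'j, 'o, 'a) diagram \<Rightarrow> 'o \<Rightarrow> ('i \<Rightarrow> 'a) \<Rightarrow> bool" where
  "hom_preserves_additive_colimit C N J D L l \<longleftrightarrow>
     (\<lambda>c. the_elem ((\<lambda>f. finprod (hom_group C N L) (\<lambda>i. l i \<cdot>\<^bsub>C\<^esub> f i)
            {i \<in> Ob J. f i \<noteq> zeroA C N (dob D i)}) ` c))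
       \<in> iso (ab_colim J (\<lambda>i. hom_group C N (dob D i)) (\<lambda>i j u f. dar D i j u \<cdot>\<^bsub>C\<^esub> f))
             (hom_group C N L)"

text \<open>
  The second half of (C1) concerns arbitrary finite systems, so the colimit of the \<open>Hom(A, A\<^sup>r)\<close> is
  taken in abelian groups (equivalently \<open>\<E>(A)\<close>-modules).  For filtered systems, where the
  underlying set of this colimit is the colimit of the underlying sets, the latter is used.
\<close>

locale standing_assumptions = abelian_category C + symmetric_monoidal_category C
  for U :: "'u set" and C :: "('o, 'a) monoidal_cat" (structure) +
  assumes universe_uncountable: "uncountable U"
    and small_limits: "has_small_limits U C"
    and small_colimits: "has_small_colimits U C"
    and tensor_preserves_colimits:
      "\<And>(J :: ('u, 'u) cat) D L l X.
        \<lbrakk>X \<in> Ob C; small_cat U J; is_functor J C D; is_colimit J C D L l\<rbrakk> \<Longrightarrow>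
        is_colimit J C
          \<lparr>dob = (\<lambda>i. dob D i \<boxtimes> X), dar = (\<lambda>i j u. dar D i j u \<boxtimes>\<^sub>a idt C X)\<rparr>
          (L \<boxtimes> X) (\<lambda>i. l i \<boxtimes>\<^sub>a idt C X)"
    and filtered_colimits_exact:
      "\<And>A. comm_monoid_object C A \<Longrightarrow>
        filtered_colimits_commute_with_finite_limits U (module_cat C A)"
    and C1_unit: "hom_preserves_filtered_colimits U C (unitO C)"
    and C1_free:
      "\<And>A (J :: ('u, 'u) cat) D L l.
        \<lbrakk>comm_monoid_object C A; finite_cat J; is_functor J (module_cat C A) D;
          \<forall>i \<in> Ob J. \<exists>r. is_power (module_cat C A) (reg_module A) r (dob D i);
          is_colimit J (module_cat C A) D L l\<rbrakk> \<Longrightarrow>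
        hom_preserves_additive_colimit (module_cat C A) (reg_module A) J D L l"
    and C2:
      "\<And>A M. \<lbrakk>comm_monoid_object C A; M \<in> Ob (module_cat C A)\<rbrakk> \<Longrightarrow>
        \<exists>(J :: ('u, 'u) cat) D l. small_cat U J \<and> directed_cat J \<and>
          is_functor J (module_cat C A) D \<and>
          (\<forall>i \<in> Ob J. finitely_presented U (module_cat C A) (dob D i)) \<and>
          is_colimit J (module_cat C A) D M l"

end

theory Submission
  imports Defs
begin

text \<open>
  An endomorphism of \<open>A\<close> is multiplication by an element, so \<open>\<E>(A)\<close> is commutative.  If an ideal \<open>I\<close> is
  not finitely generated, choose finite subsets \<open>F\<^sub>0 \<subseteq> F\<^sub>1 \<subseteq> \<dots>\<close> of \<open>I\<close> such that \<open>F\<^sub>n\<^sub>+\<^sub>1\<close> is not contained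
  in the ideal \<open>(F\<^sub>n)\<close>, and let \<open>q\<^sub>n : A \<rightarrow> Q\<^sub>n = A / F\<^sub>n A\<close> be the joint cokernel of \<open>F\<^sub>n\<close>.  Since \<open>Q\<^sub>n\<close> is a
  finite colimit of copies of \<open>A\<close>, (C1) shows that \<open>q\<^sub>n g = 0\<close> only for \<open>g \<in> (F\<^sub>n)\<close>.  The kernels of the
  \<open>q\<^sub>n\<close> form an ascending chain of subobjects of \<open>A\<close>; its colimit is again a subobject, hence finitely
  generated, hence equal to some \<open>ker q\<^sub>n\<close>.  Then \<open>q\<^sub>n\<close> kills \<open>F\<^sub>n\<^sub>+\<^sub>1\<close>, a contradiction.
\<close>

section \<open>Preadditive categories\<close>

text \<open>\<open>A\<close> is not assumed projective, so an endomorphism of \<open>A\<close> that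
  lands in the image of \<open>A^r -> A\<close> need not lift through that map, and images alone say
  nothing about ideals. (C1) replaces projectivity: Hom(A, -) respects the finite colimit
  \<open>A / F A\<close>, so membership in the ideal generated by \<open>F\<close> can be tested by
  composing with a cokernel. Describing subobjects as kernels of such cokernels serves two purposes
  at once: they are monomorphisms, as the finiteness condition demands, and they carry this test.
  The chain argument itself needs only a preadditive category with kernels and small colimits. For
  modules all three have to be built from the ambient category. The assumption on the tensor product
  speaks of colimits and not of sums of arrows; its additivity, on which the linearity of a sum of
  linear arrows rests, comes from the preservation of coproducts.\<close>

text \<open>Stores with an arrow the object memberships that the axioms of \<open>category\<close>
  ask for, so that typing facts compose by \<open>OF\<close>.\<close>

definition (in category) ar :: "'o \<Rightarrow> 'o \<Rightarrow> 'a \<Rightarrow> bool" where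
  "ar X Y f \<longleftrightarrow> X \<in> Ob C \<and> Y \<in> Ob C \<and> f \<in> Hom C X Y"

context category
begin

lemma arD: assumes "ar X Y f" shows "X \<in> Ob C" "Y \<in> Ob C" "f \<in> Hom C X Y"
  using assms by (simp_all add: ar_def)

lemma ar_idt: "X \<in> Ob C \<Longrightarrow> ar X X (idt C X)"
  by (simp add: ar_def idt_in)

lemma ar_cmp: "\<lbrakk>ar X Y f; ar Y Z g\<rbrakk> \<Longrightarrow> ar X Z (g \<cdot> f)"
  using cmp_in[of X Y Z f g] by (simp add: ar_def)

lemma assoc: "\<lbrakk>ar W X f; ar X Y g; ar Y Z h\<rbrakk> \<Longrightarrow> (h \<cdot> g) \<cdot> f = h \<cdot> (g \<cdot> f)"
  using cmp_assoc[of W X Y Z f g h] by (simp add: ar_def)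

lemma id_left: "ar X Y f \<Longrightarrow> idt C Y \<cdot> f = f"
  using idt_left[of X Y f] by (simp add: ar_def)

lemma id_right: "ar X Y f \<Longrightarrow> f \<cdot> idt C X = f"
  using idt_right[of X Y f] by (simp add: ar_def)

lemma is_isoE:
  assumes "is_iso C X Y f" "X \<in> Ob C" "Y \<in> Ob C"
  obtains g where "ar X Y f" "ar Y X g" "g \<cdot> f = idt C X" "f \<cdot> g = idt C Y"
  using assms by (auto simp: is_iso_def ar_def)

lemma is_monoI:
  assumes "ar X Y f" "\<And>W g h. \<lbrakk>ar W X g; ar W X h; f \<cdot> g = f \<cdot> h\<rbrakk> \<Longrightarrow> g = h"
  shows "is_mono C X Y f"
  using assms unfolding is_mono_def ar_def by blast

lemma is_monoD:
  assumes "is_mono C X Y f" "ar W X g" "ar W X h" "f \<cdot> g = f \<cdot> h"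
  shows "g = h"
  using assms unfolding is_mono_def ar_def by blast

text \<open>Serves to make the colimit of the kernels a subobject of \<open>R\<close>: exactness
  gives an isomorphism onto a kernel, and that kernel includes into \<open>R\<close>.\<close>

lemma is_mono_cmp_iso:
  assumes f: "is_mono C Y Z f" and g: "is_iso C X Y g" and ob: "X \<in> Ob C" "Y \<in> Ob C" "Z \<in> Ob C"
  shows "is_mono C X Z (f \<cdot> g)"
proof -
  obtain k where g1: "ar X Y g" and k: "ar Y X k" "k \<cdot> g = idt C X"
    using is_isoE[OF g ob(1,2)] by metis
  have f1: "ar Y Z f" using f ob by (auto simp: is_mono_def ar_def)
  show ?thesis
  proof (rule is_monoI)
    show "ar X Z (f \<cdot> g)" using ar_cmp g1 f1 .
    fix W u v assume u: "ar W X u" and v: "ar W X v" and e: "(f \<cdot> g) \<cdot> u = (f \<cdot> g) \<cdot> v"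
    have "f \<cdot> (g \<cdot> u) = f \<cdot> (g \<cdot> v)"
      using e assoc[OF u g1 f1] assoc[OF v g1 f1] by simp
    then have "g \<cdot> u = g \<cdot> v" using is_monoD[OF f ar_cmp[OF u g1] ar_cmp[OF v g1]] by simp
    then have "(k \<cdot> g) \<cdot> u = (k \<cdot> g) \<cdot> v"
      using assoc[OF u g1 k(1)] assoc[OF v g1 k(1)] by simp
    then show "u = v" using k(2) id_left u v by simp
  qed
qed

text \<open>Both arrows mediate the same cocone \<open>\<lambda>i. g \<cdot> l i\<close>.\<close>

lemma colimit_jointly_epic:
  assumes "is_colimit J C D L l" "ar L M g" "ar L M h" "\<And>i. i \<in> Ob J \<Longrightarrow> g \<cdot> l i = h \<cdot> l i"
    "is_functor J C D"
  shows "g = h"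
proof -
  have cc: "is_cocone J C D L l" using assms(1) by (simp add: is_colimit_def)
  have "is_cocone J C D M (\<lambda>i. g \<cdot> l i)"
    unfolding is_cocone_def
  proof (intro conjI ballI)
    show "M \<in> Ob C" using assms(2) arD by blast
    fix i assume i: "i \<in> Ob J"
    have li: "ar (dob D i) L (l i)"
      using cc i assms(5) by (auto simp: is_cocone_def ar_def is_functor_def)
    show "g \<cdot> l i \<in> Hom C (dob D i) M"
      using ar_cmp[OF li assms(2)] arD by blast
    fix j u assume j: "j \<in> Ob J" and u: "u \<in> Hom J i j"
    have lj: "ar (dob D j) L (l j)"
      using cc j assms(5) by (auto simp: is_cocone_def ar_def is_functor_def)
    have d: "ar (dob D i) (dob D j) (dar D i j u)"
      using i j u assms(5) by (auto simp: is_functor_def ar_def)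
    show "(g \<cdot> l j) \<cdot> dar D i j u = g \<cdot> l i"
      using assoc[OF d lj assms(2)] cc i j u by (simp add: is_cocone_def)
  qed
  then have "\<exists>!k. k \<in> Hom C L M \<and> (\<forall>i \<in> Ob J. k \<cdot> l i = g \<cdot> l i)"
    using assms(1) unfolding is_colimit_def by blast
  then show ?thesis using assms(2,3,4) arD by (metis (no_types, lifting))
qed

lemma colimitE:
  assumes "is_colimit J C D L l" "is_cocone J C D M m"
  obtains h where "ar L M h" "\<And>i. i \<in> Ob J \<Longrightarrow> h \<cdot> l i = m i"
    "\<And>k. \<lbrakk>ar L M k; \<And>i. i \<in> Ob J \<Longrightarrow> k \<cdot> l i = m i\<rbrakk> \<Longrightarrow> k = h"
proof -
  have ob: "L \<in> Ob C" "M \<in> Ob C" using assms by (auto simp: is_colimit_def is_cocone_def)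
  have "\<exists>!h. h \<in> Hom C L M \<and> (\<forall>i \<in> Ob J. h \<cdot> l i = m i)"
    using assms unfolding is_colimit_def by blast
  then obtain h where h: "h \<in> Hom C L M \<and> (\<forall>i \<in> Ob J. h \<cdot> l i = m i)"
    and u: "\<forall>k. k \<in> Hom C L M \<and> (\<forall>i \<in> Ob J. k \<cdot> l i = m i) \<longrightarrow> k = h"
    by (elim ex1E)
  show ?thesis
  proof (rule that[of h])
    show "ar L M h" "\<And>i. i \<in> Ob J \<Longrightarrow> h \<cdot> l i = m i" using h ob by (simp_all add: ar_def)
    show "\<And>k. \<lbrakk>ar L M k; \<And>i. i \<in> Ob J \<Longrightarrow> k \<cdot> l i = m i\<rbrakk> \<Longrightarrow> k = h"
      using u by (simp add: ar_def)
  qed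
qed

lemma functor_ar: "\<lbrakk>is_functor J C D; i \<in> Ob J; j \<in> Ob J; u \<in> Hom J i j\<rbrakk>
    \<Longrightarrow> ar (dob D i) (dob D j) (dar D i j u)"
  by (auto simp: is_functor_def ar_def)

lemma cocone_ar: "\<lbrakk>is_cocone J C D L l; is_functor J C D; i \<in> Ob J\<rbrakk> \<Longrightarrow> ar (dob D i) L (l i)"
  by (auto simp: is_functor_def is_cocone_def ar_def)

lemma cocone_eq: "\<lbrakk>is_cocone J C D L l; i \<in> Ob J; j \<in> Ob J; u \<in> Hom J i j\<rbrakk>
    \<Longrightarrow> l j \<cdot> dar D i j u = l i"
  by (auto simp: is_cocone_def)

end

text \<open>Weaker than \<open>abelian_category\<close>, so that \<open>module_cat\<close> becomes
  an instance as soon as sums and negatives of linear arrows are known to be linear. Kernels and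
  colimits enter later as separate hypotheses.\<close>

locale preadditive_category = category C
  for C :: "('o, 'a, 'm) additive_cat_scheme" (structure) +
  assumes hom_group: "\<lbrakk>X \<in> Ob C; Y \<in> Ob C\<rbrakk> \<Longrightarrow> comm_group (hom_group C X Y)"
    and add_right:
      "\<lbrakk>X \<in> Ob C; Y \<in> Ob C; Z \<in> Ob C; f \<in> Hom C X Y; f' \<in> Hom C X Y; g \<in> Hom C Y Z\<rbrakk>
        \<Longrightarrow> g \<cdot> addA C f f' = addA C (g \<cdot> f) (g \<cdot> f')"
    and add_left:
      "\<lbrakk>X \<in> Ob C; Y \<in> Ob C; Z \<in> Ob C; f \<in> Hom C X Y; g \<in> Hom C Y Z; g' \<in> Hom C Y Z\<rbrakk>
        \<Longrightarrow> addA C g g' \<cdot> f = addA C (g \<cdot> f) (g' \<cdot> f)"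

sublocale abelian_category \<subseteq> preadditive_category
  by (intro preadditive_category.intro category_axioms preadditive_category_axioms.intro
      hom_comm_group cmp_add_right cmp_add_left)

lemma hom_group_simps [simp]:
  "carrier (hom_group C X Y) = Hom C X Y"
  "monoid.mult (hom_group C X Y) = addA C"
  "one (hom_group C X Y) = zeroA C X Y"
  by (simp_all add: hom_group_def)

context preadditive_category
begin

lemma ar_zero: "\<lbrakk>X \<in> Ob C; Y \<in> Ob C\<rbrakk> \<Longrightarrow> ar X Y (zeroA C X Y)"
  using comm_group.axioms(2)[OF hom_group, THEN group.is_monoid, THEN monoid.one_closed]
  by (simp add: ar_def)

lemma ar_add: assumes "ar X Y f" "ar X Y g" shows "ar X Y (addA C f g)"
  using monoid.m_closed[OF group.is_monoid[OF comm_group.axioms(2)[OF hom_group]], of X Y f g]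
    assms by (simp add: ar_def)

lemma add_zero: assumes "ar X Y f"
  shows "addA C f (zeroA C X Y) = f" "addA C (zeroA C X Y) f = f"
  using monoid.r_one[OF group.is_monoid[OF comm_group.axioms(2)[OF hom_group]], of X Y f]
    monoid.l_one[OF group.is_monoid[OF comm_group.axioms(2)[OF hom_group]], of X Y f]
    assms by (simp_all add: ar_def)

lemma add_right': "\<lbrakk>ar X Y f; ar X Y f'; ar Y Z g\<rbrakk> \<Longrightarrow> g \<cdot> addA C f f' = addA C (g \<cdot> f) (g \<cdot> f')"
  using add_right[of X Y Z f f' g] by (simp add: ar_def)

lemma add_left': "\<lbrakk>ar X Y f; ar Y Z g; ar Y Z g'\<rbrakk> \<Longrightarrow> addA C g g' \<cdot> f = addA C (g \<cdot> f) (g' \<cdot> f)"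
  using add_left[of X Y Z f g g'] by (simp add: ar_def)

text \<open>Yields the rules for composing with zero: by distributivity such a composite equals its
  own double.\<close>

lemma idem_zero:
  assumes "ar X Y f" "addA C f f = f" shows "f = zeroA C X Y"
proof -
  interpret G: comm_group "hom_group C X Y" using hom_group assms(1) arD by blast
  show ?thesis using G.l_cancel_one[of f f] assms by (auto simp: ar_def)
qed

lemma cmp_zero:
  assumes "ar Y Z g" "X \<in> Ob C" shows "g \<cdot> zeroA C X Y = zeroA C X Z"
proof -
  have z: "ar X Y (zeroA C X Y)" using assms ar_zero arD by blast
  show ?thesis
    using idem_zero[OF ar_cmp[OF z assms(1)]] add_right'[OF z z assms(1)] add_zero[OF z] by simp
qed

lemma zero_cmp:
  assumes "ar X Y f" "Z \<in> Ob C" shows "zeroA C Y Z \<cdot> f = zeroA C X Z"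
proof -
  have z: "ar Y Z (zeroA C Y Z)" using assms ar_zero arD by blast
  show ?thesis
    using idem_zero[OF ar_cmp[OF assms(1) z]] add_left'[OF assms(1) z z] add_zero[OF z] by simp
qed

end

section \<open>Index categories\<close>

text \<open>The element \<open>a\<close> is also the identity arrow of both objects, so it must not lie in \<open>S\<close>.\<close>

definition par_cat :: "'u \<Rightarrow> 'u \<Rightarrow> 'u set \<Rightarrow> ('u, 'u) cat" where
  "par_cat a b S = \<lparr>Ob = {a, b},
     Hom = (\<lambda>x y. if x = y \<and> x \<in> {a, b} then {a} else if x = a \<and> y = b then S else {}),
     idt = (\<lambda>_. a), cmp = (\<lambda>g f. if f = a then g else f)\<rparr>"

text \<open>A family of parallel arrows \<open>g s\<close> from \<open>X\<close> to
  \<open>Y\<close>. Its colimit is the joint coequalizer: a joint cokernel if some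
  \<open>g s\<close> is zero, and the coproduct of \<open>X\<close> and \<open>Y\<close> if
  \<open>S\<close> is empty. Its limit is a kernel if the family is a pair of an arrow and
  zero.\<close>

definition par_diag :: "'u \<Rightarrow> ('o, 'a, 'm) cat_scheme \<Rightarrow> 'o \<Rightarrow> 'o \<Rightarrow> ('u \<Rightarrow> 'a) \<Rightarrow> ('u, 'u, 'o, 'a) diagram"
  where "par_diag a C X Y g = \<lparr>dob = (\<lambda>i. if i = a then X else Y),
     dar = (\<lambda>i j v. if i = j then idt C (if i = a then X else Y) else g v)\<rparr>"

lemma par_cat_simps:
  "Ob (par_cat a b S) = {a, b}" "idt (par_cat a b S) i = a"
  "cmp (par_cat a b S) v u = (if u = a then v else u)"
  by (simp_all add: par_cat_def)

lemma par_cat_Hom: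
  assumes "a \<noteq> b"
  shows "Hom (par_cat a b S) a a = {a}" "Hom (par_cat a b S) b b = {a}"
    "Hom (par_cat a b S) a b = S" "Hom (par_cat a b S) b a = {}"
  using assms by (simp_all add: par_cat_def)

lemma par_cat_category:
  assumes "a \<noteq> b" "a \<notin> S" shows "category (par_cat a b S)"
  using assms by unfold_locales (auto simp: par_cat_def split: if_splits)

lemma par_cat_finite:
  assumes "a \<noteq> b" "a \<notin> S" "finite S" shows "finite_cat (par_cat a b S)"
proof -
  have "arrows (par_cat a b S) \<subseteq> {a, b} \<times> {a, b} \<times> insert a S"
    by (auto simp: arrows_def par_cat_def split: if_splits)
  moreover have "finite ({a, b} \<times> {a, b} \<times> insert a S)" using assms by simp
  ultimately show ?thesis
    using par_cat_category[OF assms(1,2)] finite_subset by (auto simp: finite_cat_def)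
qed

text \<open>Uncountability of \<open>U\<close> makes the chain indexed by the natural numbers a
  small category. Equipollence with \<open>U\<close> is excluded because it would make
  \<open>U\<close> countable.\<close>

lemma countable_lesspoll_uncountable:
  assumes "countable A" "uncountable U" shows "A \<prec> U"
proof -
  have "A \<lesssim> (UNIV :: nat set)" using assms(1) by (auto simp: countable_def lepoll_def)
  moreover have "(UNIV :: nat set) \<lesssim> U"
    using assms(2) by (meson uncountable_infinite infinite_le_lepoll)
  moreover have "\<not> A \<approx> U" using assms by (metis bij_betw_def countable_image eqpoll_def)
  ultimately show ?thesis by (meson lepoll_trans lesspoll_def)
qed

lemma finite_cat_small: "\<lbrakk>finite_cat J; uncountable U\<rbrakk> \<Longrightarrow> small_cat U J"
  by (simp add: finite_cat_def small_cat_def countable_lesspoll_uncountable countable_finite)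

lemma (in category) par_diag_functor:
  assumes "a \<noteq> b" "a \<notin> S" "X \<in> Ob C" "Y \<in> Ob C" "\<And>s. s \<in> S \<Longrightarrow> ar X Y (g s)"
  shows "is_functor (par_cat a b S) C (par_diag a C X Y g)"
proof -
  have g: "idt C Y \<cdot> g s = g s" "g s \<cdot> idt C X = g s" "g s \<in> Hom C X Y" if "s \<in> S" for s
    using assms(5)[OF that] id_left id_right arD by auto
  have i: "idt C X \<cdot> idt C X = idt C X" "idt C Y \<cdot> idt C Y = idt C Y"
    "idt C X \<in> Hom C X X" "idt C Y \<in> Hom C Y Y"
    using assms(3,4) ar_idt id_left arD by auto
  have s: "s \<noteq> a" if "s \<in> S" for s using that assms(2) by auto
  show ?thesis
    unfolding is_functor_def
    using par_cat_category[OF assms(1,2)] category_axioms assms(1-4)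
    by (auto simp: par_diag_def par_cat_def g i s)
qed

text \<open>The ordered set of natural numbers, carried by \<open>e\<close> into the type
  \<open>'u\<close>, to which the index categories of the assumptions are confined. The name
  \<open>e 0\<close> is shared by all arrows, one in each nonempty Hom-set.\<close>

definition chain_cat :: "(nat \<Rightarrow> 'u) \<Rightarrow> ('u, 'u) cat" where
  "chain_cat e = \<lparr>Ob = range e,
     Hom = (\<lambda>x y. {u. u = e 0 \<and> (\<exists>m n. x = e m \<and> y = e n \<and> m \<le> n)}),
     idt = (\<lambda>_. e 0), cmp = (\<lambda>_ _. e 0)\<rparr>"

lemma chain_cat_simps [simp]:
  "Ob (chain_cat e) = range e" "idt (chain_cat e) x = e 0" "cmp (chain_cat e) u v = e 0"
  by (simp_all add: chain_cat_def)

lemma chain_cat_Hom [simp]: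
  "inj e \<Longrightarrow> u \<in> Hom (chain_cat e) (e m) (e n) \<longleftrightarrow> u = e 0 \<and> m \<le> n"
  by (auto simp: chain_cat_def inj_eq)

lemma chain_cat_category: assumes "inj e" shows "category (chain_cat e)"
  using assms by unfold_locales (auto simp: chain_cat_def inj_eq)

lemma chain_cat_filtered: assumes "inj e" shows "filtered_cat (chain_cat e)"
proof -
  have "\<exists>k. Hom (chain_cat e) (e m) (e k) \<noteq> {} \<and> Hom (chain_cat e) (e n) (e k) \<noteq> {}" for m n
  proof
    have "e 0 \<in> Hom (chain_cat e) (e m) (e (max m n))" "e 0 \<in> Hom (chain_cat e) (e n) (e (max m n))"
      using assms by simp_all
    then show "Hom (chain_cat e) (e m) (e (max m n)) \<noteq> {} \<and> Hom (chain_cat e) (e n) (e (max m n)) \<noteq> {}"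
      by blast
  qed
  moreover have "\<exists>w. w \<in> Hom (chain_cat e) (e n) (e n)" for n
    using assms by simp
  ultimately show ?thesis
    using chain_cat_category[OF assms] assms unfolding filtered_cat_def
    by (auto simp: Bex_def)
qed

lemma chain_cat_small: assumes "inj e" "uncountable U" shows "small_cat U (chain_cat e)"
proof -
  have "arrows (chain_cat e) \<subseteq> range e \<times> range e \<times> {e 0}"
    by (auto simp: arrows_def chain_cat_def)
  then have "countable (arrows (chain_cat e))"
    by (rule countable_subset) simp
  then show ?thesis
    using assms chain_cat_category countable_lesspoll_uncountable by (auto simp: small_cat_def)
qed

definition chain_diag ::
  "(nat \<Rightarrow> 'u) \<Rightarrow> (nat \<Rightarrow> 'o) \<Rightarrow> (nat \<Rightarrow> nat \<Rightarrow> 'a) \<Rightarrow> ('u, 'u, 'o, 'a) diagram" where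
  "chain_diag e X t = \<lparr>dob = (\<lambda>i. X (inv_into UNIV e i)), dar = (\<lambda>i j _. t (inv_into UNIV e i) (inv_into UNIV e j))\<rparr>"

lemma (in category) chain_diag_functor:
  assumes "inj e" "\<And>n. X n \<in> Ob C" "\<And>m n. m \<le> n \<Longrightarrow> ar (X m) (X n) (t m n)"
    "\<And>n. t n n = idt C (X n)" "\<And>k m n. \<lbrakk>k \<le> m; m \<le> n\<rbrakk> \<Longrightarrow> t k n = t m n \<cdot> t k m"
  shows "is_functor (chain_cat e) C (chain_diag e X t)"
proof -
  have t: "t m n \<in> Hom C (X m) (X n)" if "m \<le> n" for m n using assms(3)[OF that] arD by blast
  show ?thesis
    unfolding is_functor_def
    using chain_cat_category[OF assms(1)] category_axioms assms(1)
    by (auto simp: chain_diag_def assms(2,4) t intro: assms(5))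
qed

lemma prod_cat_category:
  assumes "category J" "category K" shows "category (prod_cat J K)"
proof -
  interpret J: category J by fact
  interpret K: category K by fact
  show ?thesis
  proof
    fix X Y Z f g
    assume "X \<in> Ob (prod_cat J K)" "Y \<in> Ob (prod_cat J K)" "Z \<in> Ob (prod_cat J K)"
      "f \<in> Hom (prod_cat J K) X Y" "g \<in> Hom (prod_cat J K) Y Z"
    then show "g \<cdot>\<^bsub>prod_cat J K\<^esub> f \<in> Hom (prod_cat J K) X Z"
      using J.cmp_in[of "fst X" "fst Y" "fst Z" "fst f" "fst g"]
        K.cmp_in[of "snd X" "snd Y" "snd Z" "snd f" "snd g"]
      by (auto simp: prod_cat_def)
  next
    fix W X Y Z f g h
    assume "W \<in> Ob (prod_cat J K)" "X \<in> Ob (prod_cat J K)" "Y \<in> Ob (prod_cat J K)" "Z \<in> Ob (prod_cat J K)"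
      "f \<in> Hom (prod_cat J K) W X" "g \<in> Hom (prod_cat J K) X Y" "h \<in> Hom (prod_cat J K) Y Z"
    then show "(h \<cdot>\<^bsub>prod_cat J K\<^esub> g) \<cdot>\<^bsub>prod_cat J K\<^esub> f
        = h \<cdot>\<^bsub>prod_cat J K\<^esub> (g \<cdot>\<^bsub>prod_cat J K\<^esub> f)"
      using J.cmp_assoc[of "fst W" "fst X" "fst Y" "fst Z" "fst f" "fst g" "fst h"]
        K.cmp_assoc[of "snd W" "snd X" "snd Y" "snd Z" "snd f" "snd g" "snd h"]
      by (auto simp: prod_cat_def)
  qed (auto simp: prod_cat_def J.idt_in K.idt_in J.idt_left K.idt_left J.idt_right K.idt_right)
qed

section \<open>Colimits of Hom-sets\<close>

text \<open>The ring \<open>end_ring\<close> for an arbitrary object, so that the ring-theoretic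
  part can be done in a general preadditive category.\<close>

definition endo_ring :: "('o, 'a, 'm) additive_cat_scheme \<Rightarrow> 'o \<Rightarrow> 'a ring" where
  "endo_ring C X = \<lparr>carrier = Hom C X X, monoid.mult = cmp C, one = idt C X,
     ring.zero = zeroA C X X, ring.add = addA C\<rparr>"

lemma endo_ring_simps [simp]:
  "carrier (endo_ring C X) = Hom C X X"
  "monoid.mult (endo_ring C X) = cmp C"
  "one (endo_ring C X) = idt C X"
  "ring.zero (endo_ring C X) = zeroA C X X"
  "ring.add (endo_ring C X) = addA C"
  by (simp_all add: endo_ring_def)

text \<open>This is surjectivity of the canonical map. The map is given on classes through
  \<open>the_elem\<close>, so \<open>l i \<cdot> f\<close> must first be seen to be constant on a
  class: each generating step preserves it by the cocone identity, and induction extends this to the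
  closure.\<close>

lemma (in category) hom_preserves_colimitE:
  assumes H: "hom_preserves_colimit C N J D L l" and D: "is_functor J C D" and cc: "is_cocone J C D L l"
    and f: "ar N L f"
  obtains i g where "i \<in> Ob J" "ar N (dob D i) g" "l i \<cdot> g = f"
proof -
  let ?S = "SIGMA i : Ob J. Hom C N (dob D i)"
  let ?r = "set_colim_step J (\<lambda>i. Hom C N (dob D i)) (\<lambda>i j u f. dar D i j u \<cdot> f)"
  let ?v = "\<lambda>(i, f). l i \<cdot> f"
  have NO: "N \<in> Ob C" using f arD by blast
  have DO: "dob D i \<in> Ob C" if "i \<in> Ob J" for i using D that by (simp add: is_functor_def)
  have step: "p \<in> ?S \<and> q \<in> ?S \<and> ?v p = ?v q" if pq: "(p, q) \<in> ?r" for p q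
  proof -
    obtain i j u x where pq: "p = (i, x)" "q = (j, dar D i j u \<cdot> x)"
      and i: "i \<in> Ob J" and j: "j \<in> Ob J" and u: "u \<in> Hom J i j" and x: "x \<in> Hom C N (dob D i)"
      using pq unfolding set_colim_step_def by blast
    have xa: "ar N (dob D i) x" using x NO DO[OF i] by (simp add: ar_def)
    note d = functor_ar[OF D i j u] and lj = cocone_ar[OF cc D j]
    have "l j \<cdot> (dar D i j u \<cdot> x) = l i \<cdot> x"
      using assoc[OF xa d lj] cocone_eq[OF cc i j u] by simp
    then show ?thesis using pq i j x arD(3)[OF ar_cmp[OF xa d]] by simp
  qed
  have rt: "q \<in> ?S \<and> ?v q = ?v p" if "(p, q) \<in> (?r \<union> ?r\<inverse>)\<^sup>*" "p \<in> ?S" for p q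
    using that by (induction rule: rtrancl_induct) (use step in fastforce)+
  have "f \<in> (\<lambda>c. the_elem (?v ` c)) ` (?S // (?r \<union> ?r\<inverse>)\<^sup>*)"
    using bij_betw_imp_surj_on[OF H[unfolded hom_preserves_colimit_def set_colim_def]] arD(3)[OF f]
    by simp
  then obtain c where c: "c \<in> ?S // (?r \<union> ?r\<inverse>)\<^sup>*" and cf: "the_elem (?v ` c) = f"
    by (elim imageE) simp
  obtain i g where ig: "i \<in> Ob J" "g \<in> Hom C N (dob D i)" and ce: "c = (?r \<union> ?r\<inverse>)\<^sup>* `` {(i, g)}"
    using c by (auto simp: quotient_def)
  have "?v ` c = {l i \<cdot> g}"
  proof
    show "?v ` c \<subseteq> {l i \<cdot> g}"
    proof
      fix y assume "y \<in> ?v ` c"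
      then obtain q where "((i, g), q) \<in> (?r \<union> ?r\<inverse>)\<^sup>*" "y = ?v q" unfolding ce by blast
      then show "y \<in> {l i \<cdot> g}" using rt[of "(i, g)" q] ig by simp
    qed
    have "(i, g) \<in> c" unfolding ce by blast
    then show "{l i \<cdot> g} \<subseteq> ?v ` c" by force
  qed
  then have "l i \<cdot> g = f" using cf by simp
  then show ?thesis using that ig NO DO by (simp add: ar_def)
qed

context preadditive_category
begin

lemma endo_ring_ring: assumes X: "X \<in> Ob C" shows "ring (endo_ring C X)"
proof (rule ringI)
  interpret G: comm_group "hom_group C X X" using hom_group X by blast
  show "abelian_group (endo_ring C X)"
  proof (rule abelian_groupI)
    fix f assume "f \<in> carrier (endo_ring C X)"
    then show "\<exists>g\<in>carrier (endo_ring C X). g \<oplus>\<^bsub>endo_ring C X\<^esub> f = \<zero>\<^bsub>endo_ring C X\<^esub>"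
      using G.l_inv_ex[of f] by simp
  qed (use G.m_closed G.one_closed G.m_assoc G.m_comm G.l_one in simp_all)
  show "monoid (endo_ring C X)"
  proof
    fix f g h assume "f \<in> carrier (endo_ring C X)" "g \<in> carrier (endo_ring C X)"
      and "h \<in> carrier (endo_ring C X)"
    then show "(f \<otimes>\<^bsub>endo_ring C X\<^esub> g) \<otimes>\<^bsub>endo_ring C X\<^esub> h = f \<otimes>\<^bsub>endo_ring C X\<^esub> (g \<otimes>\<^bsub>endo_ring C X\<^esub> h)"
      using cmp_assoc[OF X X X X, of h g f] by simp
  qed (use X idt_in cmp_in[OF X X X] idt_left[OF X X] idt_right[OF X X] in simp_all)
  fix f g h assume "f \<in> carrier (endo_ring C X)" "g \<in> carrier (endo_ring C X)" "h \<in> carrier (endo_ring C X)"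
  then show "(f \<oplus>\<^bsub>endo_ring C X\<^esub> g) \<otimes>\<^bsub>endo_ring C X\<^esub> h
        = f \<otimes>\<^bsub>endo_ring C X\<^esub> h \<oplus>\<^bsub>endo_ring C X\<^esub> g \<otimes>\<^bsub>endo_ring C X\<^esub> h"
    and "h \<otimes>\<^bsub>endo_ring C X\<^esub> (f \<oplus>\<^bsub>endo_ring C X\<^esub> g)
        = h \<otimes>\<^bsub>endo_ring C X\<^esub> f \<oplus>\<^bsub>endo_ring C X\<^esub> h \<otimes>\<^bsub>endo_ring C X\<^esub> g"
    using add_left[OF X X X, of h f g] add_right[OF X X X, of f g h] by simp_all
qed

lemma endo_ring_cring:
  assumes "X \<in> Ob C" "\<And>f g. \<lbrakk>ar X X f; ar X X g\<rbrakk> \<Longrightarrow> f \<cdot> g = g \<cdot> f"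
  shows "cring (endo_ring C X)"
proof -
  interpret ring "endo_ring C X" using endo_ring_ring assms(1) .
  show ?thesis
    by unfold_locales (use assms in \<open>simp add: ar_def\<close>)
qed

text \<open>
  The elements of the direct sum whose component at \<open>b\<close> lies in \<open>I\<close> form a subgroup that contains the
  relations of the colimit, and \<open>l b \<cdot> g = 0\<close> puts \<open>g\<close>, placed at \<open>b\<close>, among these relations.
\<close>

lemma additive_colimit_ideal:
  assumes R: "R \<in> Ob C" and ab: "a \<noteq> b" "a \<notin> S"
    and f: "\<And>s. s \<in> S \<Longrightarrow> ar R R (f s)" and s0: "s0 \<in> S" "f s0 = zeroA C R R"
    and cc: "is_cocone (par_cat a b S) C (par_diag a C R R f) L l"
    and H: "hom_preserves_additive_colimit C R (par_cat a b S) (par_diag a C R R f) L l"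
    and I: "ideal I (endo_ring C R)" "\<And>s. s \<in> S \<Longrightarrow> f s \<in> I" "\<And>x. x \<in> I \<Longrightarrow> l b \<cdot> x = zeroA C R L"
    and g: "ar R R g" "l b \<cdot> g = zeroA C R L"
  shows "g \<in> I"
proof -
  let ?J = "par_cat a b S" and ?D = "par_diag a C R R f"
  have DR: "dob ?D i = R" for i by (simp add: par_diag_def)
  have dD: "dar ?D i j u = (if i = j then idt C R else f u)" for i j u by (simp add: par_diag_def)
  interpret I: ideal I "endo_ring C R" by fact
  define G where "G = hom_group C R R"
  interpret G: comm_group G unfolding G_def using hom_group R by blast
  have G_simps: "carrier G = Hom C R R" "monoid.mult G = addA C" "\<one>\<^bsub>G\<^esub> = zeroA C R R"
    by (simp_all add: G_def)
  have IG: "subgroup I G" using I.a_subgroup by (simp add: G_def hom_group_def)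
  have LO: "L \<in> Ob C" using cc by (simp add: is_cocone_def)
  have la: "ar R L (l a)" and lb: "ar R L (l b)"
    using cc R by (auto simp: is_cocone_def par_cat_simps DR ar_def)
  \<comment> \<open>The zero arrow \<open>f s0\<close> forces the coprojection at \<open>a\<close>
    to vanish, so only the component at \<open>b\<close> contributes to the canonical map.\<close>
  have "l b \<cdot> dar ?D a b s0 = l a"
    using cc s0 by (auto simp: is_cocone_def par_cat_simps par_cat_Hom[OF ab(1)])
  then have la0: "l a = zeroA C R L" using ab s0 cmp_zero[OF lb R] by (simp add: dD)
  interpret L: comm_group "hom_group C R L" using hom_group R LO by blast
  \<comment> \<open>Since \<open>{a, b}\<close> is finite, the direct sum consists of all pairs and
    can be handled componentwise.\<close>
  define Q where "Q = sum_group {a, b} (\<lambda>_. G)"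
  have grp: "group G" by (rule G.is_group)
  interpret Q: group Q unfolding Q_def using grp by simp
  have Qc: "carrier Q = PiE {a, b} (\<lambda>_. Hom C R R)"
    unfolding Q_def by (auto simp: carrier_sum_group grp G_simps)
  have Qm: "(x \<otimes>\<^bsub>Q\<^esub> y) i = addA C (x i) (y i)" if "i \<in> {a, b}" for x y i
    using that by (auto simp: Q_def G_simps)
  have Qi: "(inv\<^bsub>Q\<^esub> x) i = inv\<^bsub>G\<^esub> (x i)" if "x \<in> carrier Q" "i \<in> {a, b}" for x i
    using that inv_sum_group[of "{a, b}" "\<lambda>_. G" x] grp unfolding Q_def by auto
  define \<sigma> where "\<sigma> w = finprod (hom_group C R L) (\<lambda>i. l i \<cdot> w i) {i \<in> {a, b}. w i \<noteq> zeroA C R R}" for w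
  have \<sigma>: "\<sigma> w = l b \<cdot> w b" if w: "w \<in> carrier Q" for w
  proof -
    have wa: "ar R R (w a)" and wb: "ar R R (w b)" using w R by (auto simp: Qc ar_def)
    have za: "l a \<cdot> w a = \<one>\<^bsub>hom_group C R L\<^esub>" using la0 zero_cmp[OF wa LO] by simp
    have hb: "l b \<cdot> w b \<in> carrier (hom_group C R L)" using arD(3)[OF ar_cmp[OF wb lb]] by simp
    show ?thesis
    \<comment> \<open>The canonical map sums over the support of \<open>w\<close> only, so a zero
      component at \<open>b\<close> is a case of its own; both cases give
      \<open>l b \<cdot> w b\<close>.\<close>
    proof (cases "w b = zeroA C R R")
      case True
      then have "\<sigma> w = \<one>\<^bsub>hom_group C R L\<^esub>"
        unfolding \<sigma>_def by (intro L.finprod_one_eqI) (use za in auto)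
      then show ?thesis using True cmp_zero[OF lb R] by simp
    next
      case False
      let ?A = "{i \<in> {a}. w i \<noteq> zeroA C R R}"
      have "{i \<in> {a, b}. w i \<noteq> zeroA C R R} = insert b ?A" using False by auto
      moreover have "finprod (hom_group C R L) (\<lambda>i. l i \<cdot> w i) (insert b ?A)
          = (l b \<cdot> w b) \<otimes>\<^bsub>hom_group C R L\<^esub> finprod (hom_group C R L) (\<lambda>i. l i \<cdot> w i) ?A"
        using ab hb za L.one_closed by (intro L.finprod_insert) auto
      moreover have "finprod (hom_group C R L) (\<lambda>i. l i \<cdot> w i) ?A = \<one>\<^bsub>hom_group C R L\<^esub>"
        by (intro L.finprod_one_eqI) (use za in auto)
      ultimately show ?thesis unfolding \<sigma>_def using L.r_one[OF hb] by simp
    qed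
  qed
  define \<iota> where "\<iota> = ab_inj {a, b} (\<lambda>_. G)"
  have \<iota>: "\<iota> i x \<in> carrier Q" if "x \<in> Hom C R R" for i x
    using that ar_zero[OF R R] arD(3) by (auto simp: \<iota>_def ab_inj_def Qc G_simps)
  have \<iota>b: "\<iota> i x b = (if i = b then x else zeroA C R R)" for i x
    by (auto simp: \<iota>_def ab_inj_def G_simps)
  define K where "K = {\<iota> j (dar ?D i j u \<cdot> x) \<otimes>\<^bsub>Q\<^esub> inv\<^bsub>Q\<^esub> (\<iota> i x) | i j u x.
       i \<in> Ob ?J \<and> j \<in> Ob ?J \<and> u \<in> Hom ?J i j \<and> x \<in> carrier G}"
  define N where "N = generate Q K"
  let ?W = "{w \<in> carrier Q. w b \<in> I}"
  have W: "subgroup ?W Q"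
  proof
    show "?W \<subseteq> carrier Q" by blast
    show "\<one>\<^bsub>Q\<^esub> \<in> ?W" using Q.one_closed subgroup.one_closed[OF IG] by (simp add: Q_def)
    fix x assume x: "x \<in> ?W"
    then show "inv\<^bsub>Q\<^esub> x \<in> ?W" using Qi[of x b] subgroup.m_inv_closed[OF IG] by simp
    fix y assume "y \<in> ?W"
    then show "x \<otimes>\<^bsub>Q\<^esub> y \<in> ?W" using x Qm[of b x y] subgroup.m_closed[OF IG, of "x b" "y b"]
      by (simp add: G_simps)
  qed
  have "K \<subseteq> ?W"
  proof
    fix w assume "w \<in> K"
    then obtain i j u x where w: "w = \<iota> j (dar ?D i j u \<cdot> x) \<otimes>\<^bsub>Q\<^esub> inv\<^bsub>Q\<^esub> (\<iota> i x)"
      and i: "i \<in> {a, b}" and j: "j \<in> {a, b}" and u: "u \<in> Hom ?J i j" and x: "x \<in> Hom C R R"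
      unfolding K_def by (auto simp: par_cat_simps G_simps)
    have xa: "ar R R x" using x R by (simp add: ar_def)
    have d: "ar R R (dar ?D i j u)"
      using i j u f ar_idt[OF R] ab(1) by (auto simp: dD par_cat_Hom[OF ab(1)])
    note dx = arD(3)[OF ar_cmp[OF xa d]]
    have wQ: "w \<in> carrier Q" unfolding w using \<iota>[OF dx] \<iota>[OF x] by simp
    have wb: "w b = addA C (\<iota> j (dar ?D i j u \<cdot> x) b) (inv\<^bsub>G\<^esub> (\<iota> i x b))"
      unfolding w using Qm Qi[OF \<iota>[OF x]] by simp
    \<comment> \<open>At \<open>b\<close>, the relation of an identity arrow is zero, and that of
      \<open>f u\<close> is \<open>f u \<cdot> x\<close>, because its other term sits at
      \<open>a\<close>. The latter is in \<open>I\<close> because \<open>I\<close> is an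
      ideal.\<close>
    have "w b \<in> I"
    proof (cases "i = j")
      case True
      have "\<iota> i x b \<in> carrier G" using x ar_zero[OF R R] arD(3) by (simp add: \<iota>b G_simps)
      then have "w b = zeroA C R R"
        unfolding wb using True G.r_inv[of "\<iota> i x b"] id_left[OF xa] by (simp add: dD G_simps)
      then show ?thesis using subgroup.one_closed[OF IG] by (simp add: G_simps)
    next
      case False
      then have ij: "i = a" "j = b" "u \<in> S"
        using i j u ab(1) by (auto simp: par_cat_Hom[OF ab(1)])
      have "w b = f u \<cdot> x"
        unfolding wb using ij ab(1) G.inv_one add_zero(1)[OF ar_cmp[OF xa f[OF ij(3)]]]
        by (simp add: \<iota>b dD G_simps)
      then show ?thesis using I.I_r_closed[OF I(2)[OF ij(3)], of x] x by simp
    qed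
    then show "w \<in> ?W" using wQ by simp
  qed
  then have NW: "N \<subseteq> ?W" unfolding N_def using Q.generate_subgroup_incl[OF _ W] by blast
  have KQ: "K \<subseteq> carrier Q" using \<open>K \<subseteq> ?W\<close> by blast
  have N: "subgroup N Q" unfolding N_def using Q.generate_is_subgroup[OF KQ] .
  have colim: "ab_colim ?J (\<lambda>i. hom_group C R R) (\<lambda>i j u f. dar ?D i j u \<cdot> f) = Q Mod N"
    by (simp add: ab_colim_def Let_def DR N_def K_def \<iota>_def Q_def G_def par_cat_simps(1))
  have "(\<lambda>c. the_elem (\<sigma> ` c)) \<in> iso (Q Mod N) (hom_group C R L)"
    using H unfolding hom_preserves_additive_colimit_def colim DR par_cat_simps(1) \<sigma>_def .
  then have inj: "inj_on (\<lambda>c. the_elem (\<sigma> ` c)) (carrier (Q Mod N))"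
    by (simp add: iso_def bij_betw_def)
  \<comment> \<open>The canonical map is injective on cosets, but its value is read off the image of
    a whole coset. Hence \<open>\<sigma>\<close> is shown to vanish at every element of
    \<open>N\<close> and of the coset of \<open>?w\<close>; the two cosets then coincide.\<close>
  let ?w = "\<iota> b g"
  have wQ: "?w \<in> carrier Q" using \<iota> arD(3)[OF g(1)] .
  have s0: "\<sigma> x = zeroA C R L" if "x \<in> N" for x
    using that NW \<sigma>[of x] I(3) by auto
  have s1: "\<sigma> x = zeroA C R L" if "x \<in> N #>\<^bsub>Q\<^esub> ?w" for x
  proof -
    obtain n where n: "n \<in> N" and x: "x = n \<otimes>\<^bsub>Q\<^esub> ?w" using \<open>x \<in> _\<close> by (auto simp: r_coset_def)
    have nQ: "n \<in> carrier Q" and nI: "n b \<in> I" using n NW by auto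
    have nb: "ar R R (n b)" using nQ R by (auto simp: Qc ar_def)
    have "\<sigma> x = l b \<cdot> addA C (n b) g"
      unfolding x using \<sigma>[OF Q.m_closed[OF nQ wQ]] Qm[of b n ?w] by (simp add: \<iota>b)
    also have "\<dots> = zeroA C R L"
      using add_right'[OF nb g(1) lb] I(3)[OF nI] g(2) add_zero[OF ar_zero[OF R LO]] by simp
    finally show ?thesis .
  qed
  have "?w \<in> N #>\<^bsub>Q\<^esub> ?w" using Q.rcos_self[OF wQ N] .
  moreover have "\<one>\<^bsub>Q\<^esub> \<in> N" using subgroup.one_closed[OF N] .
  ultimately have img: "\<sigma> ` (N #>\<^bsub>Q\<^esub> ?w) = {zeroA C R L}" "\<sigma> ` N = {zeroA C R L}"
    using s0 s1 by (auto 0 3 intro: image_eqI[symmetric])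
  have "N #>\<^bsub>Q\<^esub> ?w \<in> carrier (Q Mod N)" using wQ by (auto simp: FactGroup_def RCOSETS_def)
  moreover have "N \<in> carrier (Q Mod N)"
    using Q.coset_mult_one[OF subgroup.subset[OF N]] Q.one_closed
    by (auto simp: FactGroup_def RCOSETS_def intro: bexI[of _ "\<one>\<^bsub>Q\<^esub>"])
  moreover have "the_elem (\<sigma> ` (N #>\<^bsub>Q\<^esub> ?w)) = the_elem (\<sigma> ` N)" using img by simp
  ultimately have "N #>\<^bsub>Q\<^esub> ?w = N" by (intro inj_onD[OF inj])
  then have "?w \<in> N" using Q.rcos_self[OF wQ N] by simp
  then show ?thesis using NW \<iota>b[of b g] by auto
qed

end

section \<open>Ascending chains of kernels\<close>

context preadditive_category
begin

lemma kernelD: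
  assumes "is_kernel C X Y f K k" "ar X Y f"
  shows "ar K X k" "f \<cdot> k = zeroA C K Y"
    "\<And>W g. \<lbrakk>ar W X g; f \<cdot> g = zeroA C W Y\<rbrakk> \<Longrightarrow> \<exists>h. ar W K h \<and> k \<cdot> h = g"
    "\<And>W g h. \<lbrakk>ar W K g; ar W K h; k \<cdot> g = k \<cdot> h\<rbrakk> \<Longrightarrow> g = h"
proof -
  show k: "ar K X k" "f \<cdot> k = zeroA C K Y" using assms by (auto simp: is_kernel_def ar_def)
  have u: "\<exists>!h. h \<in> Hom C W K \<and> k \<cdot> h = g" if "ar W X g" "f \<cdot> g = zeroA C W Y" for W g
    using assms(1) that unfolding is_kernel_def ar_def by blast
  show "\<exists>h. ar W K h \<and> k \<cdot> h = g" if "ar W X g" "f \<cdot> g = zeroA C W Y" for W g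
    using u[OF that] arD[OF that(1)] arD[OF k(1)] by (auto simp: ar_def)
  fix W g h assume g: "ar W K g" and h: "ar W K h" and e: "k \<cdot> g = k \<cdot> h"
  have "f \<cdot> (k \<cdot> h) = zeroA C W Y"
    using assoc[OF h k(1) assms(2)] k(2) zero_cmp[OF h] arD[OF assms(2)] by simp
  from u[OF ar_cmp[OF h k(1)] this] show "g = h"
    by (rule ex1E) (metis g h e arD(3))
qed

text \<open>Presents a kernel as the limit of the pair \<open>f\<close>, zero, the form in which
  exactness of filtered colimits can be applied. The leg at \<open>b\<close> is zero because it
  equals \<open>f \<cdot> k\<close>.\<close>

lemma kernel_is_limit:
  assumes ker: "is_kernel C X Y f K k" and f: "ar X Y f" and ab: "a \<noteq> b" "s \<noteq> s'"
    and D: "dob D a = X" "dob D b = Y" "dar D a b s = f" "dar D a b s' = zeroA C X Y"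
      "dar D a a a = idt C X" "dar D b b a = idt C Y"
  shows "is_limit (par_cat a b {s, s'}) C D K (\<lambda>i. if i = a then k else zeroA C K Y)"
proof -
  note k = kernelD[OF ker f]
  have ob: "X \<in> Ob C" "Y \<in> Ob C" "K \<in> Ob C" using arD f k(1) by auto
  have "is_cone (par_cat a b {s, s'}) C D K (\<lambda>i. if i = a then k else zeroA C K Y)"
    unfolding is_cone_def
    using ab(1) D ob arD(3)[OF k(1)] k(2) arD(3)[OF ar_zero[OF ob(3,2)]] zero_cmp[OF k(1) ob(2)]
      id_left[OF k(1)] id_left[OF ar_zero[OF ob(3,2)]]
    by (auto simp: par_cat_simps par_cat_Hom)
  moreover have "\<exists>!h. h \<in> Hom C M K \<and>
      (\<forall>i\<in>Ob (par_cat a b {s, s'}). (if i = a then k else zeroA C K Y) \<cdot> h = m i)"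
    if m: "is_cone (par_cat a b {s, s'}) C D M m" for M m
  proof -
    have MO: "M \<in> Ob C" using m by (simp add: is_cone_def)
    have ma: "ar M X (m a)" using m D ob by (auto simp: is_cone_def par_cat_simps ar_def)
    have e: "f \<cdot> m a = m b" "zeroA C X Y \<cdot> m a = m b"
      using m D ab(1) by (auto simp: is_cone_def par_cat_simps par_cat_Hom)
    then have mb: "m b = zeroA C M Y" using zero_cmp[OF ma ob(2)] by simp
    obtain h where h: "ar M K h" "k \<cdot> h = m a" using k(3)[OF ma] e mb by auto
    show ?thesis
    proof (rule ex1I[of _ h])
      show "h \<in> Hom C M K \<and>
          (\<forall>i\<in>Ob (par_cat a b {s, s'}). (if i = a then k else zeroA C K Y) \<cdot> h = m i)"
        using h arD(3)[OF h(1)] zero_cmp[OF h(1) ob(2)] mb ab(1) by (auto simp: par_cat_simps)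
      fix h' assume h': "h' \<in> Hom C M K \<and>
          (\<forall>i\<in>Ob (par_cat a b {s, s'}). (if i = a then k else zeroA C K Y) \<cdot> h' = m i)"
      then have "k \<cdot> h' = m a" "ar M K h'" using MO ob by (auto simp: par_cat_simps ar_def)
      then show "h' = h" using k(4)[of M h' h] h by simp
    qed
  qed
  ultimately show ?thesis by (simp add: is_limit_def)
qed

text \<open>
  Exactness is used on the diagrams \<open>(q\<^sub>n, 0) : R \<rightrightarrows> Q\<^sub>n\<close>: it identifies \<open>X = colim K\<^sub>n\<close>, for
  \<open>K\<^sub>n = ker q\<^sub>n\<close>, with the kernel of \<open>R \<rightarrow> colim Q\<^sub>n\<close>, so that \<open>X\<close> is a subobject of \<open>R\<close>.  As \<open>X\<close> is
  finitely generated, its identity factors through some \<open>K\<^sub>n\<close>.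
\<close>

lemma kernel_chain_stationary:
  fixes U :: "'u set" and R :: 'o and Q :: "nat \<Rightarrow> 'o" and q :: "nat \<Rightarrow> 'a"
  assumes R: "R \<in> Ob C" and U: "uncountable U" and colim: "has_small_colimits U C"
    and kernels: "\<And>X Y f. ar X Y f \<Longrightarrow> \<exists>K k. is_kernel C X Y f K k"
    and comm: "filtered_colimits_commute_with_finite_limits U C"
    and fg: "\<And>N m. \<lbrakk>N \<in> Ob C; is_mono C N R m\<rbrakk> \<Longrightarrow> finitely_generated U C N"
    and q: "\<And>n. ar R (Q n) (q n)"
    and epi: "\<And>n Z g h. \<lbrakk>ar (Q n) Z g; ar (Q n) Z h; g \<cdot> q n = h \<cdot> q n\<rbrakk> \<Longrightarrow> g = h"
    and factor: "\<And>m n. m \<le> n \<Longrightarrow> \<exists>t. ar (Q m) (Q n) t \<and> t \<cdot> q m = q n"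
  shows "\<exists>n. \<forall>g. ar R R g \<and> q (Suc n) \<cdot> g = zeroA C R (Q (Suc n)) \<longrightarrow> q n \<cdot> g = zeroA C R (Q n)"
proof -
  obtain e :: "nat \<Rightarrow> 'u" where e: "inj e"
    using U uncountable_infinite infinite_countable_subset by (metis)
  define a b where "a = e 0" and "b = e 1"
  define s where "s = e 2"
  have ab: "a \<noteq> b" "a \<notin> {b, s}" "b \<noteq> s" using e by (auto simp: a_def b_def s_def inj_eq)
  \<comment> \<open>The two arrows of \<open>?K\<close> from \<open>a\<close> to \<open>b\<close>
    are named \<open>b\<close> and \<open>s\<close>: the first will carry \<open>q n\<close>, the
    second the zero arrow. An arrow may share its name with the object \<open>b\<close>, but not
    with \<open>a\<close>, which names the identities.\<close>
  let ?J = "chain_cat e" and ?K = "par_cat a b {b, s}"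
  define ix where "ix = inv_into UNIV e"
  have ix: "ix (e n) = n" for n using e by (simp add: ix_def)
  have QO: "Q n \<in> Ob C" for n using q arD by blast
  have "\<forall>p. \<exists>t. fst p \<le> snd p \<longrightarrow> ar (Q (fst p)) (Q (snd p)) t \<and> t \<cdot> q (fst p) = q (snd p)"
    using factor by blast
  then obtain t0 where t0: "\<forall>p. fst p \<le> snd p \<longrightarrow> ar (Q (fst p)) (Q (snd p)) (t0 p) \<and> t0 p \<cdot> q (fst p) = q (snd p)"
    by (rule choice[THEN exE])
  define t where "t m n = t0 (m, n)" for m n
  have t: "ar (Q m) (Q n) (t m n)" "t m n \<cdot> q m = q n" if "m \<le> n" for m n
    using t0 that by (auto simp: t_def)
  \<comment> \<open>The arrows \<open>t m n\<close> were chosen independently; they are functorial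
    because \<open>q m\<close>, being epic, determines them.\<close>
  have t_id: "t n n = idt C (Q n)" for n
    using epi[OF t(1)[of n n] ar_idt[OF QO]] t(2)[of n n] id_left[OF q] by simp
  have t_cmp: "t k n = t m n \<cdot> t k m" if "k \<le> m" "m \<le> n" for k m n
  proof (rule epi)
    show "ar (Q k) (Q n) (t k n)" using t that by simp
    show "ar (Q k) (Q n) (t m n \<cdot> t k m)" using ar_cmp t(1) that by blast
    show "t k n \<cdot> q k = (t m n \<cdot> t k m) \<cdot> q k"
      using assoc[OF q t(1)[OF that(1)] t(1)[OF that(2)]] t(2) that by simp
  qed
  have "\<forall>n. \<exists>p. is_kernel C R (Q n) (q n) (fst p) (snd p)" using kernels[OF q] by simp
  then obtain p0 where p0: "\<forall>n. is_kernel C R (Q n) (q n) (fst (p0 n)) (snd (p0 n))"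
    by (rule choice[THEN exE])
  define K k where "K n = fst (p0 n)" and "k n = snd (p0 n)" for n
  have ker: "is_kernel C R (Q n) (q n) (K n) (k n)" for n using p0 by (simp add: K_def k_def)
  note kD = kernelD[OF ker q]
  have KO: "K n \<in> Ob C" for n using kD(1) arD by blast
  have qk: "q n \<cdot> g = zeroA C W (Q n)" if "ar W R g" "q m \<cdot> g = zeroA C W (Q m)" "m \<le> n" for m n W g
    using assoc[OF that(1) q t(1)[OF that(3)]] t(2)[OF that(3)] that(2) cmp_zero[OF t(1)[OF that(3)], of W]
      arD[OF that(1)] by simp
  have "\<forall>p. \<exists>s. fst p \<le> snd p \<longrightarrow> ar (K (fst p)) (K (snd p)) s \<and> k (snd p) \<cdot> s = k (fst p)"
    using kD(3)[OF kD(1) qk[OF kD(1) kD(2)]] by blast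
  then obtain s0 where s0: "\<forall>p. fst p \<le> snd p \<longrightarrow> ar (K (fst p)) (K (snd p)) (s0 p) \<and> k (snd p) \<cdot> s0 p = k (fst p)"
    by (rule choice[THEN exE])
  define r where "r m n = s0 (m, n)" for m n
  have r: "ar (K m) (K n) (r m n)" "k n \<cdot> r m n = k m" if "m \<le> n" for m n
    using s0 that by (auto simp: r_def)
  \<comment> \<open>Dually, the inclusions between the kernels are determined by the monomorphisms
    \<open>k n\<close>.\<close>
  have r_id: "r n n = idt C (K n)" for n
    using kD(4)[OF r(1)[of n n] ar_idt[OF KO]] r(2)[of n n] id_right[OF kD(1)] by simp
  have r_cmp: "r l n = r m n \<cdot> r l m" if "l \<le> m" "m \<le> n" for l m n
  proof (rule kD(4))
    show "ar (K l) (K n) (r l n)" using r that by simp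
    show "ar (K l) (K n) (r m n \<cdot> r l m)" using ar_cmp r(1) that by blast
    show "k n \<cdot> r l n = k n \<cdot> (r m n \<cdot> r l m)"
      using assoc[OF r(1)[OF that(1)] r(1)[OF that(2)] kD(1)] r(2) that by simp
  qed
  have r_mono: "is_mono C (K m) (K n) (r m n)" if "m \<le> n" for m n
  proof (rule is_monoI[OF r(1)[OF that]])
    fix W g h assume g: "ar W (K m) g" and h: "ar W (K m) h" and e: "r m n \<cdot> g = r m n \<cdot> h"
    then have "k m \<cdot> g = k m \<cdot> h"
      using assoc[OF g r(1)[OF that] kD(1)] assoc[OF h r(1)[OF that] kD(1)] r(2)[OF that] by simp
    then show "g = h" using kD(4)[OF g h] by simp
  qed
  let ?F = "chain_diag e K r" and ?T = "chain_diag e Q t"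
  have F: "is_functor ?J C ?F" using chain_diag_functor[OF e KO r(1) r_id r_cmp] .
  have T: "is_functor ?J C ?T" using chain_diag_functor[OF e QO t(1) t_id t_cmp] .
  note small = chain_cat_small[OF e U]
  have Fd: "dob ?F (e n) = K n" "dar ?F (e m) (e n) u = r m n"
    and Td: "dob ?T (e n) = Q n" "dar ?T (e m) (e n) u = t m n" for m n u
    using ix by (simp_all add: chain_diag_def ix_def)
  obtain X x where X: "is_colimit ?J C ?F X x"
    using colim small F unfolding has_small_colimits_def by blast
  obtain P c where P: "is_colimit ?J C ?T P c"
    using colim small T unfolding has_small_colimits_def by blast
  have Xc: "is_cocone ?J C ?F X x" and Pc: "is_cocone ?J C ?T P c"
    using X P by (auto simp: is_colimit_def)
  have x: "ar (K n) X (x (e n))" for n using cocone_ar[OF Xc F, of "e n"] Fd by simp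
  have c: "ar (Q n) P (c (e n))" for n using cocone_ar[OF Pc T, of "e n"] Td by simp
  have ct: "c (e n) \<cdot> t m n = c (e m)" if "m \<le> n" for m n
    using cocone_eq[OF Pc, of "e m" "e n" "e 0"] e that Td by simp
  have XO: "X \<in> Ob C" and PO: "P \<in> Ob C" using arD(2)[OF x] arD(2)[OF c] .
  \<comment> \<open>The arrow from \<open>R\<close> to the colimit \<open>P\<close> of the
    \<open>Q n\<close>; by \<open>cq\<close> every stage gives the same composite.\<close>
  define w where "w = c (e 0) \<cdot> q 0"
  have w: "ar R P w" unfolding w_def using ar_cmp[OF q c] .
  have cq: "c (e n) \<cdot> q n = w" for n
    unfolding w_def using ct[of 0 n] t[of 0 n] assoc[OF q t(1) c, of 0 n] by simp
  obtain Y y where Y: "is_kernel C R P w Y y" using kernels[OF w] by blast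
  note yD = kernelD[OF Y w]
  have YO: "Y \<in> Ob C" using yD(1) arD by blast
  have wk: "w \<cdot> k n = zeroA C (K n) P" for n
    using assoc[OF kD(1) q c, of n] cq[of n] kD(2)[of n] cmp_zero[OF c KO] by simp
  have "\<forall>n. \<exists>m. ar (K n) Y m \<and> y \<cdot> m = k n" using yD(3)[OF kD(1) wk] by blast
  then obtain m where m0: "\<forall>n. ar (K n) Y (m n) \<and> y \<cdot> m n = k n" by (rule choice[THEN exE])
  then have m: "ar (K n) Y (m n)" "y \<cdot> m n = k n" for n by auto
  have mr: "m n \<cdot> r l n = m l" if "l \<le> n" for l n
  proof (rule yD(4)[OF ar_cmp[OF r(1)[OF that] m(1)] m(1)])
    show "y \<cdot> (m n \<cdot> r l n) = y \<cdot> m l"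
      using assoc[OF r(1)[OF that] m(1) yD(1)] m(2) r(2)[OF that] by simp
  qed
  \<comment> \<open>The inclusions of the \<open>K n\<close> into \<open>Y = ker w\<close> induce
    the comparison \<open>h\<close> from the colimit of the kernels to the kernel of the
    colimit.\<close>
  have "is_cocone ?J C ?F Y (\<lambda>i. m (ix i))"
    unfolding is_cocone_def using YO Fd ix arD(3)[OF m(1)] mr e by auto
  then obtain h where h: "ar X Y h" and hx0: "\<And>i. i \<in> Ob ?J \<Longrightarrow> h \<cdot> x i = m (ix i)"
    by (rule colimitE[OF X]) blast
  have hx: "h \<cdot> x (e n) = m n" for n using hx0[of "e n"] ix by simp
  define \<gamma> where "\<gamma> Z f v = (if v = b then f else zeroA C R Z)" for Z f and v :: 'u
  have \<gamma>: "ar R Z (\<gamma> Z f v)" if "ar R Z f" for Z f v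
    using that ar_zero arD by (auto simp: \<gamma>_def)
  have \<gamma>_cmp: "g \<cdot> \<gamma> Z f v = \<gamma> Z' (g \<cdot> f) v" if "ar R Z f" "ar Z Z' g" for Z Z' f g v
    using that cmp_zero R by (auto simp: \<gamma>_def)
  \<comment> \<open>The object \<open>(e n, a)\<close> goes to \<open>R\<close> and
    \<open>(e n, b)\<close> to \<open>Q n\<close>. An arrow from stage \<open>m\<close> to stage
    \<open>n\<close> over \<open>a -> b\<close> goes to \<open>q n\<close> or to zero; the target
    stage decides, since \<open>t m n \<cdot> q m = q n\<close>. For \<open>z' = a\<close> only the
    identity occurs, as no arrow leads from \<open>b\<close> to \<open>a\<close>.\<close>
  define D where "D = \<lparr>dob = (\<lambda>(i, z). if z = a then R else Q (ix i)),
    dar = (\<lambda>(i, z) (j, z') (u :: 'u, v). if z' = a then idt C R else if z = a then \<gamma> (Q (ix j)) (q (ix j)) v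
       else t (ix i) (ix j))\<rparr>"
  have Dd: "dob D (i, z) = (if z = a then R else Q (ix i))"
    "dar D (i, z) (j, z') (u, v) = (if z' = a then idt C R else if z = a then \<gamma> (Q (ix j)) (q (ix j)) v
       else t (ix i) (ix j))" for i j z z' u v by (simp_all add: D_def)
  have R1: "idt C R \<in> Hom C R R" "idt C R \<cdot> idt C R = idt C R"
    using arD(3)[OF ar_idt[OF R]] id_left[OF ar_idt[OF R]] by auto
  note par = par_cat_simps par_cat_Hom[OF ab(1)]
  have D: "is_functor (prod_cat ?J ?K) C D"
    unfolding is_functor_def
  proof (intro conjI ballI)
    show "category (prod_cat ?J ?K)"
      using prod_cat_category chain_cat_category[OF e] par_cat_category[OF ab(1,2)] by blast
    show "category C" by (rule category_axioms)
    fix i' assume i': "i' \<in> Ob (prod_cat ?J ?K)"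
    obtain i z where i: "i' = (e i, z)" "z \<in> {a, b}" using i' by (auto simp: prod_cat_def par_cat_simps)
    show "dob D i' \<in> Ob C" using i R QO by (simp add: Dd ix)
    show "dar D i' i' (idt (prod_cat ?J ?K) i') = idt C (dob D i')"
      using i ab by (auto simp: prod_cat_def par_cat_simps Dd ix t_id)
    fix j' u' assume j': "j' \<in> Ob (prod_cat ?J ?K)" and u': "u' \<in> Hom (prod_cat ?J ?K) i' j'"
    obtain j z' where j: "j' = (e j, z')" "z' \<in> {a, b}" using j' by (auto simp: prod_cat_def par_cat_simps)
    obtain v where u: "u' = (e 0, v)" "i \<le> j" "v \<in> Hom ?K z z'"
      using u' i j e by (auto simp: prod_cat_def)
    show "dar D i' j' u' \<in> Hom C (dob D i') (dob D j')"
      using i j u ab R1 arD(3)[OF \<gamma>[OF q]] arD(3)[OF t(1)] by (auto simp: Dd ix par)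
    fix k' v' assume k': "k' \<in> Ob (prod_cat ?J ?K)" and v': "v' \<in> Hom (prod_cat ?J ?K) j' k'"
    obtain l z'' where l: "k' = (e l, z'')" "z'' \<in> {a, b}" using k' by (auto simp: prod_cat_def par_cat_simps)
    obtain v2 where v: "v' = (e 0, v2)" "j \<le> l" "v2 \<in> Hom ?K z' z''"
      using v' l j e by (auto simp: prod_cat_def)
    have "t j l \<cdot> \<gamma> (Q j) (q j) v = \<gamma> (Q l) (q l) v"
      using \<gamma>_cmp[OF q t(1)[OF v(2)]] t(2)[OF v(2)] by simp
    then show "dar D i' k' (v' \<cdot>\<^bsub>prod_cat ?J ?K\<^esub> u') = dar D j' k' v' \<cdot> dar D i' j' u'"
      using i j l u v ab R1 id_right[OF \<gamma>[OF q]] t_cmp[OF u(2) v(2)]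
      by (auto simp: Dd ix par prod_cat_def)
  qed
  \<comment> \<open>Limits over \<open>?K\<close> are the kernels \<open>K n\<close> and
    \<open>Y\<close>; colimits over \<open>?J\<close> are \<open>R\<close>, for the constant diagram
    at \<open>a\<close>, and \<open>P\<close>. The families \<open>?p\<close>, \<open>?c\<close> and
    \<open>?y\<close> are the legs of these limits and colimits.\<close>
  let ?p = "\<lambda>j z. if z = a then k (ix j) else zeroA C (K (ix j)) (Q (ix j))"
  let ?G = "par_diag a C R P (\<gamma> P w)"
  let ?c = "\<lambda>z j. if z = a then idt C R else c j"
  let ?y = "\<lambda>z. if z = a then y else zeroA C Y P"
  have "is_iso C X Y h"
  proof (rule comm[unfolded filtered_colimits_commute_with_finite_limits_def, rule_format, OF conjI])
    show "small_cat U ?J" by (rule small)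
    show "filtered_cat ?J \<and> finite_cat ?K \<and> is_functor (prod_cat ?J ?K) C D \<and>
        is_functor ?J C ?F \<and>
        (\<forall>j \<in> Ob ?J. is_limit ?K C (slice_fst ?J D j) (dob ?F j) (?p j)) \<and>
        (\<forall>j \<in> Ob ?J. \<forall>j' \<in> Ob ?J. \<forall>u \<in> Hom ?J j j'. \<forall>k \<in> Ob ?K.
           ?p j' k \<cdot> dar ?F j j' u = dar D (j, k) (j', k) (u, idt ?K k) \<cdot> ?p j k) \<and>
        is_functor ?K C ?G \<and>
        (\<forall>k \<in> Ob ?K. is_colimit ?J C (slice_snd ?K D k) (dob ?G k) (?c k)) \<and>
        (\<forall>k \<in> Ob ?K. \<forall>k' \<in> Ob ?K. \<forall>v \<in> Hom ?K k k'. \<forall>j \<in> Ob ?J.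
           dar ?G k k' v \<cdot> ?c k j = ?c k' j \<cdot> dar D (j, k) (j, k') (idt ?J j, v)) \<and>
        is_colimit ?J C ?F X x \<and> is_limit ?K C ?G Y ?y \<and>
        h \<in> Hom C X Y \<and>
        (\<forall>j \<in> Ob ?J. \<forall>k \<in> Ob ?K. ?y k \<cdot> (h \<cdot> x j) = ?c k j \<cdot> ?p j k)"
    proof (intro conjI)
      show "filtered_cat ?J" by (rule chain_cat_filtered[OF e])
      show "finite_cat ?K" by (rule par_cat_finite[OF ab(1,2)]) simp
      show "is_functor (prod_cat ?J ?K) C D" by (rule D)
      show "is_functor ?J C ?F" by (rule F)
      show "is_colimit ?J C ?F X x" by (rule X)
      show "h \<in> Hom C X Y" using h arD by blast
      show "is_functor ?K C ?G" by (rule par_diag_functor[OF ab(1,2) R PO \<gamma>[OF w]])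
      show "is_limit ?K C ?G Y ?y"
        by (rule kernel_is_limit[OF Y w ab(1,3)]) (use ab in \<open>simp_all add: par_diag_def \<gamma>_def\<close>)
      show "\<forall>j \<in> Ob ?J. is_limit ?K C (slice_fst ?J D j) (dob ?F j) (?p j)"
      proof
        fix j assume "j \<in> Ob ?J"
        then obtain n where n: "j = e n" by auto
        have "is_limit ?K C (slice_fst ?J D j) (K n) (\<lambda>i. if i = a then k n else zeroA C (K n) (Q n))"
          by (rule kernel_is_limit[OF ker q ab(1,3)])
            (use ab n in \<open>simp_all add: slice_fst_def Dd ix \<gamma>_def t_id\<close>)
        then show "is_limit ?K C (slice_fst ?J D j) (dob ?F j) (?p j)"
          unfolding n Fd ix .
      qed
      show "\<forall>j \<in> Ob ?J. \<forall>j' \<in> Ob ?J. \<forall>u \<in> Hom ?J j j'. \<forall>k \<in> Ob ?K.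
           ?p j' k \<cdot> dar ?F j j' u = dar D (j, k) (j', k) (u, idt ?K k) \<cdot> ?p j k"
      proof (intro ballI)
        fix j j' u z assume "j \<in> Ob ?J" "j' \<in> Ob ?J" and u: "u \<in> Hom ?J j j'" and z: "z \<in> Ob ?K"
        then obtain n n' where n: "j = e n" "j' = e n'" by auto
        then have le: "n \<le> n'" using u e by simp
        show "?p j' z \<cdot> dar ?F j j' u = dar D (j, z) (j', z) (u, idt ?K z) \<cdot> ?p j z"
          using n le z ab Fd r(2)[OF le] id_left[OF kD(1)] zero_cmp[OF r(1)[OF le] QO]
            cmp_zero[OF t(1)[OF le] KO]
          by (auto simp: ix Dd par_cat_simps)
      qed
      show "\<forall>z \<in> Ob ?K. is_colimit ?J C (slice_snd ?K D z) (dob ?G z) (?c z)"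
      proof
        fix z assume "z \<in> Ob ?K"
        then consider "z = a" | "z = b" by (auto simp: par_cat_simps)
        then show "is_colimit ?J C (slice_snd ?K D z) (dob ?G z) (?c z)"
        proof cases
          case 1
          have sl: "slice_snd ?K D z = \<lparr>dob = (\<lambda>_. R), dar = (\<lambda>_ _ _. idt C R)\<rparr>"
            using 1 by (simp add: slice_snd_def Dd)
          \<comment> \<open>A cocone on the constant diagram has equal legs, since every stage
            receives an arrow from the stage \<open>e 0\<close>.\<close>
          have "\<exists>!g. g \<in> Hom C R M \<and> (\<forall>i \<in> Ob ?J. g \<cdot> idt C R = m i)"
            if M: "is_cocone ?J C \<lparr>dob = (\<lambda>_. R), dar = (\<lambda>_ _ _. idt C R)\<rparr> M m" for M m
          proof -
            have ma: "ar R M (m (e n))" for n using M R by (auto simp: is_cocone_def ar_def)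
            have "m (e n) \<cdot> idt C R = m (e 0)" for n
              using cocone_eq[OF M, of "e 0" "e n" "e 0"] e by simp
            then have mc: "m (e n) = m (e 0)" for n using id_right[OF ma] by simp
            show ?thesis
            proof (rule ex1I[of _ "m (e 0)"])
              show "m (e 0) \<in> Hom C R M \<and> (\<forall>i \<in> Ob ?J. m (e 0) \<cdot> idt C R = m i)"
              proof (intro conjI ballI)
                show "m (e 0) \<in> Hom C R M" using arD(3)[OF ma] .
                fix i assume "i \<in> Ob ?J"
                then obtain n where "i = e n" by auto
                then show "m (e 0) \<cdot> idt C R = m i" using id_right[OF ma, of 0] mc[of n] by simp
              qed
              fix g assume "g \<in> Hom C R M \<and> (\<forall>i \<in> Ob ?J. g \<cdot> idt C R = m i)"
              then have "g \<in> Hom C R M" "g \<cdot> idt C R = m (e 0)" by auto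
              then show "g = m (e 0)" using idt_right[OF R arD(2)[OF ma]] by simp
            qed
          qed
          moreover have "is_cocone ?J C \<lparr>dob = (\<lambda>_. R), dar = (\<lambda>_ _ _. idt C R)\<rparr> R (\<lambda>_. idt C R)"
            using R R1 by (simp add: is_cocone_def)
          ultimately show ?thesis unfolding sl using 1 by (simp add: is_colimit_def par_diag_def)
        next
          case 2
          then have "slice_snd ?K D z = ?T"
            using ab by (simp add: slice_snd_def Dd chain_diag_def ix_def)
          then show ?thesis using P 2 ab by (simp add: par_diag_def)
        qed
      qed
      show "\<forall>k \<in> Ob ?K. \<forall>k' \<in> Ob ?K. \<forall>v \<in> Hom ?K k k'. \<forall>j \<in> Ob ?J.
           dar ?G k k' v \<cdot> ?c k j = ?c k' j \<cdot> dar D (j, k) (j, k') (idt ?J j, v)"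
      proof (intro ballI)
        fix z z' v j assume z: "z \<in> Ob ?K" and z': "z' \<in> Ob ?K" and v: "v \<in> Hom ?K z z'" and "j \<in> Ob ?J"
        then obtain n where n: "j = e n" by auto
        have "c (e n) \<cdot> \<gamma> (Q n) (q n) v = \<gamma> P w v" using \<gamma>_cmp[OF q c] cq by simp
        then show "dar ?G z z' v \<cdot> ?c z j = ?c z' j \<cdot> dar D (j, z) (j, z') (idt ?J j, v)"
          using z z' v n ab R1 id_right[OF \<gamma>[OF w]] id_left[OF c] id_right[OF c] t_id
          by (auto simp: par Dd par_diag_def ix)
      qed
      show "\<forall>j \<in> Ob ?J. \<forall>k \<in> Ob ?K. ?y k \<cdot> (h \<cdot> x j) = ?c k j \<cdot> ?p j k"
      proof (intro ballI)
        fix j z assume "j \<in> Ob ?J" and z: "z \<in> Ob ?K"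
        then obtain n where n: "j = e n" by auto
        show "?y z \<cdot> (h \<cdot> x j) = ?c z j \<cdot> ?p j z"
          using n z ab hx m(2) id_left[OF kD(1)] zero_cmp[OF m(1) PO] cmp_zero[OF c KO]
          by (auto simp: par_cat_simps ix)
      qed
    qed
  qed
  moreover have "is_mono C Y R y" using is_monoI[OF yD(1) yD(4)] .
  ultimately have mono: "is_mono C X R (y \<cdot> h)" using is_mono_cmp_iso XO YO R by blast
  have fgX: "finitely_generated U C X" using fg[OF XO mono] .
  have "\<forall>i \<in> Ob ?J. \<forall>j \<in> Ob ?J. \<forall>u \<in> Hom ?J i j. is_mono C (dob ?F i) (dob ?F j) (dar ?F i j u)"
    using r_mono e Fd by auto
  then have "hom_preserves_colimit C X ?J ?F X x"
    using fgX small chain_cat_filtered[OF e] F X unfolding finitely_generated_def by blast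
  then obtain i g where "i \<in> Ob ?J" and g0: "ar X (dob ?F i) g" "x i \<cdot> g = idt C X"
    by (rule hom_preserves_colimitE[OF _ F Xc ar_idt[OF XO]])
  then obtain n where n: "i = e n" by auto
  have g: "ar X (K n) g" "x (e n) \<cdot> g = idt C X" using g0 n Fd by auto
  define z where "z = y \<cdot> h"
  have z: "ar X R z" unfolding z_def using ar_cmp[OF h yD(1)] .
  have zx: "z \<cdot> x (e l) = k l" for l
    unfolding z_def using assoc[OF x h yD(1)] hx m(2) by simp
  \<comment> \<open>The inclusion of \<open>K (Suc n)\<close> into \<open>R\<close> passes through
    \<open>X\<close>, and the identity of \<open>X\<close> factors through stage \<open>n\<close>;
    hence the inclusion factors through \<open>k n\<close>.\<close>
  have kn: "k (Suc n) = k n \<cdot> (g \<cdot> x (e (Suc n)))"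
  proof -
    have "k n \<cdot> (g \<cdot> x (e (Suc n))) = z \<cdot> (x (e n) \<cdot> (g \<cdot> x (e (Suc n))))"
      using zx[of n] assoc[OF ar_cmp[OF x g(1)] x z] by simp
    also have "\<dots> = z \<cdot> x (e (Suc n))" using assoc[OF x g(1) x] g(2) id_left[OF x] by simp
    finally show ?thesis using zx by simp
  qed
  have "q n \<cdot> f = zeroA C R (Q n)" if f: "ar R R f" "q (Suc n) \<cdot> f = zeroA C R (Q (Suc n))" for f
  proof -
    obtain f' where f': "ar R (K (Suc n)) f'" "k (Suc n) \<cdot> f' = f" using kD(3)[OF f] by blast
    note gx = ar_cmp[OF x g(1)]
    have "f = k n \<cdot> ((g \<cdot> x (e (Suc n))) \<cdot> f')"
      using f'(2) kn assoc[OF f'(1) gx kD(1)] by simp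
    then have "q n \<cdot> f = (q n \<cdot> k n) \<cdot> ((g \<cdot> x (e (Suc n))) \<cdot> f')"
      using assoc[OF ar_cmp[OF f'(1) gx] kD(1) q] by simp
    then show ?thesis using kD(2) zero_cmp[OF ar_cmp[OF f'(1) gx] QO] by simp
  qed
  then show ?thesis by blast
qed

end

section \<open>Noetherian endomorphism rings\<close>

context preadditive_category
begin

text \<open>The object is the colimit of the arrows of \<open>F\<close> together with zero.
  Including zero makes the common composite with \<open>l b\<close> vanish, which turns a joint
  coequalizer into a joint cokernel and also covers an empty \<open>F\<close>. In the last clause
  (C1) acts, through \<open>additive_colimit_ideal\<close>.\<close>

lemma joint_cokernel:
  fixes U :: "'u set" and R :: 'o
  assumes R: "R \<in> Ob C" and U: "uncountable U" and colim: "has_small_colimits U C"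
    and cring: "cring (endo_ring C R)"
    and C1: "\<And>(J :: ('u, 'u) cat) D L l. \<lbrakk>finite_cat J; is_functor J C D; \<And>i. i \<in> Ob J \<Longrightarrow> dob D i = R;
      is_colimit J C D L l\<rbrakk> \<Longrightarrow> hom_preserves_additive_colimit C R J D L l"
    and F: "finite F" "F \<subseteq> Hom C R R"
  shows "\<exists>Q q. ar R Q q \<and> (\<forall>f \<in> F. q \<cdot> f = zeroA C R Q) \<and>
    (\<forall>Z g. ar R Z g \<longrightarrow> (\<forall>f \<in> F. g \<cdot> f = zeroA C R Z) \<longrightarrow> (\<exists>h. ar Q Z h \<and> h \<cdot> q = g)) \<and>
    (\<forall>Z g h. ar Q Z g \<longrightarrow> ar Q Z h \<longrightarrow> g \<cdot> q = h \<cdot> q \<longrightarrow> g = h) \<and>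
    (\<forall>g. ar R R g \<longrightarrow> q \<cdot> g = zeroA C R Q \<longrightarrow> g \<in> Idl\<^bsub>endo_ring C R\<^esub> F)"
proof -
  interpret E: cring "endo_ring C R" by fact
  obtain e :: "nat \<Rightarrow> 'u" where e: "inj e"
    using U uncountable_infinite infinite_countable_subset by (metis)
  define a b where "a = e 0" and "b = e 1"
  let ?F = "insert (zeroA C R R) F"
  have F': "finite ?F" "?F \<subseteq> Hom C R R" using F arD(3)[OF ar_zero[OF R R]] by auto
  obtain k where k: "bij_betw k {0..<card ?F} ?F" using ex_bij_betw_nat_finite[OF F'(1)] by blast
  \<comment> \<open>The elements of \<open>F\<close> have type \<open>'a\<close>, whereas the arrows
    of an index category must have type \<open>'u\<close>; an enumeration renames them. Shifting by
    \<open>Suc\<close> avoids \<open>a = e 0\<close>, the name of the identities.\<close>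
  define S where "S = (e \<circ> Suc) ` {0..<card ?F}"
  define f where "f = k \<circ> inv_into UNIV (e \<circ> Suc)"
  have "inj (e \<circ> Suc)" using e by (simp add: inj_compose)
  then have "f ((e \<circ> Suc) n) = k n" for n
    using inv_f_f[of "e \<circ> Suc" n] by (simp add: f_def)
  then have fS: "f ` S = ?F"
    using k by (simp add: S_def image_image bij_betw_def)
  have ab: "a \<noteq> b" "a \<notin> S" and S: "finite S"
    using e by (auto simp: a_def b_def S_def inj_eq)
  have fa: "ar R R (f s)" if "s \<in> S" for s using imageI[OF that, of f] fS F' R by (auto simp: ar_def)
  obtain s0 where s0: "s0 \<in> S" "f s0 = zeroA C R R" using fS by (metis imageE insertI1)
  let ?J = "par_cat a b S" and ?D = "par_diag a C R R f"
  have J: "finite_cat ?J" using par_cat_finite ab S .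
  have D: "is_functor ?J C ?D" using par_diag_functor[OF ab R R, of f] fa by blast
  obtain Q l where Q: "is_colimit ?J C ?D Q l"
    using colim finite_cat_small[OF J U] D unfolding has_small_colimits_def by blast
  then have cc: "is_cocone ?J C ?D Q l" by (simp add: is_colimit_def)
  define q where "q = l b"
  have q: "ar R Q q" using cocone_ar[OF cc D, of b] by (simp add: q_def par_cat_simps par_diag_def)
  have QO: "Q \<in> Ob C" using q arD by blast
  have qf: "q \<cdot> f s = l a" if "s \<in> S" for s
    using cocone_eq[OF cc, of a b s] that ab by (simp add: q_def par_cat_simps par_cat_Hom par_diag_def)
  have la: "l a = zeroA C R Q" using qf[OF s0(1)] s0(2) cmp_zero[OF q R] by simp
  have qF: "q \<cdot> g = zeroA C R Q" if "g \<in> F" for g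
  proof -
    have "g \<in> f ` S" using that fS by blast
    then show ?thesis using qf la by auto
  qed
  have fac: "\<exists>h. ar Q Z h \<and> h \<cdot> q = g" if g: "ar R Z g" and gF: "\<forall>f \<in> F. g \<cdot> f = zeroA C R Z" for Z g
  proof -
    have ZO: "Z \<in> Ob C" using g arD by blast
    have gS: "g \<cdot> f s = zeroA C R Z" if "s \<in> S" for s
    proof -
      have "f s \<in> ?F" using that fS by blast
      then show ?thesis using gF cmp_zero[OF g R] by auto
    qed
    have "is_cocone ?J C ?D Z (\<lambda>i. if i = a then zeroA C R Z else g)"
      unfolding is_cocone_def
      using ZO ab arD(3)[OF g] arD(3)[OF ar_zero[OF R ZO]] id_right[OF g] id_right[OF ar_zero[OF R ZO]] gS
      by (auto simp: par_cat_simps par_cat_Hom par_diag_def)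
    then obtain h where "ar Q Z h" "\<And>i. i \<in> Ob ?J \<Longrightarrow> h \<cdot> l i = (if i = a then zeroA C R Z else g)"
      by (rule colimitE[OF Q]) blast
    then show ?thesis using ab by (auto simp: q_def par_cat_simps)
  qed
  have epi: "g = h" if "ar Q Z g" "ar Q Z h" "g \<cdot> q = h \<cdot> q" for Z g h
  proof (rule colimit_jointly_epic[OF Q that(1,2) _ D])
    fix i assume "i \<in> Ob ?J"
    then show "g \<cdot> l i = h \<cdot> l i"
      using that(3) cmp_zero[OF that(1) R] cmp_zero[OF that(2) R] la by (auto simp: par_cat_simps q_def)
  qed
  have FE: "F \<subseteq> carrier (endo_ring C R)" using F by simp
  \<comment> \<open>The annihilator of \<open>q\<close> is an ideal containing \<open>F\<close>, so
    \<open>q\<close> kills the whole ideal generated by \<open>F\<close>. Closure under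
    multiplication from the left comes from commutativity.\<close>
  let ?A = "{x \<in> Hom C R R. q \<cdot> x = zeroA C R Q}"
  have A: "ideal ?A (endo_ring C R)"
  proof (rule idealI)
    show "ring (endo_ring C R)" by (rule E.ring_axioms)
    interpret H: comm_group "hom_group C R R" using hom_group R by blast
    interpret HQ: comm_group "hom_group C R Q" using hom_group R QO by blast
    have "subgroup ?A (hom_group C R R)"
    proof (rule H.subgroupI)
      show "?A \<noteq> {}" using arD(3)[OF ar_zero[OF R R]] cmp_zero[OF q R] by auto
      fix x assume x: "x \<in> ?A"
      then have xa: "ar R R x" using R by (simp add: ar_def)
      let ?x = "inv\<^bsub>hom_group C R R\<^esub> x"
      have i: "ar R R ?x" "addA C x ?x = zeroA C R R"
        using H.inv_closed[of x] H.r_inv[of x] x R by (simp_all add: ar_def)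
      have "addA C (q \<cdot> x) (q \<cdot> ?x) = zeroA C R Q"
        using add_right'[OF xa i(1) q] i(2) cmp_zero[OF q R] by simp
      then have "q \<cdot> ?x = zeroA C R Q" using x add_zero(2)[OF ar_cmp[OF i(1) q]] by simp
      then show "?x \<in> ?A" using arD(3)[OF i(1)] by simp
    next
      fix x y assume "x \<in> ?A" "y \<in> ?A"
      then have "ar R R x" "ar R R y" "q \<cdot> x = zeroA C R Q" "q \<cdot> y = zeroA C R Q"
        using R by (simp_all add: ar_def)
      then show "x \<otimes>\<^bsub>hom_group C R R\<^esub> y \<in> ?A"
        using add_right'[OF _ _ q, of R x y] arD(3)[OF ar_add, of R R x y]
          add_zero[OF ar_zero[OF R QO]] by simp
    qed auto
    then show "subgroup ?A (add_monoid (endo_ring C R))" by (simp add: hom_group_def)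
    fix x y assume x: "x \<in> ?A" and y: "y \<in> carrier (endo_ring C R)"
    then have xa: "ar R R x" and ya: "ar R R y" using R by (simp_all add: ar_def)
    have "q \<cdot> (x \<cdot> y) = zeroA C R Q"
      using assoc[OF ya xa q] x zero_cmp[OF ya QO] by simp
    then show "x \<otimes>\<^bsub>endo_ring C R\<^esub> y \<in> ?A" using arD(3)[OF ar_cmp[OF ya xa]] by simp
    then show "y \<otimes>\<^bsub>endo_ring C R\<^esub> x \<in> ?A" using E.m_comm[of x y] x y by simp
  qed
  have qI: "q \<cdot> x = zeroA C R Q" if "x \<in> Idl\<^bsub>endo_ring C R\<^esub> F" for x
    using E.genideal_minimal[OF A, of F] F qF that by blast
  have fI: "f s \<in> Idl\<^bsub>endo_ring C R\<^esub> F" if "s \<in> S" for s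
  proof -
    have "f s \<in> ?F" using that fS by blast
    then show ?thesis
      using E.genideal_self[OF FE] additive_subgroup.zero_closed[OF ideal.axioms(1)[OF E.genideal_ideal[OF FE]]]
      by auto
  qed
  have H: "hom_preserves_additive_colimit C R ?J ?D Q l"
    using C1[OF J D _ Q] by (simp add: par_diag_def)
  have "g \<in> Idl\<^bsub>endo_ring C R\<^esub> F" if "ar R R g" "q \<cdot> g = zeroA C R Q" for g
    using additive_colimit_ideal[OF R ab fa s0 cc H E.genideal_ideal[OF FE] fI _ that(1)] qI that(2)
    by (simp add: q_def)
  then show ?thesis using q qF fac epi by blast
qed

text \<open>Isolates what the argument uses of the category of modules: \<open>fg\<close> is the
  Noetherian condition on \<open>R\<close>, and \<open>C1\<close> is the second half of (C1) for
  diagrams all of whose objects are \<open>R\<close>.\<close>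

theorem noetherian_endo_ring:
  fixes U :: "'u set" and R :: 'o
  assumes R: "R \<in> Ob C" and U: "uncountable U" and colim: "has_small_colimits U C"
    and kernels: "\<And>X Y f. ar X Y f \<Longrightarrow> \<exists>K k. is_kernel C X Y f K k"
    and comm: "filtered_colimits_commute_with_finite_limits U C"
    and fg: "\<And>N m. \<lbrakk>N \<in> Ob C; is_mono C N R m\<rbrakk> \<Longrightarrow> finitely_generated U C N"
    and cring: "cring (endo_ring C R)"
    and C1: "\<And>(J :: ('u, 'u) cat) D L l. \<lbrakk>finite_cat J; is_functor J C D; \<And>i. i \<in> Ob J \<Longrightarrow> dob D i = R;
      is_colimit J C D L l\<rbrakk> \<Longrightarrow> hom_preserves_additive_colimit C R J D L l"
  shows "noetherian_ring (endo_ring C R)"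
proof -
  interpret E: cring "endo_ring C R" by fact
  show ?thesis
  proof (rule E.noetherian_ringI, rule ccontr)
    fix I assume I: "ideal I (endo_ring C R)"
      and nfg: "\<not> (\<exists>F \<subseteq> carrier (endo_ring C R). finite F \<and> I = Idl\<^bsub>endo_ring C R\<^esub> F)"
    have IE: "I \<subseteq> Hom C R R"
      using additive_subgroup.a_subset[OF ideal.axioms(1)[OF I]] by simp
    \<comment> \<open>A finite subset of \<open>I\<close> generates an ideal inside
      \<open>I\<close>, different from \<open>I\<close> by \<open>nfg\<close>; so it misses an
      element of \<open>I\<close>, and \<open>p\<close> picks one.\<close>
    have "\<forall>F. \<exists>g. finite F \<and> F \<subseteq> I \<longrightarrow> g \<in> I - Idl\<^bsub>endo_ring C R\<^esub> F"
    proof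
      fix F
      show "\<exists>g. finite F \<and> F \<subseteq> I \<longrightarrow> g \<in> I - Idl\<^bsub>endo_ring C R\<^esub> F"
      proof (cases "finite F \<and> F \<subseteq> I")
        case True
        then have "Idl\<^bsub>endo_ring C R\<^esub> F \<subseteq> I" using E.genideal_minimal[OF I] by blast
        moreover have "F \<subseteq> carrier (endo_ring C R)" using True IE by auto
        ultimately show ?thesis using nfg True by blast
      qed blast
    qed
    then obtain p where p: "\<forall>F. finite F \<and> F \<subseteq> I \<longrightarrow> p F \<in> I - Idl\<^bsub>endo_ring C R\<^esub> F"
      by (rule choice[THEN exE])
    define F where "F = rec_nat {} (\<lambda>_ B. insert (p B) B)"
    have F_Suc: "F (Suc n) = insert (p (F n)) (F n)" and F_0: "F 0 = {}" for n by (simp_all add: F_def)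
    have F: "finite (F n)" "F n \<subseteq> I" for n
      by (induction n) (use p in \<open>auto simp: F_Suc F_0\<close>)
    have F_mono: "F m \<subseteq> F n" if "m \<le> n" for m n
      using that by (rule lift_Suc_mono_le[rotated]) (auto simp: F_Suc)
    have FH: "F n \<subseteq> Hom C R R" for n using F(2) IE by blast
    let ?P = "\<lambda>F Q q. ar R Q q \<and> (\<forall>f \<in> F. q \<cdot> f = zeroA C R Q) \<and>
      (\<forall>Z g. ar R Z g \<longrightarrow> (\<forall>f \<in> F. g \<cdot> f = zeroA C R Z) \<longrightarrow> (\<exists>h. ar Q Z h \<and> h \<cdot> q = g)) \<and>
      (\<forall>Z g h. ar Q Z g \<longrightarrow> ar Q Z h \<longrightarrow> g \<cdot> q = h \<cdot> q \<longrightarrow> g = h) \<and>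
      (\<forall>g. ar R R g \<longrightarrow> q \<cdot> g = zeroA C R Q \<longrightarrow> g \<in> Idl\<^bsub>endo_ring C R\<^esub> F)"
    have "\<exists>Q q. ?P (F n) Q q" for n
      by (rule joint_cokernel[OF R U colim cring C1 F(1) FH])
    then have "\<forall>n. \<exists>z. ?P (F n) (fst z) (snd z)" unfolding split_paired_Ex fst_conv snd_conv by (rule allI)
    then obtain z where z: "\<forall>n. ?P (F n) (fst (z n)) (snd (z n))" by (rule choice[THEN exE])
    define Q q where "Q n = fst (z n)" and "q n = snd (z n)" for n
    have P: "?P (F n) (Q n) (q n)" for n unfolding Q_def q_def using z by (rule spec)
    note P' = P[THEN conjunct2] and P'' = P[THEN conjunct2, THEN conjunct2]
    have q: "ar R (Q n) (q n)" for n by (rule P[THEN conjunct1])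
    have qF: "q n \<cdot> f = zeroA C R (Q n)" if "f \<in> F n" for n f
      using P'[THEN conjunct1] that by (rule bspec)
    have fac: "\<exists>h. ar (Q n) Z h \<and> h \<cdot> q n = g"
      if "ar R Z g" "\<forall>f \<in> F n. g \<cdot> f = zeroA C R Z" for n Z g
      by (rule P''[THEN conjunct1, rule_format]) (use that in auto)
    have epi: "g = h" if "ar (Q n) Z g" "ar (Q n) Z h" "g \<cdot> q n = h \<cdot> q n" for n Z g h
      by (rule P''[THEN conjunct2, THEN conjunct1, rule_format, OF that])
    have qI: "g \<in> Idl\<^bsub>endo_ring C R\<^esub> (F n)" if "ar R R g" "q n \<cdot> g = zeroA C R (Q n)" for n g
      by (rule P''[THEN conjunct2, THEN conjunct2, rule_format, OF that])
    have factor: "\<exists>t. ar (Q m) (Q n) t \<and> t \<cdot> q m = q n" if "m \<le> n" for m n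
      using fac[OF q] qF F_mono[OF that] by blast
    have "\<exists>n. \<forall>g. ar R R g \<and> q (Suc n) \<cdot> g = zeroA C R (Q (Suc n)) \<longrightarrow> q n \<cdot> g = zeroA C R (Q n)"
      by (rule kernel_chain_stationary[OF R U colim]) (fact kernels comm fg q epi factor)+
    then obtain n where n: "\<forall>g. ar R R g \<and> q (Suc n) \<cdot> g = zeroA C R (Q (Suc n)) \<longrightarrow> q n \<cdot> g = zeroA C R (Q n)"
      by blast
    have pn: "p (F n) \<in> I - Idl\<^bsub>endo_ring C R\<^esub> (F n)" using p F by blast
    then have g: "ar R R (p (F n))" using IE R by (auto simp: ar_def)
    have "q (Suc n) \<cdot> p (F n) = zeroA C R (Q (Suc n))" by (rule qF) (simp add: F_Suc)
    then show False using qI[OF g] n g pn by blast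
  qed
qed

end

section \<open>Additivity of the tensor product\<close>

context preadditive_category
begin

text \<open>The tensor hypothesis concerns colimits of diagrams, so a biproduct is recast as the
  colimit over two objects without arrows between them. The mediating arrow is the sum of the
  \<open>m i\<close> composed with the projections. With no arrow to interpret, \<open>g\<close> is
  arbitrary.\<close>

lemma biproduct_colimit:
  assumes bp: "is_biproduct C X Y P i1 i2 p1 p2" and ob: "X \<in> Ob C" "Y \<in> Ob C" and ab: "a \<noteq> b"
  shows "is_colimit (par_cat a b {}) C (par_diag a C X Y g) P (\<lambda>i. if i = a then i1 else i2)"
proof -
  have i1: "ar X P i1" and i2: "ar Y P i2" and p1: "ar P X p1" and p2: "ar P Y p2"
    and e: "p1 \<cdot> i1 = idt C X" "p2 \<cdot> i2 = idt C Y" "p1 \<cdot> i2 = zeroA C Y X" "p2 \<cdot> i1 = zeroA C X Y"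
      "addA C (i1 \<cdot> p1) (i2 \<cdot> p2) = idt C P"
    using bp ob by (auto simp: is_biproduct_def ar_def)
  have cc: "is_cocone (par_cat a b {}) C (par_diag a C X Y g) P (\<lambda>i. if i = a then i1 else i2)"
    using arD[OF i1] arD[OF i2] id_right[OF i1] id_right[OF i2] ab
    by (auto simp: is_cocone_def par_cat_def par_diag_def split: if_splits)
  have "\<exists>!h. h \<in> Hom C P M \<and> (\<forall>i\<in>Ob (par_cat a b {}). h \<cdot> (if i = a then i1 else i2) = m i)"
    if "is_cocone (par_cat a b {}) C (par_diag a C X Y g) M m" for M m
  proof -
    have m1: "ar X M (m a)" and m2: "ar Y M (m b)"
      using that ob ab by (auto simp: is_cocone_def par_cat_def par_diag_def ar_def)
    let ?h = "addA C (m a \<cdot> p1) (m b \<cdot> p2)"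
    note q1 = ar_cmp[OF p1 m1] and q2 = ar_cmp[OF p2 m2]
    have h: "ar P M ?h" using ar_add q1 q2 .
    have "?h \<cdot> i1 = addA C (m a \<cdot> (p1 \<cdot> i1)) (m b \<cdot> (p2 \<cdot> i1))"
      using add_left'[OF i1 q1 q2] assoc[OF i1 p1 m1] assoc[OF i1 p2 m2] by simp
    also have "\<dots> = m a" using e id_right[OF m1] cmp_zero[OF m2 ob(1)] add_zero[OF m1] by simp
    finally have h1: "?h \<cdot> i1 = m a" .
    have "?h \<cdot> i2 = addA C (m a \<cdot> (p1 \<cdot> i2)) (m b \<cdot> (p2 \<cdot> i2))"
      using add_left'[OF i2 q1 q2] assoc[OF i2 p1 m1] assoc[OF i2 p2 m2] by simp
    also have "\<dots> = m b" using e id_right[OF m2] cmp_zero[OF m1 ob(2)] add_zero[OF m2] by simp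
    finally have h2: "?h \<cdot> i2 = m b" .
    have u: "k = ?h" if k: "ar P M k" and k1: "k \<cdot> i1 = m a" and k2: "k \<cdot> i2 = m b" for k
    proof -
      have "k = k \<cdot> addA C (i1 \<cdot> p1) (i2 \<cdot> p2)" using e(5) id_right[OF k] by simp
      also have "\<dots> = addA C (k \<cdot> (i1 \<cdot> p1)) (k \<cdot> (i2 \<cdot> p2))"
        using add_right'[OF ar_cmp[OF p1 i1] ar_cmp[OF p2 i2] k] .
      also have "\<dots> = ?h" using assoc[OF p1 i1 k] assoc[OF p2 i2 k] k1 k2 by simp
      finally show ?thesis .
    qed
    show ?thesis
    proof (rule ex1I[of _ ?h])
      show "?h \<in> Hom C P M \<and> (\<forall>i\<in>Ob (par_cat a b {}). ?h \<cdot> (if i = a then i1 else i2) = m i)"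
        using h h1 h2 ab arD by (auto simp: par_cat_def)
      fix k assume "k \<in> Hom C P M \<and> (\<forall>i\<in>Ob (par_cat a b {}). k \<cdot> (if i = a then i1 else i2) = m i)"
      then show "k = ?h" using u[of k] h ab by (auto simp: par_cat_def ar_def)
    qed
  qed
  then show ?thesis using cc by (simp add: is_colimit_def)
qed

lemma zero_object_ar:
  assumes "is_zero_object C Z" "ar X Y f" "ar X Y g" "X = Z \<or> Y = Z" shows "f = g"
  using assms unfolding is_zero_object_def ar_def by metis

end

section \<open>Tensoring with a fixed object on the left\<close>

context symmetric_monoidal_category
begin

abbreviation whisker (infixr "\<rhd>" 80) where "X \<rhd> f \<equiv> idt C X \<boxtimes>\<^sub>a f"

lemma ar_ten: "\<lbrakk>ar X X' f; ar Y Y' g\<rbrakk> \<Longrightarrow> ar (X \<boxtimes> Y) (X' \<boxtimes> Y') (f \<boxtimes>\<^sub>a g)"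
  using ten_ob ten_ar[of X X' Y Y' f g] by (simp add: ar_def)

lemma ar_whisker: "\<lbrakk>X \<in> Ob C; ar Y Z f\<rbrakk> \<Longrightarrow> ar (X \<boxtimes> Y) (X \<boxtimes> Z) (X \<rhd> f)"
  by (rule ar_ten[OF ar_idt])

lemma ten_cmp': "\<lbrakk>ar X X' f; ar X' X'' f'; ar Y Y' g; ar Y' Y'' g'\<rbrakk>
    \<Longrightarrow> (f' \<cdot> f) \<boxtimes>\<^sub>a (g' \<cdot> g) = (f' \<boxtimes>\<^sub>a g') \<cdot> (f \<boxtimes>\<^sub>a g)"
  using ten_cmp[of X X' X'' Y Y' Y'' f f' g g'] by (simp add: ar_def)

lemma whisker_cmp: "\<lbrakk>X \<in> Ob C; ar W Y f; ar Y Z g\<rbrakk> \<Longrightarrow> X \<rhd> (g \<cdot> f) = (X \<rhd> g) \<cdot> (X \<rhd> f)"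
  using ten_cmp'[OF ar_idt ar_idt, of X W Y f Z g] id_left[OF ar_idt, of X] by simp

text \<open>Together with \<open>ten_split2\<close> this is the interchange law that moves an arrow
  past a multiplication or a unit.\<close>

lemma ten_split1: "\<lbrakk>ar X X' f; ar Y Y' g\<rbrakk> \<Longrightarrow> (X' \<rhd> g) \<cdot> (f \<boxtimes>\<^sub>a idt C Y) = f \<boxtimes>\<^sub>a g"
  using ten_cmp'[OF _ ar_idt ar_idt, of X X' f Y Y' g] id_left[of X X' f] id_right[of Y Y' g] arD
  by simp

lemma ten_split2: "\<lbrakk>ar X X' f; ar Y Y' g\<rbrakk> \<Longrightarrow> (f \<boxtimes>\<^sub>a idt C Y') \<cdot> (X \<rhd> g) = f \<boxtimes>\<^sub>a g"
  using ten_cmp'[OF ar_idt _ _ ar_idt, of X X' f Y Y' g] id_right[of X X' f] id_left[of Y Y' g] arD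
  by simp

lemma ar_braid: "\<lbrakk>X \<in> Ob C; Y \<in> Ob C\<rbrakk> \<Longrightarrow> ar (X \<boxtimes> Y) (Y \<boxtimes> X) (braidA C X Y)"
  using braid_iso[of X Y] ten_ob by (simp add: ar_def is_iso_def)

lemma braid_nat': "\<lbrakk>ar X X' f; ar Y Y' g\<rbrakk>
    \<Longrightarrow> braidA C X' Y' \<cdot> (f \<boxtimes>\<^sub>a g) = (g \<boxtimes>\<^sub>a f) \<cdot> braidA C X Y"
  using braid_nat[of X X' Y Y' f g] by (simp add: ar_def)

lemma ar_assoc: "\<lbrakk>X \<in> Ob C; Y \<in> Ob C; Z \<in> Ob C\<rbrakk>
    \<Longrightarrow> ar ((X \<boxtimes> Y) \<boxtimes> Z) (X \<boxtimes> (Y \<boxtimes> Z)) (assocA C X Y Z)"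
  using assoc_iso[of X Y Z] ten_ob by (simp add: ar_def is_iso_def)

lemma ar_lunit: "X \<in> Ob C \<Longrightarrow> ar (unitO C \<boxtimes> X) X (lunitA C X)"
  using lunit_iso[of X] ten_ob unit_ob by (simp add: ar_def is_iso_def)

end

definition whisker_diag ::
  "('o, 'a, 'm) monoidal_cat_scheme \<Rightarrow> 'o \<Rightarrow> ('i, 'j, 'o, 'a) diagram \<Rightarrow> ('i, 'j, 'o, 'a) diagram" where
  "whisker_diag C X D = \<lparr>dob = (\<lambda>i. X \<boxtimes>\<^bsub>C\<^esub> dob D i), dar = (\<lambda>i j u. idt C X \<boxtimes>\<^sub>a\<^bsub>C\<^esub> dar D i j u)\<rparr>"

lemma (in symmetric_monoidal_category) whisker_diag_functor:
  assumes "X \<in> Ob C" "is_functor J C D" shows "is_functor J C (whisker_diag C X D)"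
  unfolding is_functor_def
proof (intro conjI ballI)
  show "category J" "category C" using assms(2) by (auto simp: is_functor_def)
  fix i assume i: "i \<in> Ob J"
  have Di: "dob D i \<in> Ob C" using assms(2) i by (auto simp: is_functor_def)
  then show "dob (whisker_diag C X D) i \<in> Ob C" using assms ten_ob by (simp add: whisker_diag_def)
  show "dar (whisker_diag C X D) i i (idt J i) = idt C (dob (whisker_diag C X D) i)"
    using assms i Di ten_idt by (simp add: whisker_diag_def is_functor_def)
  fix j u assume j: "j \<in> Ob J" and u: "u \<in> Hom J i j"
  show "dar (whisker_diag C X D) i j u \<in> Hom C (dob (whisker_diag C X D) i) (dob (whisker_diag C X D) j)"
    using ar_whisker[OF assms(1) functor_ar[OF assms(2) i j u]] arD by (simp add: whisker_diag_def)
  fix k v assume k: "k \<in> Ob J" and v: "v \<in> Hom J j k"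
  show "dar (whisker_diag C X D) i k (v \<cdot>\<^bsub>J\<^esub> u)
      = dar (whisker_diag C X D) j k v \<cdot> dar (whisker_diag C X D) i j u"
    using whisker_cmp[OF assms(1) functor_ar[OF assms(2) i j u] functor_ar[OF assms(2) j k v]]
      assms(2) i j k u v by (simp add: whisker_diag_def is_functor_def)
qed

context standing_assumptions
begin

text \<open>Preservation is assumed for tensoring on the right, but actions have the monoid on the
  left. Composing with the braiding turns a cocone on one side into a cocone on the other, and
  \<open>symmetry\<close> makes this reversible.\<close>

lemma whisker_colimit:
  fixes J :: "('u, 'u) cat"
  assumes X: "X \<in> Ob C" and J: "small_cat U J" and D: "is_functor J C D" and L: "is_colimit J C D L l"
  shows "is_colimit J C (whisker_diag C X D) (X \<boxtimes> L) (\<lambda>i. X \<rhd> l i)"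
proof -
  let ?D = "\<lparr>dob = (\<lambda>i. dob D i \<boxtimes> X), dar = (\<lambda>i j u. dar D i j u \<boxtimes>\<^sub>a idt C X)\<rparr>"
  have R: "is_colimit J C ?D (L \<boxtimes> X) (\<lambda>i. l i \<boxtimes>\<^sub>a idt C X)"
    using tensor_preserves_colimits[OF X J D L] .
  have cc: "is_cocone J C D L l" using L by (simp add: is_colimit_def)
  then have LO: "L \<in> Ob C" by (simp add: is_cocone_def)
  note la = cocone_ar[OF cc D] and Da = functor_ar[OF D]
  note bXL = ar_braid[OF X LO] and bLX = ar_braid[OF LO X]
  have DO: "dob D i \<in> Ob C" if "i \<in> Ob J" for i using D that by (simp add: is_functor_def)
  have "is_cocone J C (whisker_diag C X D) (X \<boxtimes> L) (\<lambda>i. X \<rhd> l i)"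
    unfolding is_cocone_def
  proof (intro conjI ballI)
    show "X \<boxtimes> L \<in> Ob C" using X LO ten_ob by simp
    fix i assume i: "i \<in> Ob J"
    show "X \<rhd> l i \<in> Hom C (dob (whisker_diag C X D) i) (X \<boxtimes> L)"
      using ar_whisker[OF X la[OF i]] arD by (simp add: whisker_diag_def)
    fix j u assume j: "j \<in> Ob J" and u: "u \<in> Hom J i j"
    show "(X \<rhd> l j) \<cdot> dar (whisker_diag C X D) i j u = X \<rhd> l i"
      using whisker_cmp[OF X Da[OF i j u] la[OF j]] cocone_eq[OF cc i j u] by (simp add: whisker_diag_def)
  qed
  moreover have "\<exists>!h. h \<in> Hom C (X \<boxtimes> L) M \<and> (\<forall>i\<in>Ob J. h \<cdot> (X \<rhd> l i) = m i)"
    if m: "is_cocone J C (whisker_diag C X D) M m" for M m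
  proof -
    have ma: "ar (X \<boxtimes> dob D i) M (m i)" if "i \<in> Ob J" for i
      using cocone_ar[OF m whisker_diag_functor[OF X D] that] by (simp add: whisker_diag_def)
    have MO: "M \<in> Ob C" using m by (simp add: is_cocone_def)
    let ?m = "\<lambda>i. m i \<cdot> braidA C (dob D i) X"
    have m'a: "ar (dob D i \<boxtimes> X) M (?m i)" if "i \<in> Ob J" for i
      using ar_cmp[OF ar_braid[OF DO[OF that] X] ma[OF that]] .
    have "is_cocone J C ?D M ?m"
      unfolding is_cocone_def
    proof (intro conjI ballI)
      show "M \<in> Ob C" by fact
      fix i assume i: "i \<in> Ob J"
      show "?m i \<in> Hom C (dob ?D i) M" using m'a[OF i] arD by simp
      fix j u assume j: "j \<in> Ob J" and u: "u \<in> Hom J i j"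
      have "?m j \<cdot> (dar D i j u \<boxtimes>\<^sub>a idt C X) = m j \<cdot> (braidA C (dob D j) X \<cdot> (dar D i j u \<boxtimes>\<^sub>a idt C X))"
        using assoc[OF ar_ten[OF Da[OF i j u] ar_idt[OF X]] ar_braid[OF DO[OF j] X] ma[OF j]] .
      also have "\<dots> = m j \<cdot> ((X \<rhd> dar D i j u) \<cdot> braidA C (dob D i) X)"
        using braid_nat'[OF Da[OF i j u] ar_idt[OF X]] by simp
      also have "\<dots> = (m j \<cdot> (X \<rhd> dar D i j u)) \<cdot> braidA C (dob D i) X"
        using assoc[OF ar_braid[OF DO[OF i] X] ar_whisker[OF X Da[OF i j u]] ma[OF j]] by simp
      also have "\<dots> = ?m i" using cocone_eq[OF m i j u] by (simp add: whisker_diag_def)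
      finally show "?m j \<cdot> dar ?D i j u = ?m i" by simp
    qed
    then obtain h' where h'a: "ar (L \<boxtimes> X) M h'"
      and h': "\<And>i. i \<in> Ob J \<Longrightarrow> h' \<cdot> (l i \<boxtimes>\<^sub>a idt C X) = ?m i"
      and u: "\<And>k. \<lbrakk>ar (L \<boxtimes> X) M k; \<And>i. i \<in> Ob J \<Longrightarrow> k \<cdot> (l i \<boxtimes>\<^sub>a idt C X) = ?m i\<rbrakk> \<Longrightarrow> k = h'"
      by (rule colimitE[OF R]) blast
    show ?thesis
    proof (rule ex1I[of _ "h' \<cdot> braidA C X L"], intro conjI ballI)
      show "h' \<cdot> braidA C X L \<in> Hom C (X \<boxtimes> L) M" using ar_cmp[OF bXL h'a] arD by simp
      fix i assume i: "i \<in> Ob J"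
      note b1 = ar_braid[OF X DO[OF i]] and b2 = ar_braid[OF DO[OF i] X]
      note lX = ar_ten[OF la[OF i] ar_idt[OF X]]
      have "(h' \<cdot> braidA C X L) \<cdot> (X \<rhd> l i) = h' \<cdot> ((l i \<boxtimes>\<^sub>a idt C X) \<cdot> braidA C X (dob D i))"
        using assoc[OF ar_whisker[OF X la[OF i]] bXL h'a] braid_nat'[OF ar_idt[OF X] la[OF i]] by simp
      also have "\<dots> = (m i \<cdot> braidA C (dob D i) X) \<cdot> braidA C X (dob D i)"
        using assoc[OF b1 lX h'a] h'[OF i] by simp
      also have "\<dots> = m i"
        using assoc[OF b1 b2 ma[OF i]] symmetry[OF X DO[OF i]] id_right[OF ma[OF i]] by simp
      finally show "(h' \<cdot> braidA C X L) \<cdot> (X \<rhd> l i) = m i" .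
    next
      fix k assume k: "k \<in> Hom C (X \<boxtimes> L) M \<and> (\<forall>i\<in>Ob J. k \<cdot> (X \<rhd> l i) = m i)"
      then have ka: "ar (X \<boxtimes> L) M k" using X LO MO ten_ob by (simp add: ar_def)
      have "(k \<cdot> braidA C L X) \<cdot> (l i \<boxtimes>\<^sub>a idt C X) = ?m i" if i: "i \<in> Ob J" for i
        using assoc[OF ar_ten[OF la[OF i] ar_idt[OF X]] bLX ka]
          braid_nat'[OF la[OF i] ar_idt[OF X]]
          assoc[OF ar_braid[OF DO[OF i] X] ar_whisker[OF X la[OF i]] ka] k i by simp
      then have "k \<cdot> braidA C L X = h'"
        by (intro u ar_cmp[OF bLX ka])
      then show "k = h' \<cdot> braidA C X L"
        using assoc[OF bXL bLX ka] symmetry[OF X LO] id_right[OF ka] by simp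
    qed
  qed
  ultimately show ?thesis by (simp add: is_colimit_def)
qed

lemma two_indices: obtains a b :: 'u where "a \<noteq> b"
proof -
  have "infinite U" using universe_uncountable uncountable_infinite by blast
  then obtain a where "a \<in> U" by (metis finite.emptyI ex_in_conv)
  moreover have "U \<noteq> {a}" using \<open>infinite U\<close> by auto
  ultimately show ?thesis using that by blast
qed

text \<open>The biproduct, seen as a colimit by \<open>biproduct_colimit\<close>, is preserved by
  \<open>whisker_colimit\<close>.\<close>

lemma whisker_biproduct:
  assumes bp: "is_biproduct C X Y P i1 i2 p1 p2" and V: "V \<in> Ob C" and ob: "X \<in> Ob C" "Y \<in> Ob C"
    and m1: "ar (V \<boxtimes> X) M m1" and m2: "ar (V \<boxtimes> Y) M m2"
  shows "\<exists>!h. ar (V \<boxtimes> P) M h \<and> h \<cdot> (V \<rhd> i1) = m1 \<and> h \<cdot> (V \<rhd> i2) = m2"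
proof -
  obtain a b :: 'u where ab: "a \<noteq> b" by (rule two_indices)
  let ?J = "par_cat a b {}" and ?D = "par_diag a C X Y (\<lambda>_. undefined)"
  have J: "small_cat U ?J"
    by (intro finite_cat_small par_cat_finite ab universe_uncountable) simp_all
  have D: "is_functor ?J C ?D" by (intro par_diag_functor ab ob) simp_all
  have L: "is_colimit ?J C (whisker_diag C V ?D) (V \<boxtimes> P) (\<lambda>i. V \<rhd> (if i = a then i1 else i2))"
    using whisker_colimit[OF V J D biproduct_colimit[OF bp ob ab]] .
  have PO: "V \<boxtimes> P \<in> Ob C" "M \<in> Ob C"
    using bp V m1 ten_ob by (auto simp: is_biproduct_def ar_def)
  have "is_cocone ?J C (whisker_diag C V ?D) M (\<lambda>i. if i = a then m1 else m2)"
    using ab arD[OF m1] arD[OF m2] id_right[OF m1] id_right[OF m2] ten_idt V ob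
    by (auto simp: is_cocone_def par_cat_def par_diag_def whisker_diag_def split: if_splits)
  then have "\<exists>!h. h \<in> Hom C (V \<boxtimes> P) M \<and>
      (\<forall>i\<in>Ob ?J. h \<cdot> (V \<rhd> (if i = a then i1 else i2)) = (if i = a then m1 else m2))"
    using L unfolding is_colimit_def by blast
  then show ?thesis using PO ab by (simp add: par_cat_def ar_def)
qed

lemma whisker_biproduct_epic:
  assumes "is_biproduct C X Y P i1 i2 p1 p2" "V \<in> Ob C" and ob: "X \<in> Ob C" "Y \<in> Ob C"
    and h: "ar (V \<boxtimes> P) M h" and k: "ar (V \<boxtimes> P) M k"
    and e: "h \<cdot> (V \<rhd> i1) = k \<cdot> (V \<rhd> i1)" "h \<cdot> (V \<rhd> i2) = k \<cdot> (V \<rhd> i2)"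
  shows "h = k"
proof -
  have i: "ar X P i1" "ar Y P i2" using assms by (auto simp: is_biproduct_def ar_def)
  have "\<exists>!g. ar (V \<boxtimes> P) M g \<and> g \<cdot> (V \<rhd> i1) = k \<cdot> (V \<rhd> i1) \<and> g \<cdot> (V \<rhd> i2) = k \<cdot> (V \<rhd> i2)"
    using whisker_biproduct[OF assms(1,2) ob ar_cmp[OF ar_whisker[OF assms(2) i(1)] k]
      ar_cmp[OF ar_whisker[OF assms(2) i(2)] k]] .
  then show ?thesis by (rule ex1E) (metis h k e)
qed

text \<open>A zero arrow factors through a zero object \<open>Z\<close>. As \<open>Z\<close> is its
  own biproduct with all structure arrows the identity, \<open>V \<boxtimes> Z\<close> is a
  coproduct whose two coprojections are both the identity; so any two arrows out of it
  agree.\<close>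

lemma whisker_zero:
  assumes V: "V \<in> Ob C" and ob: "X \<in> Ob C" "Y \<in> Ob C"
  shows "V \<rhd> zeroA C X Y = zeroA C (V \<boxtimes> X) (V \<boxtimes> Y)"
proof -
  obtain Z where Z: "is_zero_object C Z" using ex_zero_object by blast
  then have ZO: "Z \<in> Ob C" by (simp add: is_zero_object_def)
  have z: "f = g" if "ar Z Z f" "ar Z Z g" for f g using zero_object_ar[OF Z] that by blast
  note i = ar_idt[OF ZO]
  have bp: "is_biproduct C Z Z Z (idt C Z) (idt C Z) (idt C Z) (idt C Z)"
    using ZO i z[OF ar_cmp[OF i i] i] z[OF ar_cmp[OF i i] ar_zero[OF ZO ZO]]
      z[OF ar_add[OF ar_cmp[OF i i] ar_cmp[OF i i]] i] arD by (simp add: is_biproduct_def)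
  note p = ar_zero[OF ob(1) ZO] and q = ar_zero[OF ZO ob(2)]
  note z0 = ar_zero[OF ten_ob[OF V ZO] ten_ob[OF V ob(2)]]
  have eq: "f = g" if f: "ar (V \<boxtimes> Z) M f" and g: "ar (V \<boxtimes> Z) M g" for f g M
  proof -
    obtain h where "ar (V \<boxtimes> Z) M h" "h \<cdot> (V \<rhd> idt C Z) = f" "h \<cdot> (V \<rhd> idt C Z) = g"
      using whisker_biproduct[OF bp V ZO ZO f g] by blast
    then show ?thesis by simp
  qed
  have "V \<rhd> zeroA C X Y = (V \<rhd> zeroA C Z Y) \<cdot> (V \<rhd> zeroA C X Z)"
    using whisker_cmp[OF V p q, symmetric] cmp_zero[OF q ob(1)] by simp
  also have "V \<rhd> zeroA C Z Y = zeroA C (V \<boxtimes> Z) (V \<boxtimes> Y)"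
    using eq[OF ar_whisker[OF V q] z0] .
  finally show ?thesis using zero_cmp[OF ar_whisker[OF V p]] ten_ob V ob by simp
qed

text \<open>
  Additivity of the tensor product is not assumed.  It holds because \<open>V \<otimes> -\<close> preserves the coproduct
  \<open>X \<oplus> X\<close>, through which every sum \<open>f + g\<close> factors as \<open>[f, g] \<cdot> (i\<^sub>1 + i\<^sub>2)\<close>.
\<close>

lemma whisker_add:
  assumes V: "V \<in> Ob C" and f: "ar X Y f" and g: "ar X Y g"
  shows "V \<rhd> addA C f g = addA C (V \<rhd> f) (V \<rhd> g)"
proof -
  have X: "X \<in> Ob C" and Y: "Y \<in> Ob C" using arD f by auto
  obtain P i1 i2 p1 p2 where bp: "is_biproduct C X X P i1 i2 p1 p2"
    using ex_biproduct[OF X X] by blast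
  then have i1: "ar X P i1" and i2: "ar X P i2" and p1: "ar P X p1" and p2: "ar P X p2"
    and e: "p1 \<cdot> i1 = idt C X" "p2 \<cdot> i2 = idt C X" "p1 \<cdot> i2 = zeroA C X X" "p2 \<cdot> i1 = zeroA C X X"
    using X by (auto simp: is_biproduct_def ar_def)
  note wh = ar_whisker[OF V]
  note w = wh[OF i1] wh[OF i2] wh[OF p1] wh[OF p2]
  have PO: "P \<in> Ob C" using arD i1 by blast
  \<comment> \<open>Expanding the whiskering of
    \<open>addA C (i1 \<cdot> p1) (i2 \<cdot> p2)\<close> would presuppose the claim. Instead
    \<open>?E\<close> is compared with the identity on the two whiskered coprojections, which are
    jointly epic.\<close>
  let ?E = "addA C ((V \<rhd> i1) \<cdot> (V \<rhd> p1)) ((V \<rhd> i2) \<cdot> (V \<rhd> p2))"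
  note w11 = ar_cmp[OF w(3) w(1)] and w22 = ar_cmp[OF w(4) w(2)]
  have E: "ar (V \<boxtimes> P) (V \<boxtimes> P) ?E" using ar_add[OF w11 w22] .
  have VX: "V \<boxtimes> X \<in> Ob C" using V X ten_ob by simp
  have E1: "?E \<cdot> (V \<rhd> i1) = V \<rhd> i1"
    using add_left'[OF w(1) w11 w22] assoc[OF w(1) w(3) w(1)] assoc[OF w(1) w(4) w(2)]
      whisker_cmp[OF V i1 p1] whisker_cmp[OF V i1 p2] e whisker_zero[OF V X X] ten_idt[OF V X]
      id_right[OF w(1)] cmp_zero[OF w(2) VX] add_zero[OF w(1)] by simp
  have E2: "?E \<cdot> (V \<rhd> i2) = V \<rhd> i2"
    using add_left'[OF w(2) w11 w22] assoc[OF w(2) w(3) w(1)] assoc[OF w(2) w(4) w(2)]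
      whisker_cmp[OF V i2 p1] whisker_cmp[OF V i2 p2] e whisker_zero[OF V X X] ten_idt[OF V X]
      id_right[OF w(2)] cmp_zero[OF w(1) VX] add_zero[OF w(2)] by simp
  have Eid: "?E = idt C (V \<boxtimes> P)"
    using whisker_biproduct_epic[OF bp V X X E ar_idt[OF ten_ob[OF V PO]]] E1 E2
      id_left[OF w(1)] id_left[OF w(2)] by simp
  let ?d = "addA C i1 i2" and ?h = "addA C (f \<cdot> p1) (g \<cdot> p2)"
  have d: "ar X P ?d" using ar_add i1 i2 .
  have h: "ar P Y ?h" using ar_add[OF ar_cmp[OF p1 f] ar_cmp[OF p2 g]] .
  have pd: "p1 \<cdot> ?d = idt C X" "p2 \<cdot> ?d = idt C X"
    using add_right'[OF i1 i2 p1] add_right'[OF i1 i2 p2] e add_zero[OF ar_idt[OF X]] by simp_all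
  have hi: "?h \<cdot> i1 = f" "?h \<cdot> i2 = g"
    using add_left'[OF i1 ar_cmp[OF p1 f] ar_cmp[OF p2 g]] add_left'[OF i2 ar_cmp[OF p1 f] ar_cmp[OF p2 g]]
      assoc[OF i1 p1 f] assoc[OF i1 p2 g] assoc[OF i2 p1 f] assoc[OF i2 p2 g] e
      id_right[OF f] id_right[OF g] cmp_zero[OF f X] cmp_zero[OF g X] add_zero[OF f] add_zero[OF g]
    by simp_all
  have hd: "?h \<cdot> ?d = addA C f g" using add_right'[OF i1 i2 h] hi by simp
  have "V \<rhd> ?d = ?E \<cdot> (V \<rhd> ?d)" using Eid id_left[OF wh[OF d]] by simp
  also have "\<dots> = addA C ((V \<rhd> i1) \<cdot> ((V \<rhd> p1) \<cdot> (V \<rhd> ?d))) ((V \<rhd> i2) \<cdot> ((V \<rhd> p2) \<cdot> (V \<rhd> ?d)))"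
    using add_left'[OF wh[OF d] w11 w22] assoc[OF wh[OF d] w(3) w(1)] assoc[OF wh[OF d] w(4) w(2)]
    by simp
  also have "\<dots> = addA C (V \<rhd> i1) (V \<rhd> i2)"
    using whisker_cmp[OF V d p1] whisker_cmp[OF V d p2] pd ten_idt[OF V X] id_right[OF w(1)]
      id_right[OF w(2)] by simp
  finally have wd: "V \<rhd> ?d = addA C (V \<rhd> i1) (V \<rhd> i2)" .
  have "V \<rhd> addA C f g = (V \<rhd> ?h) \<cdot> addA C (V \<rhd> i1) (V \<rhd> i2)"
    using whisker_cmp[OF V d h] hd wd by simp
  also have "\<dots> = addA C (V \<rhd> f) (V \<rhd> g)"
    using add_right'[OF w(1) w(2) wh[OF h]] whisker_cmp[OF V i1 h] whisker_cmp[OF V i2 h] hi by simp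
  finally show ?thesis .
qed

end

section \<open>Modules over a commutative monoid object\<close>

lemma module_cat_simps [simp]:
  "N \<in> Ob (module_cat C A) \<longleftrightarrow> is_module C A N"
  "idt (module_cat C A) N = idt C (fst N)"
  "cmp (module_cat C A) = cmp C"
  "addA (module_cat C A) = addA C"
  "zeroA (module_cat C A) N N' = zeroA C (fst N) (fst N')"
  by (simp_all add: module_cat_def)

locale monoid_setting = standing_assumptions U C + comm_monoid_object C A
  for U :: "'u set" and C :: "('o, 'a) monoidal_cat" (structure) and A :: "('o, 'a) monoid_object"
begin

abbreviation "\<M> \<equiv> module_cat C A"
abbreviation "a \<equiv> undO A"
abbreviation "\<R> \<equiv> reg_module A"

lemma ar_mul: "ar (a \<boxtimes> a) a (mulA A)"
  using und_ob mul_in ten_ob by (simp add: ar_def)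

lemma ar_uni: "ar (unitO C) a (uniA A)"
  using und_ob uni_in unit_ob by (simp add: ar_def)

lemma moduleD:
  assumes "is_module C A N"
  shows "fst N \<in> Ob C" "ar (a \<boxtimes> fst N) (fst N) (snd N)"
    "snd N \<cdot> (mulA A \<boxtimes>\<^sub>a idt C (fst N)) = snd N \<cdot> (a \<rhd> snd N) \<cdot> assocA C a a (fst N)"
    "snd N \<cdot> (uniA A \<boxtimes>\<^sub>a idt C (fst N)) = lunitA C (fst N)"
  using assms und_ob ten_ob by (auto simp: is_module_def ar_def split: prod.splits)

lemma module_Hom:
  assumes "is_module C A N" "is_module C A N'"
  shows "f \<in> Hom \<M> N N' \<longleftrightarrow> ar (fst N) (fst N') f \<and> f \<cdot> snd N = snd N' \<cdot> (a \<rhd> f)"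
  using moduleD(1)[OF assms(1)] moduleD(1)[OF assms(2)] by (auto simp: module_cat_def ar_def)

lemma module_category: "category \<M>"
proof
  fix N assume "N \<in> Ob \<M>"
  then have N: "is_module C A N" by simp
  show "idt \<M> N \<in> Hom \<M> N N"
    using moduleD[OF N] ar_idt id_left id_right ten_idt und_ob by (simp add: module_Hom[OF N N])
next
  fix X Y Z f g assume "X \<in> Ob \<M>" "Y \<in> Ob \<M>" "Z \<in> Ob \<M>" and f: "f \<in> Hom \<M> X Y" and g: "g \<in> Hom \<M> Y Z"
  then have X: "is_module C A X" and Y: "is_module C A Y" and Z: "is_module C A Z" by simp_all
  have f': "ar (fst X) (fst Y) f" "f \<cdot> snd X = snd Y \<cdot> (a \<rhd> f)"
    and g': "ar (fst Y) (fst Z) g" "g \<cdot> snd Y = snd Z \<cdot> (a \<rhd> g)"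
    using f g module_Hom[OF X Y] module_Hom[OF Y Z] by auto
  note w = ar_whisker[OF und_ob f'(1)] ar_whisker[OF und_ob g'(1)]
  have "(g \<cdot> f) \<cdot> snd X = (g \<cdot> snd Y) \<cdot> (a \<rhd> f)"
    using assoc[OF moduleD(2)[OF X] f'(1) g'(1)] assoc[OF w(1) moduleD(2)[OF Y] g'(1)] f'(2) by simp
  also have "\<dots> = snd Z \<cdot> (a \<rhd> (g \<cdot> f))"
    using assoc[OF w moduleD(2)[OF Z]] g'(2) whisker_cmp[OF und_ob f'(1) g'(1)] by simp
  finally show "g \<cdot>\<^bsub>\<M>\<^esub> f \<in> Hom \<M> X Z"
    using ar_cmp[OF f'(1) g'(1)] by (simp add: module_Hom[OF X Z])
next
  fix X Y f assume "X \<in> Ob \<M>" "Y \<in> Ob \<M>" "f \<in> Hom \<M> X Y"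
  then show "idt \<M> Y \<cdot>\<^bsub>\<M>\<^esub> f = f" "f \<cdot>\<^bsub>\<M>\<^esub> idt \<M> X = f"
    using id_left[of "fst X" "fst Y" f] id_right[of "fst X" "fst Y" f] by (simp_all add: module_Hom)
next
  fix W X Y Z f g h assume "W \<in> Ob \<M>" "X \<in> Ob \<M>" "Y \<in> Ob \<M>" "Z \<in> Ob \<M>"
    "f \<in> Hom \<M> W X" "g \<in> Hom \<M> X Y" "h \<in> Hom \<M> Y Z"
  then show "(h \<cdot>\<^bsub>\<M>\<^esub> g) \<cdot>\<^bsub>\<M>\<^esub> f = h \<cdot>\<^bsub>\<M>\<^esub> (g \<cdot>\<^bsub>\<M>\<^esub> f)"
    using assoc[of "fst W" "fst X" f "fst Y" g "fst Z" h] by (simp add: module_Hom)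
qed

section \<open>Addition of module homomorphisms\<close>

lemma module_add:
  assumes X: "is_module C A X" and Y: "is_module C A Y" and f: "f \<in> Hom \<M> X Y" and g: "g \<in> Hom \<M> X Y"
  shows "addA C f g \<in> Hom \<M> X Y"
proof -
  have f': "ar (fst X) (fst Y) f" "f \<cdot> snd X = snd Y \<cdot> (a \<rhd> f)"
    and g': "ar (fst X) (fst Y) g" "g \<cdot> snd X = snd Y \<cdot> (a \<rhd> g)"
    using f g module_Hom[OF X Y] by auto
  note w = ar_whisker[OF und_ob f'(1)] ar_whisker[OF und_ob g'(1)]
  show ?thesis
    using add_left'[OF moduleD(2)[OF X] f'(1) g'(1)] add_right'[OF w moduleD(2)[OF Y]] f'(2) g'(2)
      whisker_add[OF und_ob f'(1) g'(1)] ar_add[OF f'(1) g'(1)] by (simp add: module_Hom[OF X Y])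
qed

lemma module_zero:
  assumes X: "is_module C A X" and Y: "is_module C A Y"
  shows "zeroA C (fst X) (fst Y) \<in> Hom \<M> X Y"
proof -
  have ob: "fst X \<in> Ob C" "fst Y \<in> Ob C" using moduleD(1) X Y by auto
  show ?thesis
    using zero_cmp[OF moduleD(2)[OF X] ob(2)] cmp_zero[OF moduleD(2)[OF Y] ten_ob[OF und_ob ob(1)]]
      whisker_zero[OF und_ob ob] ar_zero[OF ob] by (simp add: module_Hom[OF X Y])
qed

text \<open>Both sides of the linearity equation for the sum of \<open>f\<close> and
  \<open>g\<close> are zero, by \<open>whisker_add\<close> and \<open>whisker_zero\<close>.
  Cancelling the equal contributions of \<open>f\<close> leaves the equation for
  \<open>g\<close>.\<close>

lemma module_neg:
  assumes X: "is_module C A X" and Y: "is_module C A Y" and f: "f \<in> Hom \<M> X Y"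
    and g: "ar (fst X) (fst Y) g" and fg: "addA C f g = zeroA C (fst X) (fst Y)"
  shows "g \<in> Hom \<M> X Y"
proof -
  have f': "ar (fst X) (fst Y) f" "f \<cdot> snd X = snd Y \<cdot> (a \<rhd> f)"
    using f module_Hom[OF X Y] by auto
  have ob: "fst X \<in> Ob C" "fst Y \<in> Ob C" using moduleD(1) X Y by auto
  note w = ar_whisker[OF und_ob f'(1)] ar_whisker[OF und_ob g]
  note rX = moduleD(2)[OF X] and rY = moduleD(2)[OF Y]
  have "addA C (f \<cdot> snd X) (g \<cdot> snd X) = zeroA C (a \<boxtimes> fst X) (fst Y)"
    using add_left'[OF rX f'(1) g] fg zero_cmp[OF rX ob(2)] by simp
  moreover have "addA C (snd Y \<cdot> (a \<rhd> f)) (snd Y \<cdot> (a \<rhd> g)) = zeroA C (a \<boxtimes> fst X) (fst Y)"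
    using add_right'[OF w rY] whisker_add[OF und_ob f'(1) g] fg whisker_zero[OF und_ob ob]
      cmp_zero[OF rY ten_ob[OF und_ob ob(1)]] by simp
  ultimately have e: "addA C (f \<cdot> snd X) (g \<cdot> snd X) = addA C (f \<cdot> snd X) (snd Y \<cdot> (a \<rhd> g))"
    using f'(2) by simp
  interpret G: comm_group "hom_group C (a \<boxtimes> fst X) (fst Y)"
    using hom_group ten_ob und_ob ob by blast
  have "g \<cdot> snd X = snd Y \<cdot> (a \<rhd> g)"
    using e G.l_cancel[of "f \<cdot> snd X" "g \<cdot> snd X" "snd Y \<cdot> (a \<rhd> g)"]
      arD(3)[OF ar_cmp[OF rX f'(1)]] arD(3)[OF ar_cmp[OF rX g]] arD(3)[OF ar_cmp[OF w(2) rY]] by simp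
  then show ?thesis using g by (simp add: module_Hom[OF X Y])
qed

lemma module_hom_group:
  assumes X: "is_module C A X" and Y: "is_module C A Y"
  shows "comm_group (hom_group \<M> X Y)"
proof -
  interpret G: comm_group "hom_group C (fst X) (fst Y)"
    using hom_group moduleD(1) X Y by blast
  have sub: "f \<in> Hom C (fst X) (fst Y)" if "f \<in> Hom \<M> X Y" for f
    using that module_Hom[OF X Y] arD by blast
  show ?thesis
  proof (rule comm_groupI)
    fix f g h assume "f \<in> carrier (hom_group \<M> X Y)" "g \<in> carrier (hom_group \<M> X Y)"
      and "h \<in> carrier (hom_group \<M> X Y)"
    then have f: "f \<in> Hom \<M> X Y" and g: "g \<in> Hom \<M> X Y" and h: "h \<in> Hom \<M> X Y" by simp_all
    show "(f \<otimes>\<^bsub>hom_group \<M> X Y\<^esub> g) \<otimes>\<^bsub>hom_group \<M> X Y\<^esub> h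
        = f \<otimes>\<^bsub>hom_group \<M> X Y\<^esub> (g \<otimes>\<^bsub>hom_group \<M> X Y\<^esub> h)"
      using G.m_assoc[of f g h] sub f g h by simp
  next
    fix f g assume "f \<in> carrier (hom_group \<M> X Y)" "g \<in> carrier (hom_group \<M> X Y)"
    then have f: "f \<in> Hom \<M> X Y" and g: "g \<in> Hom \<M> X Y" by simp_all
    show "f \<otimes>\<^bsub>hom_group \<M> X Y\<^esub> g \<in> carrier (hom_group \<M> X Y)"
      using module_add[OF X Y f g] by simp
    show "f \<otimes>\<^bsub>hom_group \<M> X Y\<^esub> g = g \<otimes>\<^bsub>hom_group \<M> X Y\<^esub> f"
      using G.m_comm[of f g] sub f g by simp
  next
    show "\<one>\<^bsub>hom_group \<M> X Y\<^esub> \<in> carrier (hom_group \<M> X Y)"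
      using module_zero[OF X Y] by simp
  next
    fix f assume "f \<in> carrier (hom_group \<M> X Y)"
    then have f: "f \<in> Hom \<M> X Y" by simp
    show "\<one>\<^bsub>hom_group \<M> X Y\<^esub> \<otimes>\<^bsub>hom_group \<M> X Y\<^esub> f = f"
      using G.l_one[of f] sub[OF f] by simp
    let ?g = "inv\<^bsub>hom_group C (fst X) (fst Y)\<^esub> f"
    have g: "?g \<in> Hom C (fst X) (fst Y)" "addA C ?g f = zeroA C (fst X) (fst Y)"
        "addA C f ?g = zeroA C (fst X) (fst Y)"
      using G.inv_closed[of f] G.l_inv[of f] G.r_inv[of f] sub[OF f] by simp_all
    then have "?g \<in> Hom \<M> X Y"
      by (intro module_neg[OF X Y f]) (simp_all add: ar_def moduleD(1) X Y)
    then show "\<exists>g\<in>carrier (hom_group \<M> X Y). g \<otimes>\<^bsub>hom_group \<M> X Y\<^esub> f = \<one>\<^bsub>hom_group \<M> X Y\<^esub>"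
      using g(2) by auto
  qed
qed

sublocale M: preadditive_category \<M>
proof (intro preadditive_category.intro module_category preadditive_category_axioms.intro)
  fix X Y assume "X \<in> Ob \<M>" "Y \<in> Ob \<M>"
  then show "comm_group (hom_group \<M> X Y)" using module_hom_group by simp
next
  fix X Y Z f f' g assume "X \<in> Ob \<M>" "Y \<in> Ob \<M>" "Z \<in> Ob \<M>"
    "f \<in> Hom \<M> X Y" "f' \<in> Hom \<M> X Y" "g \<in> Hom \<M> Y Z"
  then show "g \<cdot>\<^bsub>\<M>\<^esub> addA \<M> f f' = addA \<M> (g \<cdot>\<^bsub>\<M>\<^esub> f) (g \<cdot>\<^bsub>\<M>\<^esub> f')"
    using add_right'[of "fst X" "fst Y" f f' "fst Z" g] by (simp add: module_Hom)
next
  fix X Y Z f g g' assume "X \<in> Ob \<M>" "Y \<in> Ob \<M>" "Z \<in> Ob \<M>"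
    "f \<in> Hom \<M> X Y" "g \<in> Hom \<M> Y Z" "g' \<in> Hom \<M> Y Z"
  then show "addA \<M> g g' \<cdot>\<^bsub>\<M>\<^esub> f = addA \<M> (g \<cdot>\<^bsub>\<M>\<^esub> f) (g' \<cdot>\<^bsub>\<M>\<^esub> f)"
    using add_left'[of "fst X" "fst Y" f "fst Z" g g'] by (simp add: module_Hom)
qed

lemma module_ar:
  "M.ar X Y f \<longleftrightarrow> is_module C A X \<and> is_module C A Y \<and> ar (fst X) (fst Y) f \<and>
     f \<cdot> snd X = snd Y \<cdot> (a \<rhd> f)"
  using module_Hom[of X Y f] by (auto simp: M.ar_def)

lemma reg_module: "is_module C A \<R>"
  using und_ob mul_in mul_assoc mul_lunit by (simp add: is_module_def reg_module_def)

text \<open>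
  An endomorphism \<open>f\<close> satisfies \<open>f \<mu> = \<mu> (1 \<otimes> f) = \<mu> (f \<otimes> 1)\<close>, hence \<open>f g \<mu> = \<mu> (f \<otimes> g) = g f \<mu>\<close>,
  and \<open>\<mu>\<close> is split by the unit.
\<close>

lemma endomorphisms_commute:
  assumes f: "M.ar \<R> \<R> f" and g: "M.ar \<R> \<R> g"
  shows "f \<cdot> g = g \<cdot> f"
proof -
  let ?m = "mulA A"
  have f1: "ar a a f" "f \<cdot> ?m = ?m \<cdot> (a \<rhd> f)" and g1: "ar a a g" "g \<cdot> ?m = ?m \<cdot> (a \<rhd> g)"
    using f g by (auto simp: module_ar reg_module_def)
  note fr = ar_ten[OF f1(1) ar_idt[OF und_ob]] and wf = ar_whisker[OF und_ob f1(1)]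
    and wg = ar_whisker[OF und_ob g1(1)] and b = ar_braid[OF und_ob und_ob]
  have "?m \<cdot> (f \<boxtimes>\<^sub>a idt C a) = (?m \<cdot> braidA C a a) \<cdot> (f \<boxtimes>\<^sub>a idt C a)"
    using mul_comm by simp
  also have "\<dots> = ?m \<cdot> ((a \<rhd> f) \<cdot> braidA C a a)"
    using assoc[OF fr b ar_mul] braid_nat'[OF f1(1) ar_idt[OF und_ob]] by simp
  also have "\<dots> = (f \<cdot> ?m) \<cdot> braidA C a a"
    using assoc[OF b wf ar_mul] f1(2) by simp
  also have "\<dots> = f \<cdot> ?m"
    using assoc[OF b ar_mul f1(1)] mul_comm by simp
  finally have fm: "?m \<cdot> (f \<boxtimes>\<^sub>a idt C a) = f \<cdot> ?m" .
  have "(f \<cdot> g) \<cdot> ?m = (f \<cdot> ?m) \<cdot> (a \<rhd> g)"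
    using assoc[OF ar_mul g1(1) f1(1)] assoc[OF wg ar_mul f1(1)] g1(2) by simp
  also have "\<dots> = ?m \<cdot> (f \<boxtimes>\<^sub>a g)"
    using fm[symmetric] assoc[OF wg fr ar_mul] ten_split2[OF f1(1) g1(1)] by simp
  also have "\<dots> = (g \<cdot> ?m) \<cdot> (f \<boxtimes>\<^sub>a idt C a)"
    using g1(2) assoc[OF fr wg ar_mul] ten_split1[OF f1(1) g1(1)] by simp
  also have "\<dots> = (g \<cdot> f) \<cdot> ?m"
    using fm assoc[OF fr ar_mul g1(1)] assoc[OF ar_mul f1(1) g1(1)] by simp
  finally have e: "(f \<cdot> g) \<cdot> ?m = (g \<cdot> f) \<cdot> ?m" .
  obtain k where k: "ar a (unitO C \<boxtimes> a) k" "lunitA C a \<cdot> k = idt C a"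
    using is_isoE[OF lunit_iso[OF und_ob] ten_ob[OF unit_ob und_ob] und_ob] by metis
  have ua: "ar (unitO C \<boxtimes> a) (a \<boxtimes> a) (uniA A \<boxtimes>\<^sub>a idt C a)"
    using ar_ten[OF ar_uni ar_idt[OF und_ob]] .
  let ?s = "(uniA A \<boxtimes>\<^sub>a idt C a) \<cdot> k"
  have s: "ar a (a \<boxtimes> a) ?s" using ar_cmp[OF k(1) ua] .
  have ms: "?m \<cdot> ?s = idt C a" using assoc[OF k(1) ua ar_mul] mul_lunit k(2) by simp
  have "h = (h \<cdot> ?m) \<cdot> ?s" if "ar a a h" for h
    using assoc[OF s ar_mul that] ms id_right[OF that] by simp
  then show ?thesis using e ar_cmp[OF f1(1) g1(1)] ar_cmp[OF g1(1) f1(1)] by metis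
qed

section \<open>Kernels and colimits of modules\<close>

text \<open>The kernel in \<open>C\<close> carries an action: the action of \<open>X\<close>
  restricted along \<open>k\<close> is killed by the linear \<open>f\<close>, so it factors through
  \<open>k\<close>. The module axioms, and linearity of mediating arrows, follow by cancelling the
  monomorphism \<open>k\<close>; no exactness of the tensor product enters.\<close>

lemma module_kernel:
  assumes f: "M.ar X Y f"
  obtains K k where "is_kernel \<M> X Y f K k"
proof -
  have X: "is_module C A X" and Y: "is_module C A Y"
    and fa: "ar (fst X) (fst Y) f" and fl: "f \<cdot> snd X = snd Y \<cdot> (a \<rhd> f)"
    using f by (auto simp: module_ar)
  note rX = moduleD(2)[OF X] and rY = moduleD(2)[OF Y]
  obtain K k where K: "is_kernel C (fst X) (fst Y) f K k"
    using ex_kernel[of "fst X" "fst Y" f] fa by (auto simp: ar_def)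
  then have KO: "K \<in> Ob C" and ka: "ar K (fst X) k" and fk: "f \<cdot> k = zeroA C K (fst Y)"
    using fa by (auto simp: is_kernel_def ar_def)
  have univ: "\<exists>!h. ar W K h \<and> k \<cdot> h = g" if "ar W (fst X) g" "f \<cdot> g = zeroA C W (fst Y)" for W g
    using K that by (auto simp: is_kernel_def ar_def)
  have mono: "g = h" if g: "ar W K g" and h: "ar W K h" and e: "k \<cdot> g = k \<cdot> h" for W g h
  proof -
    have "f \<cdot> (k \<cdot> h) = zeroA C W (fst Y)"
      using assoc[OF h ka fa] fk zero_cmp[OF h] fa by (simp add: ar_def)
    then show ?thesis using univ[OF ar_cmp[OF h ka]] g h e by blast
  qed
  note wk = ar_whisker[OF und_ob ka] and wf = ar_whisker[OF und_ob fa]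
  have "f \<cdot> (snd X \<cdot> (a \<rhd> k)) = snd Y \<cdot> (a \<rhd> (f \<cdot> k))"
    using assoc[OF wk rX fa] fl assoc[OF wk wf rY] whisker_cmp[OF und_ob ka fa] by simp
  also have "\<dots> = zeroA C (a \<boxtimes> K) (fst Y)"
    using fk whisker_zero[OF und_ob KO moduleD(1)[OF Y]] cmp_zero[OF rY ten_ob[OF und_ob KO]] by simp
  finally obtain r where r: "ar (a \<boxtimes> K) K r" and kr: "k \<cdot> r = snd X \<cdot> (a \<rhd> k)"
    using univ[OF ar_cmp[OF wk rX]] by blast
  note wr = ar_whisker[OF und_ob r] and wX = ar_whisker[OF und_ob rX]
  have aa: "a \<boxtimes> a \<in> Ob C" using ten_ob und_ob by simp
  note mK = ar_ten[OF ar_mul ar_idt[OF KO]] and mX = ar_ten[OF ar_mul ar_idt[OF moduleD(1)[OF X]]]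
  note wwk = ar_whisker[OF aa ka] and w2k = ar_whisker[OF und_ob wk]
  note aK = ar_assoc[OF und_ob und_ob KO] and aX = ar_assoc[OF und_ob und_ob moduleD(1)[OF X]]
  \<comment> \<open>Composed with \<open>k\<close>, associativity of \<open>r\<close> reduces to
    that of the action of \<open>X\<close>; interchange and naturality of the associator carry
    \<open>k\<close> across.\<close>
  have "k \<cdot> (r \<cdot> (mulA A \<boxtimes>\<^sub>a idt C K)) = (snd X \<cdot> (a \<rhd> k)) \<cdot> (mulA A \<boxtimes>\<^sub>a idt C K)"
    using assoc[OF mK r ka] kr by simp
  also have "\<dots> = snd X \<cdot> (mulA A \<boxtimes>\<^sub>a k)"
    using assoc[OF mK wk rX] ten_split1[OF ar_mul ka] by simp
  also have "\<dots> = (snd X \<cdot> (mulA A \<boxtimes>\<^sub>a idt C (fst X))) \<cdot> ((a \<boxtimes> a) \<rhd> k)"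
    using assoc[OF wwk mX rX] ten_split2[OF ar_mul ka] by simp
  also have "\<dots> = (snd X \<cdot> (a \<rhd> snd X)) \<cdot> (assocA C a a (fst X) \<cdot> ((a \<boxtimes> a) \<rhd> k))"
    using moduleD(3)[OF X] assoc[OF wwk ar_cmp[OF aX wX] rX] assoc[OF wwk aX wX]
      assoc[OF ar_cmp[OF wwk aX] wX rX] by simp
  also have "assocA C a a (fst X) \<cdot> ((a \<boxtimes> a) \<rhd> k) = (a \<rhd> (a \<rhd> k)) \<cdot> assocA C a a K"
    using assoc_nat[of a a a a K "fst X" "idt C a" "idt C a" k] und_ob KO moduleD(1)[OF X]
      idt_in arD(3)[OF ka] ten_idt[OF und_ob und_ob] by simp
  also have "(snd X \<cdot> (a \<rhd> snd X)) \<cdot> ((a \<rhd> (a \<rhd> k)) \<cdot> assocA C a a K)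
      = (snd X \<cdot> (a \<rhd> (snd X \<cdot> (a \<rhd> k)))) \<cdot> assocA C a a K"
    using assoc[OF aK w2k ar_cmp[OF wX rX]] assoc[OF w2k wX rX] whisker_cmp[OF und_ob wk rX] by simp
  also have "\<dots> = ((snd X \<cdot> (a \<rhd> k)) \<cdot> (a \<rhd> r)) \<cdot> assocA C a a K"
    using kr[symmetric] whisker_cmp[OF und_ob r ka] assoc[OF wr wk rX] by simp
  also have "\<dots> = k \<cdot> (r \<cdot> (a \<rhd> r) \<cdot> assocA C a a K)"
    using kr[symmetric] assoc[OF aK wr ar_cmp[OF r ka]] assoc[OF ar_cmp[OF aK wr] r ka] by simp
  finally have ax1: "r \<cdot> (mulA A \<boxtimes>\<^sub>a idt C K) = r \<cdot> (a \<rhd> r) \<cdot> assocA C a a K"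
    by (rule mono[OF ar_cmp[OF mK r] ar_cmp[OF ar_cmp[OF aK wr] r]])
  note uK = ar_ten[OF ar_uni ar_idt[OF KO]] and uX = ar_ten[OF ar_uni ar_idt[OF moduleD(1)[OF X]]]
  note w1k = ar_whisker[OF unit_ob ka]
  have "k \<cdot> (r \<cdot> (uniA A \<boxtimes>\<^sub>a idt C K)) = (snd X \<cdot> (a \<rhd> k)) \<cdot> (uniA A \<boxtimes>\<^sub>a idt C K)"
    using assoc[OF uK r ka] kr by simp
  also have "\<dots> = snd X \<cdot> (uniA A \<boxtimes>\<^sub>a k)"
    using assoc[OF uK wk rX] ten_split1[OF ar_uni ka] by simp
  also have "\<dots> = (snd X \<cdot> (uniA A \<boxtimes>\<^sub>a idt C (fst X))) \<cdot> (unitO C \<rhd> k)"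
    using assoc[OF w1k uX rX] ten_split2[OF ar_uni ka] by simp
  also have "\<dots> = k \<cdot> lunitA C K"
    using moduleD(4)[OF X] lunit_nat[OF KO moduleD(1)[OF X] arD(3)[OF ka]] by simp
  finally have ax2: "r \<cdot> (uniA A \<boxtimes>\<^sub>a idt C K) = lunitA C K"
    by (rule mono[OF ar_cmp[OF uK r] ar_lunit[OF KO]])
  have KM: "is_module C A (K, r)"
    using KO arD(3)[OF r] ax1 ax2 by (simp add: is_module_def)
  have kM: "M.ar (K, r) X k" using KM X ka kr by (simp add: module_ar)
  have "\<exists>!h. h \<in> Hom \<M> W (K, r) \<and> k \<cdot>\<^bsub>\<M>\<^esub> h = g"
    if "W \<in> Ob \<M>" "g \<in> Hom \<M> W X" "f \<cdot>\<^bsub>\<M>\<^esub> g = zeroA \<M> W Y" for W g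
  proof -
    have W: "is_module C A W" and ga: "ar (fst W) (fst X) g" and gl: "g \<cdot> snd W = snd X \<cdot> (a \<rhd> g)"
      and fg: "f \<cdot> g = zeroA C (fst W) (fst Y)"
      using that X by (auto simp: module_Hom)
    note rW = moduleD(2)[OF W]
    obtain h where h: "ar (fst W) K h" and kh: "k \<cdot> h = g" using univ[OF ga fg] by blast
    note wh = ar_whisker[OF und_ob h]
    have "k \<cdot> (h \<cdot> snd W) = snd X \<cdot> (a \<rhd> (k \<cdot> h))"
      using assoc[OF rW h ka] kh gl by simp
    also have "\<dots> = k \<cdot> (r \<cdot> (a \<rhd> h))"
      using whisker_cmp[OF und_ob h ka] assoc[OF wh wk rX] kr[symmetric] assoc[OF wh r ka] by simp
    finally have "h \<cdot> snd W = r \<cdot> (a \<rhd> h)"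
      by (rule mono[OF ar_cmp[OF rW h] ar_cmp[OF wh r]])
    then have "h \<in> Hom \<M> W (K, r)" using h by (simp add: module_Hom[OF W KM])
    moreover have "h' = h" if "h' \<in> Hom \<M> W (K, r)" "k \<cdot> h' = g" for h'
      using mono[of "fst W" h' h] h kh that by (simp add: module_Hom[OF W KM])
    ultimately show ?thesis using kh by auto
  qed
  then have "is_kernel \<M> X Y f (K, r) k"
    using KM M.arD(3)[OF kM] fk unfolding is_kernel_def by simp
  then show ?thesis using that by blast
qed

lemma forget_functor:
  assumes "is_functor J \<M> D"
  shows "is_functor J C \<lparr>dob = (\<lambda>i. fst (dob D i)), dar = dar D\<rparr>"
proof -
  have "is_module C A (dob D i)" if "i \<in> Ob J" for i using assms that by (simp add: is_functor_def)
  then show ?thesis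
    using assms category_axioms unfolding is_functor_def
    by (auto simp: moduleD(1) module_Hom ar_def)
qed

text \<open>The colimit is formed in \<open>C\<close>. Because \<open>a \<boxtimes> -\<close>
  preserves it, the actions on the \<open>dob D i\<close> induce an action on
  \<open>L\<close>.\<close>

lemma module_has_small_colimits: "has_small_colimits U \<M>"
  unfolding has_small_colimits_def
proof (intro allI impI, elim conjE)
  fix J :: "('u, 'u) cat" and D assume J: "small_cat U J" and D: "is_functor J \<M> D"
  let ?D = "\<lparr>dob = (\<lambda>i. fst (dob D i)), dar = dar D\<rparr>"
  have F: "is_functor J C ?D" using forget_functor[OF D] .
  obtain L l where L: "is_colimit J C ?D L l"
    using small_colimits J F unfolding has_small_colimits_def by blast
  then have cc: "is_cocone J C ?D L l" by (simp add: is_colimit_def)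
  then have LO: "L \<in> Ob C" by (simp add: is_cocone_def)
  have Dm: "is_module C A (dob D i)" if "i \<in> Ob J" for i using D that by (simp add: is_functor_def)
  note Di = moduleD(1)[OF Dm] and rD = moduleD(2)[OF Dm]
  have la: "ar (fst (dob D i)) L (l i)" if "i \<in> Ob J" for i using cocone_ar[OF cc F that] by simp
  have DH: "ar (fst (dob D i)) (fst (dob D j)) (dar D i j u)"
      "dar D i j u \<cdot> snd (dob D i) = snd (dob D j) \<cdot> (a \<rhd> dar D i j u)"
    if "i \<in> Ob J" "j \<in> Ob J" "u \<in> Hom J i j" for i j u
    using M.functor_ar[OF D that] by (auto simp: module_ar)
  have lD: "l j \<cdot> dar D i j u = l i" if "i \<in> Ob J" "j \<in> Ob J" "u \<in> Hom J i j" for i j u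
    using cocone_eq[OF cc that] by simp
  \<comment> \<open>Stated for all \<open>V\<close>: associativity of the new action is tested with
    \<open>V = a \<boxtimes> a\<close>, the unit law with \<open>V = unitO C\<close>, and linearity
    of mediating arrows with \<open>V = a\<close>.\<close>
  have epic: "g = h" if "V \<in> Ob C" "ar (V \<boxtimes> L) M g" "ar (V \<boxtimes> L) M h"
    "\<And>i. i \<in> Ob J \<Longrightarrow> g \<cdot> (V \<rhd> l i) = h \<cdot> (V \<rhd> l i)" for V M g h
    using colimit_jointly_epic[OF whisker_colimit[OF that(1) J F L] that(2,3) _ whisker_diag_functor[OF that(1) F]]
      that(4) by blast
  note wl = ar_whisker[OF und_ob la]
  have "is_cocone J C (whisker_diag C a ?D) L (\<lambda>i. l i \<cdot> snd (dob D i))"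
    unfolding is_cocone_def
  proof (intro conjI ballI)
    show "L \<in> Ob C" by fact
    fix i assume i: "i \<in> Ob J"
    show "l i \<cdot> snd (dob D i) \<in> Hom C (dob (whisker_diag C a ?D) i) L"
      using arD(3)[OF ar_cmp[OF rD[OF i] la[OF i]]] by (simp add: whisker_diag_def)
    fix j u assume j: "j \<in> Ob J" and u: "u \<in> Hom J i j"
    note d = DH[OF i j u]
    have "(l j \<cdot> snd (dob D j)) \<cdot> (a \<rhd> dar D i j u) = l i \<cdot> snd (dob D i)"
      using assoc[OF ar_whisker[OF und_ob d(1)] rD[OF j] la[OF j]] d(2)[symmetric]
        assoc[OF rD[OF i] d(1) la[OF j]] lD[OF i j u] by simp
    then show "(l j \<cdot> snd (dob D j)) \<cdot> dar (whisker_diag C a ?D) i j u = l i \<cdot> snd (dob D i)"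
      by (simp add: whisker_diag_def)
  qed
  then obtain r where r: "ar (a \<boxtimes> L) L r"
    and rl: "\<And>i. i \<in> Ob J \<Longrightarrow> r \<cdot> (a \<rhd> l i) = l i \<cdot> snd (dob D i)"
    by (rule colimitE[OF whisker_colimit[OF und_ob J F L]]) blast
  note wr = ar_whisker[OF und_ob r]
  have aa: "a \<boxtimes> a \<in> Ob C" using ten_ob und_ob by simp
  note mL = ar_ten[OF ar_mul ar_idt[OF LO]] and aL = ar_assoc[OF und_ob und_ob LO]
    and uL = ar_ten[OF ar_uni ar_idt[OF LO]]
  have ax1: "r \<cdot> (mulA A \<boxtimes>\<^sub>a idt C L) = r \<cdot> (a \<rhd> r) \<cdot> assocA C a a L"
  proof (rule epic[OF aa ar_cmp[OF mL r] ar_cmp[OF ar_cmp[OF aL wr] r]])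
    fix i assume i: "i \<in> Ob J"
    note ri = rD[OF i] and li = la[OF i] and Xi = Di[OF i]
    note wli = ar_whisker[OF und_ob li] and wri = ar_whisker[OF und_ob ri]
    note wwl = ar_whisker[OF aa li] and w2l = ar_whisker[OF und_ob wli]
    note mi = ar_ten[OF ar_mul ar_idt[OF Xi]] and ai = ar_assoc[OF und_ob und_ob Xi]
    have nat: "assocA C a a L \<cdot> ((a \<boxtimes> a) \<rhd> l i) = (a \<rhd> (a \<rhd> l i)) \<cdot> assocA C a a (fst (dob D i))"
      using assoc_nat[of a a a a "fst (dob D i)" L "idt C a" "idt C a" "l i"] und_ob LO Xi
        idt_in arD(3)[OF li] ten_idt[OF und_ob und_ob] by simp
    have "(r \<cdot> (mulA A \<boxtimes>\<^sub>a idt C L)) \<cdot> ((a \<boxtimes> a) \<rhd> l i) = r \<cdot> (mulA A \<boxtimes>\<^sub>a l i)"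
      using assoc[OF wwl mL r] ten_split2[OF ar_mul li] by simp
    also have "\<dots> = (r \<cdot> (a \<rhd> l i)) \<cdot> (mulA A \<boxtimes>\<^sub>a idt C (fst (dob D i)))"
      using assoc[OF mi wli r] ten_split1[OF ar_mul li] by simp
    also have "\<dots> = l i \<cdot> (snd (dob D i) \<cdot> (a \<rhd> snd (dob D i)) \<cdot> assocA C a a (fst (dob D i)))"
      using rl[OF i] assoc[OF mi ri li] moduleD(3)[OF Dm[OF i]] by simp
    also have "\<dots> = ((l i \<cdot> snd (dob D i)) \<cdot> (a \<rhd> snd (dob D i))) \<cdot> assocA C a a (fst (dob D i))"
      using assoc[OF ar_cmp[OF ai wri] ri li] assoc[OF ai wri ar_cmp[OF ri li]] by simp
    also have "(l i \<cdot> snd (dob D i)) \<cdot> (a \<rhd> snd (dob D i)) = r \<cdot> (a \<rhd> (r \<cdot> (a \<rhd> l i)))"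
      using rl[OF i] whisker_cmp[OF und_ob ri li] assoc[OF wri wli r] by simp
    also have "\<dots> = (r \<cdot> (a \<rhd> r)) \<cdot> (a \<rhd> (a \<rhd> l i))"
      using whisker_cmp[OF und_ob wli r] assoc[OF w2l wr r] by simp
    also have "((r \<cdot> (a \<rhd> r)) \<cdot> (a \<rhd> (a \<rhd> l i))) \<cdot> assocA C a a (fst (dob D i))
        = (r \<cdot> (a \<rhd> r)) \<cdot> (assocA C a a L \<cdot> ((a \<boxtimes> a) \<rhd> l i))"
      using assoc[OF ai w2l ar_cmp[OF wr r]] nat by simp
    also have "\<dots> = (r \<cdot> (a \<rhd> r) \<cdot> assocA C a a L) \<cdot> ((a \<boxtimes> a) \<rhd> l i)"
      using assoc[OF ar_cmp[OF wwl aL] wr r] assoc[OF wwl aL wr] assoc[OF wwl ar_cmp[OF aL wr] r] by simp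
    finally show "(r \<cdot> (mulA A \<boxtimes>\<^sub>a idt C L)) \<cdot> ((a \<boxtimes> a) \<rhd> l i)
        = (r \<cdot> (a \<rhd> r) \<cdot> assocA C a a L) \<cdot> ((a \<boxtimes> a) \<rhd> l i)" .
  qed
  have ax2: "r \<cdot> (uniA A \<boxtimes>\<^sub>a idt C L) = lunitA C L"
  proof (rule epic[OF unit_ob ar_cmp[OF uL r] ar_lunit[OF LO]])
    fix i assume i: "i \<in> Ob J"
    note ri = rD[OF i] and li = la[OF i] and Xi = Di[OF i]
    note wli = ar_whisker[OF und_ob li] and w1l = ar_whisker[OF unit_ob li]
    note ui = ar_ten[OF ar_uni ar_idt[OF Xi]]
    have "(r \<cdot> (uniA A \<boxtimes>\<^sub>a idt C L)) \<cdot> (unitO C \<rhd> l i) = r \<cdot> (uniA A \<boxtimes>\<^sub>a l i)"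
      using assoc[OF w1l uL r] ten_split2[OF ar_uni li] by simp
    also have "\<dots> = (r \<cdot> (a \<rhd> l i)) \<cdot> (uniA A \<boxtimes>\<^sub>a idt C (fst (dob D i)))"
      using assoc[OF ui wli r] ten_split1[OF ar_uni li] by simp
    also have "\<dots> = l i \<cdot> lunitA C (fst (dob D i))"
      using rl[OF i] assoc[OF ui ri li] moduleD(4)[OF Dm[OF i]] by simp
    also have "\<dots> = lunitA C L \<cdot> (unitO C \<rhd> l i)"
      using lunit_nat[OF Xi LO arD(3)[OF li]] by simp
    finally show "(r \<cdot> (uniA A \<boxtimes>\<^sub>a idt C L)) \<cdot> (unitO C \<rhd> l i) = lunitA C L \<cdot> (unitO C \<rhd> l i)" .
  qed
  have LM: "is_module C A (L, r)" using LO arD(3)[OF r] ax1 ax2 by (simp add: is_module_def)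
  have "is_cocone J \<M> D (L, r) l"
    using LM Dm la rl lD by (simp add: is_cocone_def module_Hom)
  moreover have "\<exists>!h. h \<in> Hom \<M> (L, r) N \<and> (\<forall>i\<in>Ob J. h \<cdot>\<^bsub>\<M>\<^esub> l i = m i)"
    if m: "is_cocone J \<M> D N m" for N m
  proof -
    have N: "is_module C A N" using m by (simp add: is_cocone_def)
    note rN = moduleD(2)[OF N]
    have ma: "ar (fst (dob D i)) (fst N) (m i)" "m i \<cdot> snd (dob D i) = snd N \<cdot> (a \<rhd> m i)"
      if "i \<in> Ob J" for i using M.cocone_ar[OF m D that] by (auto simp: module_ar)
    have "is_cocone J C ?D (fst N) m"
      using m N moduleD(1) ma(1) by (simp add: is_cocone_def ar_def)
    then obtain h where h: "ar L (fst N) h" and hl: "\<And>i. i \<in> Ob J \<Longrightarrow> h \<cdot> l i = m i"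
      and hu: "\<And>k. \<lbrakk>ar L (fst N) k; \<And>i. i \<in> Ob J \<Longrightarrow> k \<cdot> l i = m i\<rbrakk> \<Longrightarrow> k = h"
      by (rule colimitE[OF L]) blast
    note wh = ar_whisker[OF und_ob h]
    have "h \<cdot> r = snd N \<cdot> (a \<rhd> h)"
    proof (rule epic[OF und_ob ar_cmp[OF r h] ar_cmp[OF wh rN]])
      fix i assume i: "i \<in> Ob J"
      note ri = rD[OF i] and li = la[OF i]
      note wli = ar_whisker[OF und_ob li]
      show "(h \<cdot> r) \<cdot> (a \<rhd> l i) = (snd N \<cdot> (a \<rhd> h)) \<cdot> (a \<rhd> l i)"
        using assoc[OF wli r h] rl[OF i] assoc[OF ri li h] hl[OF i] ma(2)[OF i]
          assoc[OF wli wh rN] whisker_cmp[OF und_ob li h] by simp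
    qed
    then have hM: "h \<in> Hom \<M> (L, r) N" using h by (simp add: module_Hom[OF LM N])
    show ?thesis
    proof (rule ex1I[of _ h])
      show "h \<in> Hom \<M> (L, r) N \<and> (\<forall>i\<in>Ob J. h \<cdot>\<^bsub>\<M>\<^esub> l i = m i)" using hM hl by simp
      fix k assume k: "k \<in> Hom \<M> (L, r) N \<and> (\<forall>i\<in>Ob J. k \<cdot>\<^bsub>\<M>\<^esub> l i = m i)"
      show "k = h"
      proof (rule hu)
        show "ar L (fst N) k" using k by (simp add: module_Hom[OF LM N])
        show "k \<cdot> l i = m i" if "i \<in> Ob J" for i using k that by simp
      qed
    qed
  qed
  ultimately show "\<exists>L l. is_colimit J \<M> D L l" unfolding is_colimit_def by blast
qed

end

theorem proposition3p4:
  fixes U :: "'u set"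
    and C :: "('o, 'a) monoidal_cat"
    and A :: "('o, 'a) monoid_object"
  assumes "standing_assumptions U C"
    and "comm_monoid_object C A"
    and "noetherian_monoid U C A"
  shows "cring (end_ring C A) \<and> noetherian_ring (end_ring C A)"
proof -
  interpret monoid_setting U C A
    using assms(1,2) by (rule monoid_setting.intro)
  have E: "end_ring C A = endo_ring \<M> \<R>" by (simp add: end_ring_def endo_ring_def Let_def)
  have R: "\<R> \<in> Ob \<M>" using reg_module by simp
  have cring: "cring (endo_ring \<M> \<R>)"
    using M.endo_ring_cring[OF R] endomorphisms_commute by simp
  \<comment> \<open>(C1) speaks of powers of \<open>\<R>\<close>. The diagrams of the joint
    cokernels involve the first power, which is \<open>\<R>\<close> itself with the identity as
    coprojection.\<close>
  have "is_power \<M> \<R> 1 \<R>"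
    unfolding is_power_def
  proof (intro conjI exI[of _ "\<lambda>_. idt \<M> \<R>"] allI impI ballI)
    show "\<R> \<in> Ob \<M>" by (rule R)
    show "idt \<M> \<R> \<in> Hom \<M> \<R> \<R>" using M.idt_in[OF R] .
    fix Y and f :: "nat \<Rightarrow> 'a" assume Y: "Y \<in> Ob \<M>" and f: "\<forall>k<1. f k \<in> Hom \<M> \<R> Y"
    then show "\<exists>!h. h \<in> Hom \<M> \<R> Y \<and> (\<forall>k<1. h \<cdot>\<^bsub>\<M>\<^esub> idt \<M> \<R> = f k)"
      using M.idt_right[OF R Y] by (intro ex1I[of _ "f 0"]) auto
  qed
  then have power: "\<exists>r. is_power \<M> \<R> r \<R>" by blast
  have C1: "hom_preserves_additive_colimit \<M> \<R> J D L l"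
    if "finite_cat J" "is_functor J \<M> D" "\<And>i. i \<in> Ob J \<Longrightarrow> dob D i = \<R>" "is_colimit J \<M> D L l"
    for J :: "('u, 'u) cat" and D L l
    using C1_free[OF assms(2) that(1,2) _ that(4)] that(3) power by simp
  have "noetherian_ring (endo_ring \<M> \<R>)"
  proof (rule M.noetherian_endo_ring[OF R universe_uncountable module_has_small_colimits _ _ _ cring C1])
    show "\<exists>K k. is_kernel \<M> X Y f K k" if "M.ar X Y f" for X Y f
      using module_kernel[OF that] by blast
    show "filtered_colimits_commute_with_finite_limits U \<M>"
      using filtered_colimits_exact assms(2) .
    show "finitely_generated U \<M> N" if "N \<in> Ob \<M>" "is_mono \<M> N \<R> m" for N m
      using assms(3) that unfolding noetherian_monoid_def by blast
  qed
  then show ?thesis using cring E by simp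
qed

end
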